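(* Let $V$ be a self-dual, simple vertex operator algebra of CFT-type. Assume that $V$ has two commuting automorphisms $f$ and $h$ of order $p$. For $i,j\in\mathbb{Z}$ set $$V^{i,j}=\{v\in V\mid f(v)=\xi^iv,\ h(v)=\xi^jv\},\qquad \xi=\exp(2\pi\sqrt{-1}/p),\qquad V^i=\bigoplus_{j=0}^{p-1}V^{i,j}.$$ Assume the following: (A) there exists an anti-linear involution $\phi$ of $V^0$ such that $(V^0,\phi)$ is a unitary vertex operator algebra; (B) for each $i\in\{1,\dots,p-1\}$, $V^i$ is a unitary $(V^0,\phi)$-module; (C) there exists an automorphism $\psi\in\operatorname{Aut}(V)$ such that $\psi^{-1}f\psi=h$; (D) for this $\psi$, $\psi(V^{0,0})=V^{0,0}$ and $\psi\phi\psi^{-1}=\phi$ on $V^{0,0}$. Then there exists an anti-linear involution $\Phi$ of $V$ such that $(V,\Phi)$ is a unitary vertex operator algebra.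
   Context: Vertex operator algebras (VOAs) are over $\mathbb{C}$, with vacuum $\mathbf{1}$, conformal vector $\omega$, $Y(\omega,z)=\sum_{n}L(n)z^{-n-2}$ and $Y(u,z)=\sum_{n\in\mathbb{Z}}u_nz^{-n-1}$. Self-dual means $V$ is isomorphic to its contragredient module; CFT-type means $V=\bigoplus_{n\ge0}V_n$ with $V_0=\mathbb{C}\mathbf 1$. Here $p$ is a positive integer. An anti-linear involution of a VOA $U$ is an anti-linear bijection $\phi:U\to U$ of order $2$ with $\phi(\mathbf 1)=\mathbf 1$, $\phi(\omega)=\omega$, $\phi(u_nv)=\phi(u)_n\phi(v)$ for all $u,v\in U$, $n\in\mathbb{Z}$. The pair $(U,\phi)$ is a unitary VOA if there is a positive-definite Hermitian form $(\cdot,\cdot)_U$ on $U$ ($\mathbb{C}$-linear in the first variable, anti-linear in the second) such that for all $a,u,v\in U$ $$(Y(e^{zL(1)}(-z^{-2})^{L(0)}a,z^{-1})u,v)_U=(u,Y(\phi(a),z)v)_U.$$ An (ordinary) module $(M,Y_M)$ over a unitary VOA $(U,\phi)$ is a unitary $(U,\phi)$-module if there is a positive-definite Hermitian form $(\cdot,\cdot)_M$ on $M$ with $$(Y_M(e^{zL(1)}(-z^{-2})^{L(0)}a,z^{-1})w_1,w_2)_M=(w_1,Y_M(\phi(a),z)w_2)_M\quad\text{for all }a\in U,\ w_1,w_2\in M.$$ The formal variable $z$ is treated as real (not conjugated) in these identities. *)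

theory Defs
  imports
    Complex_Main
    "HOL-Library.Groups_Big_Fun"
    "HOL-Library.Function_Algebras"
begin

text \<open>
  Vector spaces are subspaces (carriers) of an ambient complex vector space, so that subalgebras and
  submodules live on the same type; the values of maps outside the carriers are irrelevant.
  \<^const>\<open>Sum_any\<close> is the sum over the finite support of a function. All such sums below
  have finite support when the axioms of a vertex operator algebra hold.
\<close>

definition linear_on ::
  "(complex \<Rightarrow> 'a \<Rightarrow> 'a) \<Rightarrow> (complex \<Rightarrow> 'b \<Rightarrow> 'b) \<Rightarrow> 'a set \<Rightarrow> ('a::ab_group_add \<Rightarrow> 'b::ab_group_add) \<Rightarrow> bool"
  where
  "linear_on s t A T \<longleftrightarrow>
     (\<forall>x\<in>A. \<forall>y\<in>A. T (x + y) = T x + T y) \<and> (\<forall>c. \<forall>x\<in>A. T (s c x) = t c (T x))"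

definition antilinear_on ::
  "(complex \<Rightarrow> 'a \<Rightarrow> 'a) \<Rightarrow> (complex \<Rightarrow> 'b \<Rightarrow> 'b) \<Rightarrow> 'a set \<Rightarrow> ('a::ab_group_add \<Rightarrow> 'b::ab_group_add) \<Rightarrow> bool"
  where
  "antilinear_on s t A T \<longleftrightarrow>
     (\<forall>x\<in>A. \<forall>y\<in>A. T (x + y) = T x + T y) \<and> (\<forall>c. \<forall>x\<in>A. T (s c x) = t (cnj c) (T x))"

definition has_order_on :: "'a set \<Rightarrow> ('a \<Rightarrow> 'a) \<Rightarrow> nat \<Rightarrow> bool" where
  "has_order_on A g k \<longleftrightarrow>
     0 < k \<and> (\<forall>x\<in>A. (g ^^ k) x = x) \<and> (\<forall>m. 0 < m \<and> m < k \<longrightarrow> (\<exists>x\<in>A. (g ^^ m) x \<noteq> x))"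


section \<open>Vertex operator algebras\<close>

text \<open>\<open>mode V u n v\<close> is \<open>u\<^sub>n v\<close>, where \<open>Y(u,z) = \<Sum>n. u\<^sub>n z\<^sup>-\<^sup>n\<^sup>-\<^sup>1\<close>.\<close>

record 'v voa_data =
  carr :: "'v set"
  scal :: "complex \<Rightarrow> 'v \<Rightarrow> 'v"
  vac :: 'v
  conf :: 'v
  mode :: "'v \<Rightarrow> int \<Rightarrow> 'v \<Rightarrow> 'v"

record ('v, 'm) module_data =
  mcarr :: "'m set"
  mscal :: "complex \<Rightarrow> 'm \<Rightarrow> 'm"
  mmode :: "'v \<Rightarrow> int \<Rightarrow> 'm \<Rightarrow> 'm"

definition adjoint_module :: "'v voa_data \<Rightarrow> ('v, 'v) module_data" where
  "adjoint_module V = \<lparr>mcarr = carr V, mscal = scal V, mmode = mode V\<rparr>"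

definition restrict_voa :: "'v voa_data \<Rightarrow> 'v set \<Rightarrow> 'v voa_data" where
  "restrict_voa V A = V\<lparr>carr := A\<rparr>"

definition restrict_module :: "'v voa_data \<Rightarrow> 'v set \<Rightarrow> ('v, 'v) module_data" where
  "restrict_module V A = (adjoint_module V)\<lparr>mcarr := A\<rparr>"

definition Vir :: "'v voa_data \<Rightarrow> int \<Rightarrow> 'v \<Rightarrow> 'v" where
  "Vir V n = mode V (conf V) (n + 1)"

definition weight_space :: "'v voa_data \<Rightarrow> int \<Rightarrow> 'v set" where
  "weight_space V n = {v \<in> carr V. Vir V 0 v = scal V (of_int n) v}"

definition mweight_space :: "'v voa_data \<Rightarrow> ('v, 'm) module_data \<Rightarrow> complex \<Rightarrow> 'm set" where
  "mweight_space V M c = {w \<in> mcarr M. mmode M (conf V) 1 w = mscal M c w}"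

text \<open>
  The Jacobi identity of a module, stated coefficientwise: the coefficient of
  \<open>z\<^sub>0\<^sup>-\<^sup>k\<^sup>-\<^sup>1 z\<^sub>1\<^sup>-\<^sup>m\<^sup>-\<^sup>1 z\<^sub>2\<^sup>-\<^sup>n\<^sup>-\<^sup>1\<close> (the Borcherds identity).
\<close>

definition jacobi_identity :: "'v voa_data \<Rightarrow> ('v, 'm::ab_group_add) module_data \<Rightarrow> bool" where
  "jacobi_identity V M \<longleftrightarrow>
    (\<forall>u\<in>carr V. \<forall>v\<in>carr V. \<forall>w\<in>mcarr M. \<forall>k m n.
      Sum_any (\<lambda>i::nat. mscal M (of_int m gchoose i)
        (mmode M (mode V u (k + int i) v) (m + n - int i) w)) =
      Sum_any (\<lambda>i::nat. mscal M ((-1) ^ i * (of_int k gchoose i))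
        (mmode M u (m + k - int i) (mmode M v (n + int i) w)
         - mscal M ((-1) powi k) (mmode M v (n + k - int i) (mmode M u (m + int i) w)))))"

locale voa = vector_space "scal V"
  for V :: "('v::ab_group_add) voa_data" +
  assumes subspace_carr: "subspace (carr V)"
    and vac_in: "vac V \<in> carr V"
    and conf_in: "conf V \<in> carr V"
    and mode_in: "\<And>u n v. u \<in> carr V \<Longrightarrow> v \<in> carr V \<Longrightarrow> mode V u n v \<in> carr V"
    and mode_linear_left: "\<And>n v. v \<in> carr V \<Longrightarrow> linear_on (scal V) (scal V) (carr V) (\<lambda>u. mode V u n v)"
    and mode_linear_right: "\<And>u n. u \<in> carr V \<Longrightarrow> linear_on (scal V) (scal V) (carr V) (mode V u n)"
    and truncation: "\<And>u v. u \<in> carr V \<Longrightarrow> v \<in> carr V \<Longrightarrow> \<exists>N. \<forall>n\<ge>N. mode V u n v = 0"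
    and vacuum: "\<And>n v. v \<in> carr V \<Longrightarrow> mode V (vac V) n v = (if n = -1 then v else 0)"
    and creation: "\<And>u n. u \<in> carr V \<Longrightarrow> n \<ge> 0 \<Longrightarrow> mode V u n (vac V) = 0"
      "\<And>u. u \<in> carr V \<Longrightarrow> mode V u (-1) (vac V) = u"
    and jacobi: "jacobi_identity V (adjoint_module V)"
    and virasoro: "\<exists>c. \<forall>m n. \<forall>v\<in>carr V.
      Vir V m (Vir V n v) - Vir V n (Vir V m v) =
      scal V (of_int (m - n)) (Vir V (m + n) v)
      + scal V (if m + n = 0 then of_int (m ^ 3 - m) / 12 * c else 0) v"
    and L_minus_one_derivative: "\<And>u n v. u \<in> carr V \<Longrightarrow> v \<in> carr V \<Longrightarrow>
      mode V (Vir V (-1) u) n v = scal V (of_int (- n)) (mode V u (n - 1) v)"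
    and graded: "\<And>v. v \<in> carr V \<Longrightarrow>
      \<exists>c. (\<forall>n. c n \<in> weight_space V n) \<and> finite {n. c n \<noteq> 0} \<and> v = Sum_any c"
    and weight_space_fin_dim: "\<And>n. \<exists>B. finite B \<and> B \<subseteq> carr V \<and> weight_space V n \<subseteq> span B"
    and weights_bounded_below: "\<exists>N. \<forall>n<N. weight_space V n = {0}"

text \<open>
  Ordinary modules. The module versions of the Virasoro relations and of the
  \<open>L(-1)\<close>-derivative property follow from the Jacobi identity.
\<close>

locale voa_module = V: voa V + M: vector_space "mscal M"
  for V :: "('v::ab_group_add) voa_data" and M :: "('v, 'm::ab_group_add) module_data" +
  assumes subspace_mcarr: "M.subspace (mcarr M)"
    and mmode_in: "\<And>u n w. u \<in> carr V \<Longrightarrow> w \<in> mcarr M \<Longrightarrow> mmode M u n w \<in> mcarr M"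
    and mmode_linear_left: "\<And>n w. w \<in> mcarr M \<Longrightarrow>
      linear_on (scal V) (mscal M) (carr V) (\<lambda>u. mmode M u n w)"
    and mmode_linear_right: "\<And>u n. u \<in> carr V \<Longrightarrow>
      linear_on (mscal M) (mscal M) (mcarr M) (mmode M u n)"
    and mtruncation: "\<And>u w. u \<in> carr V \<Longrightarrow> w \<in> mcarr M \<Longrightarrow> \<exists>N. \<forall>n\<ge>N. mmode M u n w = 0"
    and mvacuum: "\<And>n w. w \<in> mcarr M \<Longrightarrow> mmode M (vac V) n w = (if n = -1 then w else 0)"
    and mjacobi: "jacobi_identity V M"
    and mgraded: "\<And>w. w \<in> mcarr M \<Longrightarrow>
      \<exists>c. (\<forall>l. c l \<in> mweight_space V M l) \<and> finite {l. c l \<noteq> 0} \<and> w = Sum_any c"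
    and mweight_space_fin_dim: "\<And>l. \<exists>B. finite B \<and> B \<subseteq> mcarr M \<and> mweight_space V M l \<subseteq> M.span B"
    and mweights_bounded_below: "\<And>l. \<exists>N. \<forall>n<N. mweight_space V M (l + of_int n) = {0}"

definition simple_voa :: "('v::ab_group_add) voa_data \<Rightarrow> bool" where
  "simple_voa V \<longleftrightarrow> carr V \<noteq> {0} \<and>
    (\<forall>I. I \<subseteq> carr V \<and> module.subspace (scal V) I \<and>
         (\<forall>u\<in>carr V. \<forall>n. \<forall>v\<in>I. mode V u n v \<in> I \<and> mode V v n u \<in> I)
      \<longrightarrow> I = {0} \<or> I = carr V)"

text \<open>In the presence of the grading, \<open>V = (\<Oplus>n\<ge>0. V\<^sub>n)\<close> says that \<open>V\<^sub>n = 0\<close> for \<open>n < 0\<close>.\<close>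

definition CFT_type :: "('v::ab_group_add) voa_data \<Rightarrow> bool" where
  "CFT_type V \<longleftrightarrow> (\<forall>n<0. weight_space V n = {0}) \<and> weight_space V 0 = range (\<lambda>c. scal V c (vac V))"


section \<open>Contragredient modules and self-duality\<close>

definition homog_comp :: "('v::ab_group_add) voa_data \<Rightarrow> 'v \<Rightarrow> int \<Rightarrow> 'v" where
  "homog_comp V a =
    (THE c. (\<forall>n. c n \<in> weight_space V n) \<and> finite {n. c n \<noteq> 0} \<and> a = Sum_any c)"

text \<open>
  \<open>opp_mode V M a n w\<close> is the coefficient of \<open>z\<^sup>-\<^sup>n\<^sup>-\<^sup>1\<close> in
  \<open>Y\<^sub>M(e\<^bsup>zL(1)\<^esup> (-z\<^sup>-\<^sup>2)\<^bsup>L(0)\<^esup> a, z\<^sup>-\<^sup>1) w\<close>. For \<open>a\<close> of weight \<open>d\<close> this series is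
  \<open>\<Sum>k m. (-1)\<^sup>d / k! (L(1)\<^sup>k a)\<^sub>m w z\<^bsup>k - 2 d + m + 1\<^esup>\<close>, so that \<open>m = 2 d - k - n - 2\<close>.
\<close>

definition opp_mode ::
  "('v::ab_group_add) voa_data \<Rightarrow> ('v, 'm::ab_group_add) module_data \<Rightarrow> 'v \<Rightarrow> int \<Rightarrow> 'm \<Rightarrow> 'm" where
  "opp_mode V M a n w =
    Sum_any (\<lambda>d::int. Sum_any (\<lambda>k::nat. mscal M ((-1) powi d / fact k)
      (mmode M ((Vir V 1 ^^ k) (homog_comp V a d)) (2 * d - int k - n - 2) w)))"

text \<open>
  The restricted dual \<open>(\<Oplus>l. (M\<^sub>l)\<^sup>* )\<close> consists of the linear functionals on \<open>M\<close> that vanish on all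
  but finitely many weight spaces. Functionals are extended by \<open>0\<close> outside the carrier of \<open>M\<close>.
\<close>

definition restricted_dual :: "'v voa_data \<Rightarrow> ('v, 'm::ab_group_add) module_data \<Rightarrow> ('m \<Rightarrow> complex) set" where
  "restricted_dual V M =
    {g. linear_on (mscal M) (*) (mcarr M) g \<and> (\<forall>x. x \<notin> mcarr M \<longrightarrow> g x = 0) \<and>
        finite {l. \<exists>x\<in>mweight_space V M l. g x \<noteq> 0}}"

definition contragredient ::
  "('v::ab_group_add) voa_data \<Rightarrow> ('v, 'm::ab_group_add) module_data \<Rightarrow> ('v, 'm \<Rightarrow> complex) module_data"
  where
  "contragredient V M =
    \<lparr>mcarr = restricted_dual V M,
     mscal = (\<lambda>c g x. c * g x),
     mmode = (\<lambda>a n g w. if w \<in> mcarr M then g (opp_mode V M a n w) else 0)\<rparr>"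

definition module_iso ::
  "'v voa_data \<Rightarrow> ('v, 'm::ab_group_add) module_data \<Rightarrow> ('v, 'n::ab_group_add) module_data \<Rightarrow> ('m \<Rightarrow> 'n) \<Rightarrow> bool"
  where
  "module_iso V M N T \<longleftrightarrow>
    bij_betw T (mcarr M) (mcarr N) \<and> linear_on (mscal M) (mscal N) (mcarr M) T \<and>
    (\<forall>a\<in>carr V. \<forall>n. \<forall>w\<in>mcarr M. T (mmode M a n w) = mmode N a n (T w))"

definition self_dual :: "('v::ab_group_add) voa_data \<Rightarrow> bool" where
  "self_dual V \<longleftrightarrow>
    (\<exists>T. module_iso V (adjoint_module V) (contragredient V (adjoint_module V)) T)"


section \<open>Automorphisms and unitarity\<close>

definition voa_automorphism :: "('v::ab_group_add) voa_data \<Rightarrow> ('v \<Rightarrow> 'v) \<Rightarrow> bool" where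
  "voa_automorphism V g \<longleftrightarrow>
    bij_betw g (carr V) (carr V) \<and> linear_on (scal V) (scal V) (carr V) g \<and>
    g (vac V) = vac V \<and> g (conf V) = conf V \<and>
    (\<forall>u\<in>carr V. \<forall>v\<in>carr V. \<forall>n. g (mode V u n v) = mode V (g u) n (g v))"

definition antilinear_involution :: "('v::ab_group_add) voa_data \<Rightarrow> ('v \<Rightarrow> 'v) \<Rightarrow> bool" where
  "antilinear_involution V \<phi> \<longleftrightarrow>
    bij_betw \<phi> (carr V) (carr V) \<and> antilinear_on (scal V) (scal V) (carr V) \<phi> \<and>
    has_order_on (carr V) \<phi> 2 \<and>
    \<phi> (vac V) = vac V \<and> \<phi> (conf V) = conf V \<and>
    (\<forall>u\<in>carr V. \<forall>v\<in>carr V. \<forall>n. \<phi> (mode V u n v) = mode V (\<phi> u) n (\<phi> v))"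

definition pos_def_hermitian ::
  "(complex \<Rightarrow> 'm \<Rightarrow> 'm) \<Rightarrow> 'm set \<Rightarrow> ('m::ab_group_add \<Rightarrow> 'm \<Rightarrow> complex) \<Rightarrow> bool" where
  "pos_def_hermitian s A H \<longleftrightarrow>
    (\<forall>y\<in>A. linear_on s (*) A (\<lambda>x. H x y)) \<and>
    (\<forall>x\<in>A. antilinear_on s (*) A (H x)) \<and>
    (\<forall>x\<in>A. \<forall>y\<in>A. H y x = cnj (H x y)) \<and>
    (\<forall>x\<in>A. x \<noteq> 0 \<longrightarrow> Im (H x x) = 0 \<and> 0 < Re (H x x))"

definition invariant_form ::
  "('v::ab_group_add) voa_data \<Rightarrow> ('v \<Rightarrow> 'v) \<Rightarrow> ('v, 'm::ab_group_add) module_data \<Rightarrow> ('m \<Rightarrow> 'm \<Rightarrow> complex) \<Rightarrow> bool"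
  where
  "invariant_form V \<phi> M H \<longleftrightarrow>
    (\<forall>a\<in>carr V. \<forall>w1\<in>mcarr M. \<forall>w2\<in>mcarr M. \<forall>n.
      H (opp_mode V M a n w1) w2 = H w1 (mmode M (\<phi> a) n w2))"

definition unitary_voa :: "('v::ab_group_add) voa_data \<Rightarrow> ('v \<Rightarrow> 'v) \<Rightarrow> bool" where
  "unitary_voa V \<phi> \<longleftrightarrow>
    voa V \<and> antilinear_involution V \<phi> \<and>
    (\<exists>H. pos_def_hermitian (scal V) (carr V) H \<and> invariant_form V \<phi> (adjoint_module V) H)"

definition unitary_module ::
  "('v::ab_group_add) voa_data \<Rightarrow> ('v \<Rightarrow> 'v) \<Rightarrow> ('v, 'm::ab_group_add) module_data \<Rightarrow> bool" where
  "unitary_module V \<phi> M \<longleftrightarrow>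
    voa_module V M \<and>
    (\<exists>H. pos_def_hermitian (mscal M) (mcarr M) H \<and> invariant_form V \<phi> M H)"


section \<open>Eigenspaces\<close>

definition root_of_unity :: "nat \<Rightarrow> complex" where
  "root_of_unity p = exp (2 * of_real pi * \<i> / of_nat p)"

definition eigen2 ::
  "'v voa_data \<Rightarrow> nat \<Rightarrow> ('v \<Rightarrow> 'v) \<Rightarrow> ('v \<Rightarrow> 'v) \<Rightarrow> int \<Rightarrow> int \<Rightarrow> 'v set" where
  "eigen2 V p f h i j =
    {v \<in> carr V. f v = scal V (root_of_unity p powi i) v \<and> h v = scal V (root_of_unity p powi j) v}"

text \<open>The sum \<open>V\<^sup>i = (\<Oplus>j<p. V\<^sup>i\<^sup>,\<^sup>j)\<close>; it is direct because the \<open>V\<^sup>i\<^sup>,\<^sup>j\<close> are eigenspaces of \<open>h\<close>.\<close>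

definition eigen1 ::
  "('v::ab_group_add) voa_data \<Rightarrow> nat \<Rightarrow> ('v \<Rightarrow> 'v) \<Rightarrow> ('v \<Rightarrow> 'v) \<Rightarrow> int \<Rightarrow> 'v set" where
  "eigen1 V p f h i = {\<Sum>j<p. x j | x. \<forall>j<p. x j \<in> eigen2 V p f h i (int j)}"

end

theory Submission
  imports Defs "HOL-Computational_Algebra.Fundamental_Theorem_Algebra"
begin

text \<open>
  Self-duality gives a nondegenerate invariant symmetric bilinear form \<open>B\<close> on \<open>V\<close> with
  \<open>B(1, 1) = 1\<close>. The Hermitian forms on the \<open>V\<^sup>i\<close> add up to a form \<open>H\<close> on \<open>V\<close>, and \<open>B(\<Psi> y, x) = H(x, y)\<close>
  defines an antilinear bijection \<open>\<Psi>\<close> that is compatible with the \<open>V\<^sup>0\<close>-action. Since \<open>V\<close> is simple,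
  each \<open>V\<^sup>i\<close> is an irreducible \<open>V\<^sup>0\<close>-module, so by Schur's lemma \<open>\<Psi>\<^sup>2\<close> is a positive scalar on
  each \<open>V\<^sup>i\<close>, and \<open>\<Psi>\<close> can be rescaled to an antilinear involution \<open>\<Phi>\<close> mapping \<open>V\<^sup>i\<close> to
  \<open>V\<^sup>-\<^sup>i\<close>.

  For \<open>u \<in> V\<^sup>i\<close> and \<open>v \<in> V\<^sup>-\<^sup>i\<close> the product \<open>u\<^sub>n v\<close> lies in \<open>V\<^sup>0\<close> and is determined by the module
  structure and \<open>B\<close>, so \<open>\<Phi>(u\<^sub>n v) = \<Phi>(u)\<^sub>n \<Phi>(v)\<close>. By associativity \<open>\<Phi>\<close> also respects
  \<open>u\<^sub>q v\<^sub>n w\<close>, hence the four-point products \<open>B(u\<^sub>n w, v\<^sub>m w')\<close>, and a second use of Schur's lemma gives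
  \<open>\<Phi>(u)\<^sub>n \<Phi>(w) = \<lambda>\<^sub>i\<^sub>j \<Phi>(u\<^sub>n w)\<close> for \<open>u \<in> V\<^sup>i\<close>, \<open>w \<in> V\<^sup>j\<close>. Reflection positivity of a four-point
  function shows \<open>\<lambda>\<^sub>i\<^sub>j > 0\<close>. The \<open>\<lambda>\<^sub>i\<^sub>j\<close> form a 2-cocycle on \<open>\<int>/p\<close> with positive
  values, hence a coboundary \<open>\<mu>\<^sub>i \<mu>\<^sub>j / \<mu>\<^sub>i\<^sub>+\<^sub>j\<close> with \<open>\<mu> > 0\<close>, and dividing \<open>\<Phi>\<close> by \<open>\<mu>\<^sub>i\<close> on \<open>V\<^sup>i\<close>
  yields the required involution; the Hermitian form is \<open>B(x, \<Phi> y)\<close>.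
\<close>

section \<open>Modes and the Borcherds identity\<close>

lemma Sum_any_lessThan:
  fixes g :: "nat \<Rightarrow> 'a::comm_monoid_add"
  assumes "\<And>i. i \<ge> K \<Longrightarrow> g i = 0"
  shows "Sum_any g = (\<Sum>i<K. g i)"
  by (rule Sum_any.expand_superset) (use assms in \<open>auto simp: not_less[symmetric]\<close>)

lemma gbinomial_0_left: "((0::'a::field_char_0) gchoose i) = (if i = 0 then 1 else 0)"
  by (cases i) (simp_all add: gbinomial_Suc)

lemma cnj_gbinomial_of_int [simp]: "cnj (of_int m gchoose i) = (of_int m gchoose i)"
  by (simp add: gbinomial_prod_rev)

context voa
begin

abbreviation "C \<equiv> carr V"
abbreviation "sc \<equiv> scal V"
abbreviation "md \<equiv> mode V"

lemma carr_zero [simp, intro]: "0 \<in> C"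
  using subspace_carr subspace_0 by blast

lemma carr_add [simp, intro]: "x \<in> C \<Longrightarrow> y \<in> C \<Longrightarrow> x + y \<in> C"
  using subspace_carr subspace_add by blast

lemma carr_scale [simp, intro]: "x \<in> C \<Longrightarrow> sc c x \<in> C"
  using subspace_carr subspace_scale by blast

lemma carr_diff [simp, intro]: "x \<in> C \<Longrightarrow> y \<in> C \<Longrightarrow> x - y \<in> C"
  using subspace_carr subspace_diff by blast

lemma carr_neg [simp, intro]: "x \<in> C \<Longrightarrow> - x \<in> C"
  using subspace_carr subspace_neg by blast

lemma carr_sum [simp, intro]: "(\<And>i. i \<in> A \<Longrightarrow> g i \<in> C) \<Longrightarrow> sum g A \<in> C"
  using subspace_carr subspace_sum by blast

declare vac_in [simp, intro] conf_in [simp, intro] mode_in [simp, intro]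

lemma Vir_in [simp, intro]: "x \<in> C \<Longrightarrow> Vir V n x \<in> C"
  by (simp add: Vir_def)

lemma Vir_pow_in [simp, intro]: "x \<in> C \<Longrightarrow> (Vir V n ^^ k) x \<in> C"
  by (induction k) auto

lemma mode_add_left: "u \<in> C \<Longrightarrow> u' \<in> C \<Longrightarrow> v \<in> C \<Longrightarrow> md (u + u') n v = md u n v + md u' n v"
  using mode_linear_left[of v n] by (auto simp: linear_on_def)

lemma mode_scale_left: "u \<in> C \<Longrightarrow> v \<in> C \<Longrightarrow> md (sc c u) n v = sc c (md u n v)"
  using mode_linear_left[of v n] by (auto simp: linear_on_def)

lemma mode_add_right: "u \<in> C \<Longrightarrow> v \<in> C \<Longrightarrow> v' \<in> C \<Longrightarrow> md u n (v + v') = md u n v + md u n v'"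
  using mode_linear_right[of u n] by (auto simp: linear_on_def)

lemma mode_scale_right: "u \<in> C \<Longrightarrow> v \<in> C \<Longrightarrow> md u n (sc c v) = sc c (md u n v)"
  using mode_linear_right[of u n] by (auto simp: linear_on_def)

lemma mode_zero_left [simp]: "v \<in> C \<Longrightarrow> md 0 n v = 0"
  using mode_scale_left[of 0 v 0 n] by simp

lemma mode_zero_right [simp]: "u \<in> C \<Longrightarrow> md u n 0 = 0"
  using mode_scale_right[of u 0 n 0] by simp

lemma mode_sum_right:
  "u \<in> C \<Longrightarrow> (\<And>i. i \<in> A \<Longrightarrow> g i \<in> C) \<Longrightarrow> md u n (sum g A) = (\<Sum>i\<in>A. md u n (g i))"
  by (induction A rule: infinite_finite_induct) (auto simp: mode_add_right)

lemma mode_sum_left: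
  "v \<in> C \<Longrightarrow> (\<And>i. i \<in> A \<Longrightarrow> g i \<in> C) \<Longrightarrow> md (sum g A) n v = (\<Sum>i\<in>A. md (g i) n v)"
  by (induction A rule: infinite_finite_induct) (auto simp: mode_add_left)

lemma Vir_add: "x \<in> C \<Longrightarrow> y \<in> C \<Longrightarrow> Vir V n (x + y) = Vir V n x + Vir V n y"
  by (simp add: Vir_def mode_add_right)

lemma Vir_scale: "x \<in> C \<Longrightarrow> Vir V n (sc c x) = sc c (Vir V n x)"
  by (simp add: Vir_def mode_scale_right)

lemma Vir_zero [simp]: "Vir V n 0 = 0"
  by (simp add: Vir_def)

lemma Vir_pow_zero [simp]: "(Vir V n ^^ k) 0 = 0"
  by (induction k) auto

lemma truncation_nat:
  assumes "u \<in> C" "v \<in> C"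
  obtains K :: nat where "\<And>i. i \<ge> K \<Longrightarrow> md u (k + int i) v = 0"
proof -
  obtain N where N: "\<forall>n\<ge>N. md u n v = 0" using truncation[OF assms] by blast
  show thesis by (rule that[of "nat (N - k)"]) (use N in auto)
qed

text \<open>One cutoff \<open>K\<close> serves all three truncations: beyond it every summand on
  either side vanishes, so the formal sums become finite sums that can be split and
  compared.\<close>

lemma borcherds_finite:
  assumes "u \<in> C" "v \<in> C" "w \<in> C"
    and "\<And>i. i \<ge> K \<Longrightarrow> md u (k + int i) v = 0"
    and "\<And>i. i \<ge> K \<Longrightarrow> md v (n + int i) w = 0"
    and "\<And>i. i \<ge> K \<Longrightarrow> md u (m + int i) w = 0"
  shows "(\<Sum>i<K. sc (of_int m gchoose i) (md (md u (k + int i) v) (m + n - int i) w)) =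
    (\<Sum>i<K. sc ((-1) ^ i * (of_int k gchoose i))
        (md u (m + k - int i) (md v (n + int i) w)
         - sc ((-1) powi k) (md v (n + k - int i) (md u (m + int i) w))))"
proof -
  have J: "Sum_any (\<lambda>i::nat. sc (of_int m gchoose i)
        (md (md u (k + int i) v) (m + n - int i) w)) =
      Sum_any (\<lambda>i::nat. sc ((-1) ^ i * (of_int k gchoose i))
        (md u (m + k - int i) (md v (n + int i) w)
         - sc ((-1) powi k) (md v (n + k - int i) (md u (m + int i) w))))"
    using jacobi assms(1-3) unfolding jacobi_identity_def adjoint_module_def by simp
  show ?thesis
    using J assms by (subst (asm) (1 2) Sum_any_lessThan[of K]) auto
qed

text \<open>This is the case k = 0 of the Borcherds identity: the binomial coefficients of 0 leave
  only i = 0 on the right. The auxiliary bound \<open>L\<close> covers all truncations, but only the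
  products u_i v determine the final range.\<close>

lemma commutator:
  assumes "u \<in> C" "v \<in> C" "w \<in> C" and K: "\<And>i. i \<ge> K \<Longrightarrow> md u (int i) v = 0"
  shows "md u m (md v n w) - md v n (md u m w) =
    (\<Sum>i<K. sc (of_int m gchoose i) (md (md u (int i) v) (m + n - int i) w))"
proof -
  obtain K1 where K1: "\<And>i. i \<ge> K1 \<Longrightarrow> md v (n + int i) w = 0" using truncation_nat assms by metis
  obtain K2 where K2: "\<And>i. i \<ge> K2 \<Longrightarrow> md u (m + int i) w = 0" using truncation_nat assms by metis
  define L where "L = Suc (max K (max K1 K2))"
  have "(\<Sum>i<L. sc (of_int m gchoose i) (md (md u (0 + int i) v) (m + n - int i) w)) =
    (\<Sum>i<L. sc ((-1) ^ i * (of_int 0 gchoose i))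
        (md u (m + 0 - int i) (md v (n + int i) w)
         - sc ((-1) powi 0) (md v (n + 0 - int i) (md u (m + int i) w))))"
    by (rule borcherds_finite) (use assms K1 K2 in \<open>auto simp: L_def\<close>)
  also have "\<dots> = (\<Sum>i\<in>{0}. sc ((-1) ^ i * (of_int 0 gchoose i))
        (md u (m + 0 - int i) (md v (n + int i) w)
         - sc ((-1) powi 0) (md v (n + 0 - int i) (md u (m + int i) w))))"
    by (rule sum.mono_neutral_right) (auto simp: L_def gbinomial_0_left)
  also have "\<dots> = md u m (md v n w) - md v n (md u m w)" by simp
  finally have "md u m (md v n w) - md v n (md u m w) =
      (\<Sum>i<L. sc (of_int m gchoose i) (md (md u (0 + int i) v) (m + n - int i) w))" ..
  also have "\<dots> = (\<Sum>i<K. sc (of_int m gchoose i) (md (md u (int i) v) (m + n - int i) w))"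
    by (rule sum.mono_neutral_cong_right) (use K assms in \<open>auto simp: L_def\<close>)
  finally show ?thesis .
qed

text \<open>If u_j w = 0 for all j >= m, the second half of the Borcherds identity disappears.
  Stating the formula for all large \<open>K\<close> lets two instances be compared at a common
  cutoff.\<close>

lemma associativity:
  assumes "u \<in> C" "v \<in> C" "w \<in> C" and m: "\<And>i::nat. md u (m + int i) w = 0"
  shows "\<exists>K0. \<forall>K\<ge>K0.
    (\<Sum>i<K. sc (of_int m gchoose i) (md (md u (k + int i) v) (m + n - int i) w)) =
    (\<Sum>i<K. sc ((-1) ^ i * (of_int k gchoose i)) (md u (m + k - int i) (md v (n + int i) w)))"
proof -
  obtain K1 where K1: "\<And>i. i \<ge> K1 \<Longrightarrow> md v (n + int i) w = 0" using truncation_nat assms by metis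
  obtain K2 where K2: "\<And>i. i \<ge> K2 \<Longrightarrow> md u (k + int i) v = 0" using truncation_nat assms by metis
  have "(\<Sum>i<K. sc (of_int m gchoose i) (md (md u (k + int i) v) (m + n - int i) w)) =
    (\<Sum>i<K. sc ((-1) ^ i * (of_int k gchoose i)) (md u (m + k - int i) (md v (n + int i) w)))"
    if "K \<ge> max K1 K2" for K
    by (subst borcherds_finite) (use assms K1 K2 that in auto)
  then show ?thesis by blast
qed

text \<open>In the associativity formula the products \<open>u\<^sub>q v\<^sub>n w\<close> occur on one side in a
  unitriangular way; this recovers them from the products \<open>(u\<^sub>k v)\<^sub>m w\<close>.\<close>

lemma assoc_triangular:
  fixes g :: "int \<Rightarrow> int \<Rightarrow> 'v"
  assumes I: "subspace I"
    and N: "\<And>q n. n \<ge> N \<Longrightarrow> g q n = 0"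
    and S: "\<And>k n. \<exists>K0. \<forall>K\<ge>K0.
      (\<Sum>i<K. sc ((-1) ^ i * (of_int k gchoose i)) (g (m + k - int i) (n + int i))) \<in> I"
  shows "g q n \<in> I"
proof (induction "nat (N - n)" arbitrary: q n rule: less_induct)
  case less
  show ?case
  proof (cases "n \<ge> N")
    case True
    then show ?thesis using N I subspace_0 by simp
  next
    case False
    \<comment> \<open>With k = q - m the term i = 0 has coefficient 1 and equals
      \<open>g q n\<close>. All other terms have a larger second index and fall under the induction
      hypothesis.\<close>
    obtain K0 where K0: "\<forall>K\<ge>K0. (\<Sum>i<K. sc ((-1) ^ i * (of_int (q - m) gchoose i))
        (g (m + (q - m) - int i) (n + int i))) \<in> I"
      using S[of "q - m" n] by blast
    let ?t = "\<lambda>i. sc ((-1) ^ i * (of_int (q - m) gchoose i)) (g (m + (q - m) - int i) (n + int i))"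
    have tot: "(\<Sum>i<Suc K0. ?t i) \<in> I" using K0 le_Suc_eq by blast
    have rest: "(\<Sum>i<K0. ?t (Suc i)) \<in> I"
      by (intro subspace_sum[OF I] subspace_scale[OF I] less) (use False in auto)
    have "(\<Sum>i<Suc K0. ?t i) = g q n + (\<Sum>i<K0. ?t (Suc i))"
      by (subst sum.lessThan_Suc_shift) simp
    then have "g q n = (\<Sum>i<Suc K0. ?t i) - (\<Sum>i<K0. ?t (Suc i))" by simp
    then show ?thesis using subspace_diff[OF I tot rest] by simp
  qed
qed

text \<open>These are the coefficients of Y(x,z)1 = exp(z L(-1)) x, obtained by iterating the
  L(-1)-derivative property.\<close>

lemma vac_modes: "x \<in> C \<Longrightarrow> md x (- 1 - int i) (vac V) = sc (1 / fact i) ((Vir V (-1) ^^ i) x)"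
proof (induction i arbitrary: x)
  case 0
  then show ?case using creation by simp
next
  case (Suc i)
  have "sc (1 / fact i) ((Vir V (-1) ^^ i) (Vir V (-1) x)) = md (Vir V (-1) x) (- 1 - int i) (vac V)"
    using Suc by simp
  also have "\<dots> = sc (of_nat (Suc i)) (md x (- 1 - int (Suc i)) (vac V))"
    using L_minus_one_derivative[of x "vac V" "-1 - int i"] Suc.prems
    by (simp add: algebra_simps)
  finally have e: "sc (of_nat (Suc i)) (md x (- 1 - int (Suc i)) (vac V)) =
    sc (1 / fact i) ((Vir V (-1) ^^ i) (Vir V (-1) x))" ..
  have "md x (- 1 - int (Suc i)) (vac V) =
      sc (1 / of_nat (Suc i)) (sc (of_nat (Suc i)) (md x (- 1 - int (Suc i)) (vac V)))"
    using of_nat_neq_0[where 'a=complex, of i] by (simp del: of_nat_Suc)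
  also have "\<dots> = sc (1 / of_nat (Suc i)) (sc (1 / fact i) ((Vir V (-1) ^^ Suc i) x))"
    by (subst e) (simp add: funpow_swap1)
  finally show ?case by (simp add: field_simps)
qed

lemma gbinomial_minus_1: "((-1::complex) gchoose i) = (-1) ^ i"
proof -
  have "(1 + of_nat i - 1 :: complex) = of_nat i" by simp
  then show ?thesis using gbinomial_minus[of "1::complex" i] binomial_gbinomial[of i i, where ?'a=complex]
    by simp
qed

text \<open>Apply the Borcherds identity to the vacuum with m = -1 and n = 0. By the creation axiom
  only the term v_k u with i = 0 survives on the right, and \<open>vac_modes\<close> evaluates the
  left.\<close>

lemma skew_symmetry:
  assumes "u \<in> C" "v \<in> C"
  shows "\<exists>K0. \<forall>K\<ge>K0. md v k u =
    sc (- ((-1) powi k)) (\<Sum>i<K. sc ((-1) ^ i / fact i) ((Vir V (-1) ^^ i) (md u (k + int i) v)))"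
proof -
  obtain K1 where K1: "\<And>i. i \<ge> K1 \<Longrightarrow> md u (k + int i) v = 0" using truncation_nat assms by metis
  have "md v k u = sc (- ((-1) powi k))
      (\<Sum>i<K. sc ((-1) ^ i / fact i) ((Vir V (-1) ^^ i) (md u (k + int i) v)))"
    if K: "K \<ge> Suc K1" for K
  proof -
    let ?S = "\<Sum>i<K. sc ((-1) ^ i / fact i) ((Vir V (-1) ^^ i) (md u (k + int i) v))"
    have "(\<Sum>i<K. sc (of_int (-1) gchoose i) (md (md u (k + int i) v) (-1 + 0 - int i) (vac V))) =
      (\<Sum>i<K. sc ((-1) ^ i * (of_int k gchoose i))
        (md u (-1 + k - int i) (md v (0 + int i) (vac V))
         - sc ((-1) powi k) (md v (0 + k - int i) (md u (-1 + int i) (vac V)))))"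
      by (rule borcherds_finite) (use assms K1 K creation in auto)
    also have "\<dots> = (\<Sum>i\<in>{0}. sc ((-1) ^ i * (of_int k gchoose i))
        (md u (-1 + k - int i) (md v (0 + int i) (vac V))
         - sc ((-1) powi k) (md v (0 + k - int i) (md u (-1 + int i) (vac V)))))"
      by (rule sum.mono_neutral_right) (use assms K creation in auto)
    also have "\<dots> = - sc ((-1) powi k) (md v k u)" using creation assms by simp
    also have "(\<Sum>i<K. sc (of_int (-1) gchoose i) (md (md u (k + int i) v) (-1 + 0 - int i) (vac V))) = ?S"
    proof (rule sum.cong[OF refl])
      fix i
      have "md (md u (k + int i) v) (-1 + 0 - int i) (vac V) =
          sc (1 / fact i) ((Vir V (-1) ^^ i) (md u (k + int i) v))"
        using vac_modes[of "md u (k + int i) v" i] assms by simp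
      then show "sc (of_int (-1) gchoose i) (md (md u (k + int i) v) (-1 + 0 - int i) (vac V)) =
          sc ((-1) ^ i / fact i) ((Vir V (-1) ^^ i) (md u (k + int i) v))"
        by (simp add: gbinomial_minus_1)
    qed
    finally have S: "?S = - sc ((-1) powi k) (md v k u)" .
    have "((-1::complex) powi k) * ((-1) powi k) = 1"
      by (simp flip: power_int_mult_distrib)
    then show ?thesis using S by simp
  qed
  then show ?thesis by blast
qed

end

section \<open>Weights and opposite modes\<close>

context voa
begin

abbreviation "W \<equiv> weight_space V"

lemma weight_iff: "v \<in> W n \<longleftrightarrow> v \<in> C \<and> Vir V 0 v = sc (of_int n) v"
  by (simp add: weight_space_def)

lemma weight_in [simp]: "v \<in> W n \<Longrightarrow> v \<in> C"
  by (simp add: weight_iff)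

lemma weight_zero [simp]: "0 \<in> W n"
  by (simp add: weight_iff)

lemma weight_add: "x \<in> W n \<Longrightarrow> y \<in> W n \<Longrightarrow> x + y \<in> W n"
  by (simp add: weight_iff Vir_add scale_right_distrib)

lemma weight_scale: "x \<in> W n \<Longrightarrow> sc c x \<in> W n"
  by (simp add: weight_iff Vir_scale mult.commute)

lemma subspace_weight: "subspace (W n)"
  by (simp add: subspace_def weight_add weight_scale)

lemma Vir_vac: "n \<ge> -1 \<Longrightarrow> Vir V n (vac V) = 0"
  by (simp add: Vir_def creation)

lemma Vir_minus_2_vac: "Vir V (-2) (vac V) = conf V"
  by (simp add: Vir_def creation)

lemma vac_weight [simp]: "vac V \<in> W 0"
  by (simp add: weight_iff Vir_vac)

text \<open>For m + n nonzero the central charge drops out. Applied to the vacuum with \<omega> =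
  L(-2)1, this gives the weight of \<omega> and L(1)\<omega> = 3 L(-1)1 = 0.\<close>

lemma Vir_commute:
  assumes "v \<in> C" "m + n \<noteq> 0"
  shows "Vir V m (Vir V n v) - Vir V n (Vir V m v) = sc (of_int (m - n)) (Vir V (m + n) v)"
proof -
  obtain c where "\<forall>m n. \<forall>v\<in>carr V.
      Vir V m (Vir V n v) - Vir V n (Vir V m v) =
      scal V (of_int (m - n)) (Vir V (m + n) v)
      + scal V (if m + n = 0 then of_int (m ^ 3 - m) / 12 * c else 0) v"
    using virasoro by blast
  then show ?thesis using assms by (auto simp del: of_int_diff)
qed

lemma conf_weight [simp]: "conf V \<in> W 2"
  using Vir_commute[of "vac V" 0 "-2"] by (simp add: weight_iff Vir_vac Vir_minus_2_vac)

lemma L1_conf: "Vir V 1 (conf V) = 0"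
  using Vir_commute[of "vac V" 1 "-2"] by (simp add: Vir_vac Vir_minus_2_vac)

text \<open>For a mode index m >= 0 the binomial coefficients vanish beyond m, so the range of the
  sum no longer depends on a truncation bound.\<close>

lemma conf_commutator:
  assumes "v \<in> C" "w \<in> C"
  shows "md (conf V) (int m) (md v n w) - md v n (md (conf V) (int m) w) =
    (\<Sum>i\<le>m. sc (of_nat (m choose i)) (md (md (conf V) (int i) v) (int m + n - int i) w))"
proof -
  obtain K where K: "\<And>i. i \<ge> K \<Longrightarrow> md (conf V) (0 + int i) v = 0"
    using truncation_nat[of "conf V" v 0] assms by auto
  have "md (conf V) (int m) (md v n w) - md v n (md (conf V) (int m) w) =
      (\<Sum>i<K + Suc m. sc (of_int (int m) gchoose i) (md (md (conf V) (int i) v) (int m + n - int i) w))"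
    by (rule commutator) (use assms K in auto)
  also have "\<dots> = (\<Sum>i\<le>m. sc (of_nat (m choose i)) (md (md (conf V) (int i) v) (int m + n - int i) w))"
    by (rule sum.mono_neutral_cong_right) (auto simp: binomial_gbinomial[symmetric])
  finally show ?thesis .
qed

lemma L0_mode:
  assumes "v \<in> C" "w \<in> C"
  shows "Vir V 0 (md v n w) = md v n (Vir V 0 w) + md (Vir V 0 v) n w - sc (of_int (n + 1)) (md v n w)"
  using conf_commutator[of v w 1 n] L_minus_one_derivative[of v w "1 + n"] assms
  by (simp add: Vir_def algebra_simps)

text \<open>The three terms of the commutator with \<omega>_2 contain L(-1)v, L(0)v and L(1)v. The
  first reduces by the derivative property, the second by the weight of v.\<close>

lemma L1_mode:
  assumes "v \<in> W d" "w \<in> C"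
  shows "Vir V 1 (md v n w) =
    md v n (Vir V 1 w) + md (Vir V 1 v) n w + sc (of_int (2 * d - n - 2)) (md v (n + 1) w)"
proof -
  have "md (Vir V (-1) v) (2 + n) w = - sc (of_int (n + 2)) (md v (n + 1) w)"
    using L_minus_one_derivative[of v w "2 + n"] assms by (simp add: algebra_simps)
  moreover have "md (Vir V 0 v) (1 + n) w = sc (of_int d) (md v (n + 1) w)"
    using assms by (simp add: weight_iff mode_scale_left add.commute)
  moreover have "(\<Sum>i\<le>2. sc (of_nat (2 choose i)) (md (md (conf V) (int i) v) (int 2 + n - int i) w)) =
      md (Vir V (-1) v) (2 + n) w + sc 2 (md (Vir V 0 v) (1 + n) w) + md (Vir V 1 v) n w"
    by (simp add: numeral_2_eq_2 Vir_def)
  ultimately show ?thesis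
    using conf_commutator[of v w 2 n] assms
    by (simp add: Vir_def algebra_simps)
qed

lemma mode_weight:
  assumes "u \<in> W d" "v \<in> W e"
  shows "md u n v \<in> W (d + e - n - 1)"
  using L0_mode[of u v n] assms
  by (auto simp: weight_iff mode_scale_left mode_scale_right algebra_simps)

lemma Vir_weight: "v \<in> W e \<Longrightarrow> Vir V n v \<in> W (e - n)"
  using mode_weight[OF conf_weight, of v e "n + 1"] by (simp add: Vir_def algebra_simps)

lemma Vir_pow_weight: "v \<in> W e \<Longrightarrow> (Vir V n ^^ k) v \<in> W (e - int k * n)"
  by (induction k) (auto simp: algebra_simps dest: Vir_weight[where n = n])

text \<open>Applying L(0) - a to a relation removes the component of weight a and multiplies each
  other component by a nonzero scalar, which gives an induction on the number of weights.\<close>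

lemma weight_independent:
  assumes "finite F" "\<And>n. n \<in> F \<Longrightarrow> c n \<in> W n" "(\<Sum>n\<in>F. c n) = 0" "m \<in> F"
  shows "c m = 0"
  using assms
proof (induction F arbitrary: c m rule: finite_induct)
  case empty
  then show ?case by simp
next
  case (insert a F)
  have S: "c a + (\<Sum>n\<in>F. c n) = 0" using insert by simp
  have L: "Vir V 0 (\<Sum>n\<in>F. c n) = (\<Sum>n\<in>F. sc (of_int n) (c n))"
    using insert.prems(1)
    by (subst Vir_def, subst mode_sum_right) (auto simp: weight_iff Vir_def intro!: sum.cong)
  have "sc (of_int a) (c a) + (\<Sum>n\<in>F. sc (of_int n) (c n)) = Vir V 0 (c a + (\<Sum>n\<in>F. c n))"
    using insert.prems(1) L by (subst Vir_add) (auto simp: weight_iff)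
  also have "\<dots> = 0" using S by simp
  finally have "sc (of_int a) (c a) + (\<Sum>n\<in>F. sc (of_int n) (c n)) = 0" .
  moreover have "sc (of_int a) (c a) + (\<Sum>n\<in>F. sc (of_int a) (c n)) = 0"
    using arg_cong[OF S, of "sc (of_int a)"] by (simp add: scale_right_distrib scale_sum_right)
  ultimately have "(\<Sum>n\<in>F. sc (of_int n) (c n)) = (\<Sum>n\<in>F. sc (of_int a) (c n))"
    by (metis add_left_cancel)
  moreover have "(\<Sum>n\<in>F. sc (of_int (n - a)) (c n)) =
      (\<Sum>n\<in>F. sc (of_int n) (c n)) - (\<Sum>n\<in>F. sc (of_int a) (c n))"
    by (simp only: of_int_diff scale_left_diff_distrib sum_subtractf)
  ultimately have "(\<Sum>n\<in>F. sc (of_int (n - a)) (c n)) = 0" by simp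
  then have "sc (of_int (n - a)) (c n) = 0" if "n \<in> F" for n
    using insert.IH[of "\<lambda>n. sc (of_int (n - a)) (c n)" n] insert.prems(1) that
    by (auto simp: weight_scale)
  then have *: "c n = 0" if "n \<in> F" for n
    using that insert.hyps by fastforce
  then have "c a = 0" using S by simp
  then show ?case using * insert.prems(3) by auto
qed

text \<open>Names the condition inside the description operator of \<open>homog_comp\<close>; its
  uniqueness makes that description meaningful.\<close>

definition decomp :: "'v \<Rightarrow> (int \<Rightarrow> 'v) \<Rightarrow> bool" where
  "decomp a c \<longleftrightarrow> (\<forall>n. c n \<in> W n) \<and> finite {n. c n \<noteq> 0} \<and> a = Sum_any c"

lemma decomp_sum: "decomp a c \<Longrightarrow> finite D \<Longrightarrow> {n. c n \<noteq> 0} \<subseteq> D \<Longrightarrow> a = (\<Sum>d\<in>D. c d)"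
  by (simp add: decomp_def Sum_any.expand_superset)

lemma decompI:
  assumes "\<And>n. c n \<in> W n" "finite D" "\<And>n. n \<notin> D \<Longrightarrow> c n = 0" "a = (\<Sum>d\<in>D. c d)"
  shows "decomp a c"
proof -
  have "{n. c n \<noteq> 0} \<subseteq> D" using assms(3) by auto
  then show ?thesis using assms finite_subset[of "{n. c n \<noteq> 0}" D]
    by (auto simp: decomp_def Sum_any.expand_superset[of D c])
qed

lemma decomp_unique:
  assumes "decomp a c" "decomp a c'"
  shows "c = c'"
proof
  fix n
  let ?D = "insert n ({n. c n \<noteq> 0} \<union> {n. c' n \<noteq> 0})"
  have fin: "finite ?D" using assms by (auto simp: decomp_def)
  have "a = (\<Sum>d\<in>?D. c d)" by (rule decomp_sum) (use assms fin in auto)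
  moreover have "a = (\<Sum>d\<in>?D. c' d)" by (rule decomp_sum) (use assms fin in auto)
  ultimately have "(\<Sum>d\<in>?D. c d - c' d) = 0" by (simp add: sum_subtractf)
  then have "c n - c' n = 0"
    by (rule weight_independent[OF fin, rotated])
       (use assms in \<open>auto simp: decomp_def intro!: subspace_diff[OF subspace_weight]\<close>)
  then show "c n = c' n" by simp
qed

lemma homog_comp_eqI: "decomp a c \<Longrightarrow> homog_comp V a = c"
  unfolding homog_comp_def decomp_def[symmetric] using decomp_unique by blast

lemma decomp_homog_comp:
  assumes "a \<in> C"
  shows "decomp a (homog_comp V a)"
proof -
  obtain c where "decomp a c" using graded[OF assms] by (auto simp: decomp_def)
  then show ?thesis using homog_comp_eqI by simp
qed

lemma homog_comp_weight [simp]: "a \<in> C \<Longrightarrow> homog_comp V a d \<in> W d"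
  using decomp_homog_comp by (auto simp: decomp_def)

lemma homog_comp_in [simp]: "a \<in> C \<Longrightarrow> homog_comp V a d \<in> C"
  by (simp add: weight_in[where n = d])

lemma homog_comp_finite: "a \<in> C \<Longrightarrow> finite {d. homog_comp V a d \<noteq> 0}"
  using decomp_homog_comp by (auto simp: decomp_def)

lemma homog_comp_homog:
  assumes "a \<in> W d"
  shows "homog_comp V a = (\<lambda>n. if n = d then a else 0)"
  by (rule homog_comp_eqI, rule decompI[of _ "{d}"]) (use assms in auto)

lemma weight_induct [consumes 1, case_names homog add]:
  assumes "a \<in> C"
    and "\<And>d x. x \<in> W d \<Longrightarrow> Q x"
    and "\<And>x y. x \<in> C \<Longrightarrow> y \<in> C \<Longrightarrow> Q x \<Longrightarrow> Q y \<Longrightarrow> Q (x + y)"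
  shows "Q a"
proof -
  let ?D = "{d. homog_comp V a d \<noteq> 0}"
  have fin: "finite ?D" using homog_comp_finite[OF assms(1)] .
  have "(\<Sum>d\<in>D. homog_comp V a d) \<in> C \<and> Q (\<Sum>d\<in>D. homog_comp V a d)" if "finite D" for D
    using that
  proof induction
    case empty
    then show ?case using assms(2)[of 0 0] by simp
  next
    case (insert d D)
    then show ?case using assms(1) assms(2)[of "homog_comp V a d" d] assms(3) by auto
  qed
  from this[OF fin] show ?thesis
    using decomp_sum[OF decomp_homog_comp[OF assms(1)] fin] by simp
qed

text \<open>The images of the components form a decomposition of the image, and decompositions are
  unique. Only additivity is asked of \<open>t\<close>, so antilinear maps are covered too.\<close>

lemma homog_comp_map:
  assumes "a \<in> C" and "\<And>x. x \<in> C \<Longrightarrow> t x \<in> C"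
    and add: "\<And>x y. x \<in> C \<Longrightarrow> y \<in> C \<Longrightarrow> t (x + y) = t x + t y"
    and wt: "\<And>d x. x \<in> W d \<Longrightarrow> t x \<in> W d"
  shows "homog_comp V (t a) d = t (homog_comp V a d)"
proof -
  have z: "t 0 = 0" using add[of 0 0] by simp
  have sum: "t (\<Sum>d\<in>D. homog_comp V a d) = (\<Sum>d\<in>D. t (homog_comp V a d))" if "finite D" for D
    using that assms(1) by induction (auto simp: z add)
  let ?D = "{d. homog_comp V a d \<noteq> 0}"
  have fin: "finite ?D" using homog_comp_finite[OF assms(1)] .
  have "decomp (t a) (\<lambda>d. t (homog_comp V a d))"
    by (rule decompI[of _ ?D])
       (use fin wt assms(1) z sum[OF fin] decomp_sum[OF decomp_homog_comp[OF assms(1)] fin] in auto)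
  then show ?thesis using homog_comp_eqI by simp
qed

section \<open>Opposite modes as finite sums\<close>

abbreviation "adj \<equiv> opp_mode V (adjoint_module V)"

text \<open>L(1) lowers weights by one and the weights are bounded below; finiteness of
  \<open>D\<close> makes the exponent uniform.\<close>

lemma L1_nilpotent:
  assumes "finite D"
  shows "\<exists>K0. \<forall>k\<ge>K0. \<forall>d\<in>D. \<forall>a\<in>W d. (Vir V 1 ^^ k) a = 0"
proof -
  obtain N where N: "\<And>n. n < N \<Longrightarrow> W n = {0}" using weights_bounded_below by blast
  have "(Vir V 1 ^^ k) a = 0" if "d \<in> D" "a \<in> W d" "k \<ge> nat (Max (insert 0 D) - N + 1)" for k d a
  proof -
    have "d \<le> Max (insert 0 D)" using that assms by simp
    then have "d - int k < N" using that by linarith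
    then show ?thesis using Vir_pow_weight[OF that(2), where n = 1 and k = k] N by auto
  qed
  then show ?thesis by blast
qed

text \<open>The expansion holds for every sufficiently large pair of ranges, so the expansions of
  two different vectors can be brought to the same ranges.\<close>

lemma adj_expand:
  assumes a: "a \<in> C" and "w \<in> C"
  shows "\<exists>D0 K0. finite D0 \<and> (\<forall>D K. D0 \<subseteq> D \<longrightarrow> finite D \<longrightarrow> K0 \<le> K \<longrightarrow> adj a n w =
    (\<Sum>d\<in>D. \<Sum>k<K. sc ((-1) powi d / fact k)
      (md ((Vir V 1 ^^ k) (homog_comp V a d)) (2 * d - int k - n - 2) w)))"
proof -
  let ?D0 = "{d. homog_comp V a d \<noteq> 0}"
  have fin: "finite ?D0" using homog_comp_finite[OF a] .
  obtain K0 where K0: "\<forall>k\<ge>K0. \<forall>d\<in>?D0. \<forall>a\<in>W d. (Vir V 1 ^^ k) a = 0"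
    using L1_nilpotent[OF fin] by blast
  have z: "(Vir V 1 ^^ k) (homog_comp V a d) = 0" if "k \<ge> K0" for k d
    using K0 that a by (cases "d \<in> ?D0") auto
  have "adj a n w =
    (\<Sum>d\<in>D. \<Sum>k<K. sc ((-1) powi d / fact k)
      (md ((Vir V 1 ^^ k) (homog_comp V a d)) (2 * d - int k - n - 2) w))"
    if D: "?D0 \<subseteq> D" "finite D" and K: "K \<ge> K0" for D K
  proof -
    let ?t = "\<lambda>d k. sc ((-1) powi d / fact k)
      (md ((Vir V 1 ^^ k) (homog_comp V a d)) (2 * d - int k - n - 2) w)"
    have "adj a n w = Sum_any (\<lambda>d. Sum_any (?t d))"
      by (simp add: opp_mode_def adjoint_module_def)
    also have "(\<lambda>d. Sum_any (?t d)) = (\<lambda>d. \<Sum>k<K. ?t d k)"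
      by (rule ext, rule Sum_any_lessThan) (use z K assms in auto)
    also have "Sum_any (\<lambda>d. \<Sum>k<K. ?t d k) = (\<Sum>d\<in>D. \<Sum>k<K. ?t d k)"
    proof (rule Sum_any.expand_superset)
      show "{d. (\<Sum>k<K. ?t d k) \<noteq> 0} \<subseteq> D"
      proof safe
        fix d assume "(\<Sum>k<K. ?t d k) \<noteq> 0"
        then have "homog_comp V a d \<noteq> 0" using assms by auto
        then show "d \<in> D" using D by blast
      qed
    qed (use D in auto)
    finally show ?thesis .
  qed
  then show ?thesis using fin by blast
qed

lemma adj_homog:
  assumes "a \<in> W d" "w \<in> C"
  shows "\<exists>K0. \<forall>K\<ge>K0. adj a n w =
    (\<Sum>k<K. sc ((-1) powi d / fact k) (md ((Vir V 1 ^^ k) a) (2 * d - int k - n - 2) w))"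
proof -
  obtain D0 K0 where *: "finite D0" "\<forall>D K. D0 \<subseteq> D \<longrightarrow> finite D \<longrightarrow> K0 \<le> K \<longrightarrow> adj a n w =
    (\<Sum>d\<in>D. \<Sum>k<K. sc ((-1) powi d / fact k)
      (md ((Vir V 1 ^^ k) (homog_comp V a d)) (2 * d - int k - n - 2) w))"
    using adj_expand[OF weight_in[OF assms(1)] assms(2), of n] by blast
  have "adj a n w =
    (\<Sum>k<K. sc ((-1) powi d / fact k) (md ((Vir V 1 ^^ k) a) (2 * d - int k - n - 2) w))"
    if "K \<ge> K0" for K
  proof -
    have "adj a n w = (\<Sum>d'\<in>insert d D0. \<Sum>k<K. sc ((-1) powi d' / fact k)
      (md ((Vir V 1 ^^ k) (homog_comp V a d')) (2 * d' - int k - n - 2) w))"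
      using *(1) that by (intro *(2)[rule_format]) auto
    also have "\<dots> = (\<Sum>d'\<in>{d}. \<Sum>k<K. sc ((-1) powi d' / fact k)
      (md ((Vir V 1 ^^ k) (homog_comp V a d')) (2 * d' - int k - n - 2) w))"
      by (rule sum.mono_neutral_right)
         (use *(1) assms in \<open>auto simp: homog_comp_homog[OF assms(1)]\<close>)
    finally show ?thesis by (simp add: homog_comp_homog[OF assms(1)])
  qed
  then show ?thesis by blast
qed

text \<open>When L(1)a = 0 only the term k = 0 of exp(zL(1)) survives.\<close>

lemma adj_quasi_primary:
  assumes "a \<in> W d" "w \<in> C" "Vir V 1 a = 0"
  shows "adj a n w = sc ((-1) powi d) (md a (2 * d - n - 2) w)"
proof -
  obtain K0 where K0: "\<forall>K\<ge>K0. adj a n w =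
    (\<Sum>k<K. sc ((-1) powi d / fact k) (md ((Vir V 1 ^^ k) a) (2 * d - int k - n - 2) w))"
    using adj_homog assms by blast
  have z: "(Vir V 1 ^^ Suc k) a = 0" for k using assms(3) by (simp add: funpow_swap1)
  have "adj a n w = (\<Sum>k<Suc K0. sc ((-1) powi d / fact k)
      (md ((Vir V 1 ^^ k) a) (2 * d - int k - n - 2) w))"
    using K0 le_Suc_eq by blast
  also have "\<dots> = sc ((-1) powi d) (md a (2 * d - n - 2) w)"
    using z assms(2) by (subst sum.lessThan_Suc_shift) (simp del: funpow.simps(2))
  finally show ?thesis .
qed

text \<open>In terms of the Virasoro operators this says that L(n) and L(-n) are adjoint.\<close>

lemma adj_conf: "w \<in> C \<Longrightarrow> adj (conf V) n w = md (conf V) (2 - n) w"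
  by (simp add: adj_quasi_primary[OF conf_weight] L1_conf)

lemma adj_in [simp]: "a \<in> C \<Longrightarrow> w \<in> C \<Longrightarrow> adj a n w \<in> C"
proof -
  assume *: "a \<in> C" "w \<in> C"
  obtain D0 K0 where "finite D0" "\<forall>D K. D0 \<subseteq> D \<longrightarrow> finite D \<longrightarrow> K0 \<le> K \<longrightarrow> adj a n w =
    (\<Sum>d\<in>D. \<Sum>k<K. sc ((-1) powi d / fact k)
      (md ((Vir V 1 ^^ k) (homog_comp V a d)) (2 * d - int k - n - 2) w))"
    using adj_expand[OF *, of n] by blast
  then have "adj a n w = (\<Sum>d\<in>D0. \<Sum>k<K0. sc ((-1) powi d / fact k)
      (md ((Vir V 1 ^^ k) (homog_comp V a d)) (2 * d - int k - n - 2) w))" by blast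
  then show ?thesis using * by simp
qed

text \<open>\<open>S\<close> is the set of those vectors for whose modes \<open>t\<close> is known to be multiplicative.\<close>

lemma adj_map:
  assumes t: "\<And>x. x \<in> C \<Longrightarrow> t x \<in> C"
    and add: "\<And>x y. x \<in> C \<Longrightarrow> y \<in> C \<Longrightarrow> t (x + y) = t x + t y"
    and scale: "\<And>r x. x \<in> C \<Longrightarrow> t (sc (of_real r) x) = sc (of_real r) (t x)"
    and wt: "\<And>d x. x \<in> W d \<Longrightarrow> t x \<in> W d"
    and L1: "\<And>x. x \<in> C \<Longrightarrow> t (Vir V 1 x) = Vir V 1 (t x)"
    and S: "\<And>x. x \<in> S \<Longrightarrow> Vir V 1 x \<in> S" "\<And>x d. x \<in> S \<Longrightarrow> homog_comp V x d \<in> S" "S \<subseteq> C"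
    and mult: "\<And>x q. x \<in> S \<Longrightarrow> t (md x q y) = md (t x) q y'"
    and a: "a \<in> S" and y: "y \<in> C" "y' \<in> C"
  shows "t (adj a n y) = adj (t a) n y'"
proof -
  have aC: "a \<in> C" using a S(3) by blast
  have z: "t 0 = 0" using add[of 0 0] by simp
  have sum: "t (sum g A) = (\<Sum>i\<in>A. t (g i))" if "\<And>i. i \<in> A \<Longrightarrow> g i \<in> C" for g :: "'b \<Rightarrow> 'v" and A
    using that by (induction A rule: infinite_finite_induct) (auto simp: z add)
  obtain D1 K1 where 1: "finite D1" "\<forall>D K. D1 \<subseteq> D \<longrightarrow> finite D \<longrightarrow> K1 \<le> K \<longrightarrow> adj a n y =
    (\<Sum>d\<in>D. \<Sum>k<K. sc ((-1) powi d / fact k)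
      (md ((Vir V 1 ^^ k) (homog_comp V a d)) (2 * d - int k - n - 2) y))"
    using adj_expand[OF aC y(1), of n] by blast
  obtain D2 K2 where 2: "finite D2" "\<forall>D K. D2 \<subseteq> D \<longrightarrow> finite D \<longrightarrow> K2 \<le> K \<longrightarrow> adj (t a) n y' =
    (\<Sum>d\<in>D. \<Sum>k<K. sc ((-1) powi d / fact k)
      (md ((Vir V 1 ^^ k) (homog_comp V (t a) d)) (2 * d - int k - n - 2) y'))"
    using adj_expand[OF t[OF aC] y(2), of n] by blast
  have SL: "(Vir V 1 ^^ k) x \<in> S" if "x \<in> S" for k x
    using that S(1) by (induction k) auto
  have tL: "t ((Vir V 1 ^^ k) x) = (Vir V 1 ^^ k) (t x)" if "x \<in> C" for k x
    using that L1 by (induction k) auto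
  \<comment> \<open>The coefficients are real, so the same computation serves linear and antilinear
    \<open>t\<close>.\<close>
  have r: "((-1) powi d / fact k :: complex) = of_real ((-1) powi d / fact k)" for d k
    by simp
  let ?D = "D1 \<union> D2" and ?K = "max K1 K2"
  have "t (adj a n y) = t (\<Sum>d\<in>?D. \<Sum>k<?K. sc ((-1) powi d / fact k)
      (md ((Vir V 1 ^^ k) (homog_comp V a d)) (2 * d - int k - n - 2) y))"
    using 1(2)[rule_format, of ?D ?K] 1(1) 2(1) by simp
  also have "\<dots> = (\<Sum>d\<in>?D. \<Sum>k<?K. sc ((-1) powi d / fact k)
      (t (md ((Vir V 1 ^^ k) (homog_comp V a d)) (2 * d - int k - n - 2) y)))"
    using aC y unfolding r by (simp add: sum scale del: of_real_divide of_real_power_int)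
  also have "\<dots> = (\<Sum>d\<in>?D. \<Sum>k<?K. sc ((-1) powi d / fact k)
      (md ((Vir V 1 ^^ k) (homog_comp V (t a) d)) (2 * d - int k - n - 2) y'))"
    using a aC S(2) SL by (simp add: mult tL homog_comp_map[OF aC t add wt])
  also have "\<dots> = adj (t a) n y'"
    using 2(2)[rule_format, of ?D ?K] 1(1) 2(1) by simp
  finally show ?thesis .
qed

end

section \<open>The invariant bilinear form\<close>

text \<open>The defect \<open>E\<close> of the claimed symmetry satisfies the same recursion. If it
  vanishes on one antidiagonal, the recursion says that it only changes sign from entry to entry
  along the next one, so a single entry decides.\<close>

lemma alternating_symmetry:
  fixes A :: "nat \<Rightarrow> nat \<Rightarrow> complex"
  assumes rel: "\<And>j k. A j (Suc k) + A (Suc j) k = (of_nat j - of_nat k) * A j k"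
  shows "A j k = (-1) ^ (j + k) * A k j"
proof -
  define E where "E = (\<lambda>j k. A j k - (-1) ^ (j + k) * A k j)"
  have step: "E j (Suc k) + E (Suc j) k = (of_nat j - of_nat k) * E j k" for j k
  proof -
    have "E j (Suc k) + E (Suc j) k =
        (A j (Suc k) + A (Suc j) k) + (-1) ^ (j + k) * (A k (Suc j) + A (Suc k) j)"
      by (simp add: E_def algebra_simps)
    then show ?thesis unfolding rel by (simp add: E_def algebra_simps)
  qed
  have anti: "E k j = - ((-1) ^ (j + k)) * E j k" for j k
    by (simp add: E_def algebra_simps flip: power_add mult.assoc)
  have "E j k = 0" if "j + k = s" for s j k
    using that
  proof (induction s arbitrary: j k)
    case 0
    then show ?case by (simp add: E_def)
  next
    case (Suc s)
    have flip: "E (Suc j) k = - E j (Suc k)" if "j + k = s" for j k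
      using step[of j k] Suc.IH[OF that] by (simp add: add_eq_0_iff)
    have slide: "E j k = (-1) ^ j * E 0 (Suc s)" if "j + k = Suc s" for j k
      using that
    proof (induction j arbitrary: k)
      case (Suc j)
      then show ?case using flip[of j k] Suc.IH[of "Suc k"] by simp
    qed simp
    \<comment> \<open>On an antidiagonal of even index the middle entry is zero by definition; on
      one of odd index the two end entries are equal by \<open>anti\<close> and opposite by
      \<open>slide\<close>.\<close>
    have "E 0 (Suc s) = 0"
    proof (cases "even (Suc s)")
      case True
      then obtain m where "Suc s = m + m" by (metis evenE mult_2)
      then have "(-1) ^ m * E 0 (Suc s) = 0" using slide[of m m] by (simp add: E_def)
      then show ?thesis by simp
    next
      case False
      then show ?thesis using slide[of "Suc s" 0] anti[of 0 "Suc s"] by simp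
    qed
    then show ?case using slide[OF Suc.prems] by simp
  qed
  then have "E j k = 0" by blast
  then show ?thesis unfolding E_def by (rule eq_iff_diff_eq_0[THEN iffD2])
qed

text \<open>A nondegenerate form \<open>B\<close> realising the isomorphism of \<open>V\<close> with its contragredient module.\<close>

locale voa_dual_form = voa V for V :: "('v::ab_group_add) voa_data" +
  fixes B :: "'v \<Rightarrow> 'v \<Rightarrow> complex"
  assumes simple: "simple_voa V" and CFT: "CFT_type V"
    and B_linear_left: "\<And>v. v \<in> carr V \<Longrightarrow> linear_on (scal V) (*) (carr V) (\<lambda>u. B u v)"
    and B_linear_right: "\<And>u. u \<in> carr V \<Longrightarrow> linear_on (scal V) (*) (carr V) (B u)"
    and B_invariant: "\<And>a u v n. a \<in> carr V \<Longrightarrow> u \<in> carr V \<Longrightarrow> v \<in> carr V \<Longrightarrow>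
      B (mode V a n u) v = B u (opp_mode V (adjoint_module V) a n v)"
    and B_nondegenerate: "\<And>u. u \<in> carr V \<Longrightarrow> \<forall>v\<in>carr V. B u v = 0 \<Longrightarrow> u = 0"
    and B_represents: "\<And>g. g \<in> restricted_dual V (adjoint_module V) \<Longrightarrow>
      \<exists>u\<in>carr V. \<forall>v\<in>carr V. B u v = g v"
begin

lemma B_add_left: "x \<in> C \<Longrightarrow> y \<in> C \<Longrightarrow> v \<in> C \<Longrightarrow> B (x + y) v = B x v + B y v"
  using B_linear_left by (auto simp: linear_on_def)

lemma B_add_right: "x \<in> C \<Longrightarrow> y \<in> C \<Longrightarrow> u \<in> C \<Longrightarrow> B u (x + y) = B u x + B u y"
  using B_linear_right by (auto simp: linear_on_def)

lemma B_scale_left [simp]: "x \<in> C \<Longrightarrow> v \<in> C \<Longrightarrow> B (sc c x) v = c * B x v"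
  using B_linear_left by (auto simp: linear_on_def)

lemma B_scale_right [simp]: "x \<in> C \<Longrightarrow> u \<in> C \<Longrightarrow> B u (sc c x) = c * B u x"
  using B_linear_right by (auto simp: linear_on_def)

lemma B_zero_left [simp]: "v \<in> C \<Longrightarrow> B 0 v = 0"
  using B_scale_left[of 0 v 0] by simp

lemma B_zero_right [simp]: "v \<in> C \<Longrightarrow> B v 0 = 0"
  using B_scale_right[of 0 v 0] by simp

lemma B_diff_left: "x \<in> C \<Longrightarrow> y \<in> C \<Longrightarrow> v \<in> C \<Longrightarrow> B (x - y) v = B x v - B y v"
  using B_add_left[of "x - y" y v] by simp

lemma B_sum_left: "v \<in> C \<Longrightarrow> (\<And>i. i \<in> A \<Longrightarrow> g i \<in> C) \<Longrightarrow> B (sum g A) v = (\<Sum>i\<in>A. B (g i) v)"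
  by (induction A rule: infinite_finite_induct) (auto simp: B_add_left)

lemma B_sum_right: "u \<in> C \<Longrightarrow> (\<And>i. i \<in> A \<Longrightarrow> g i \<in> C) \<Longrightarrow> B u (sum g A) = (\<Sum>i\<in>A. B u (g i))"
  by (induction A rule: infinite_finite_induct) (auto simp: B_add_right)

lemma B_eqI:
  assumes "x \<in> C" "y \<in> C" "\<And>u. u \<in> C \<Longrightarrow> B x u = B y u"
  shows "x = y"
  using B_nondegenerate[of "x - y"] assms by (auto simp: B_diff_left)

lemma B_Vir: "u \<in> C \<Longrightarrow> v \<in> C \<Longrightarrow> B (Vir V n u) v = B u (Vir V (- n) v)"
  by (simp add: Vir_def B_invariant adj_conf algebra_simps)

lemma B_orthogonal:
  assumes "u \<in> W d" "v \<in> W e" "d \<noteq> e"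
  shows "B u v = 0"
proof -
  have "of_int d * B u v = of_int e * B u v"
    using B_Vir[of u v 0] assms by (auto simp: weight_iff)
  then show ?thesis using assms(3) by simp
qed

lemma vac_nonzero: "vac V \<noteq> 0"
proof
  assume "vac V = 0"
  then have "x = 0" if "x \<in> C" for x using vacuum[OF that, of "-1"] that by simp
  then have "C = {0}" by auto
  then show False using simple by (simp add: simple_voa_def)
qed

lemma weight_negative: "x \<in> W n \<Longrightarrow> n < 0 \<Longrightarrow> x = 0"
  using CFT by (auto simp: CFT_type_def)

lemma weight_0: "x \<in> W 0 \<Longrightarrow> \<exists>c. x = sc c (vac V)"
  using CFT by (auto simp: CFT_type_def)

text \<open>Since V_0 is spanned by the vacuum and different weights are orthogonal, B(1,1) = 0
  would put the vacuum into the radical.\<close>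

lemma B_vac_nonzero: "B (vac V) (vac V) \<noteq> 0"
proof
  assume z: "B (vac V) (vac V) = 0"
  have "B (vac V) w = 0" if "w \<in> C" for w
    using that
  proof (induction rule: weight_induct)
    case (homog d x)
    show ?case
    proof (cases "d = 0")
      case True
      then show ?thesis using weight_0[of x] homog z by auto
    next
      case False
      then show ?thesis using B_orthogonal[OF vac_weight homog] by simp
    qed
  qed (simp add: B_add_right)
  then show False using B_nondegenerate[of "vac V"] vac_nonzero by simp
qed

lemma B_vac_L1: "y \<in> C \<Longrightarrow> B (vac V) (Vir V 1 y) = 0"
  using B_Vir[of "vac V" y "-1"] by (simp add: Vir_vac)

lemma B_vac_Lm1_pow: "y \<in> C \<Longrightarrow> B (vac V) ((Vir V (-1) ^^ Suc i) y) = 0"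
  using B_Vir[of "vac V" "(Vir V (-1) ^^ i) y" 1] by (simp add: Vir_vac)

text \<open>In the skew-symmetry formula all terms in the image of L(-1) are orthogonal to the
  vacuum because L(1)1 = 0, so only i = 0 contributes.\<close>

lemma B_vac_mode:
  assumes "x \<in> C" "y \<in> C"
  shows "B (vac V) (md y k x) = - ((-1) powi k) * B (vac V) (md x k y)"
proof -
  obtain K0 where "\<forall>K\<ge>K0. md y k x =
    sc (- ((-1) powi k)) (\<Sum>i<K. sc ((-1) ^ i / fact i) ((Vir V (-1) ^^ i) (md x (k + int i) y)))"
    using skew_symmetry[OF assms] by blast
  then have *: "md y k x = sc (- ((-1) powi k))
    (\<Sum>i<Suc K0. sc ((-1) ^ i / fact i) ((Vir V (-1) ^^ i) (md x (k + int i) y)))"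
    using le_Suc_eq by blast
  have "B (vac V) (md y k x) = - ((-1) powi k) *
      (\<Sum>i<Suc K0. (-1) ^ i / fact i * B (vac V) ((Vir V (-1) ^^ i) (md x (k + int i) y)))"
    unfolding * using assms
    by (subst B_scale_right) (auto simp: B_sum_right simp del: sum.lessThan_Suc scale_minus_left)
  also have "(\<Sum>i<Suc K0. (-1) ^ i / fact i * B (vac V) ((Vir V (-1) ^^ i) (md x (k + int i) y))) =
      B (vac V) (md x k y)"
    using assms by (subst sum.lessThan_Suc_shift) (simp add: B_vac_Lm1_pow del: funpow.simps(2))
  finally show ?thesis .
qed

text \<open>Writing u as u_{-1}1 shows that the functional B(1, -) determines the whole
  form.\<close>

lemma B_via_vac: "u \<in> C \<Longrightarrow> v \<in> C \<Longrightarrow> B u v = B (vac V) (adj u (-1) v)"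
  using B_invariant[of u "vac V" v "-1"] by (simp add: creation)

text \<open>With \<open>A j k = B(1, (L(1)\<^sup>j v)\<^sub>2\<^sub>d\<^sub>-\<^sub>1\<^sub>-\<^sub>j\<^sub>-\<^sub>k L(1)\<^sup>k u)\<close>, both sides are combinations of
  \<open>A 0 k\<close> resp. \<open>A k 0\<close>; the recursion for \<open>A\<close> expresses \<open>B(1, L(1) y) = 0\<close>.\<close>

lemma B_symmetric_homog:
  assumes u: "u \<in> W d" and v: "v \<in> W d"
  shows "B u v = B v u"
proof -
  define A where "A = (\<lambda>j k. B (vac V)
    (md ((Vir V 1 ^^ j) v) (2 * d - 1 - int j - int k) ((Vir V 1 ^^ k) u)))"
  have rel: "A j (Suc k) + A (Suc j) k = (of_nat j - of_nat k) * A j k" for j k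
  proof -
    let ?v = "(Vir V 1 ^^ j) v" and ?u = "(Vir V 1 ^^ k) u" and ?n = "2 * d - 2 - int j - int k"
    have "?v \<in> W (d - int j)" using Vir_pow_weight[OF v, of j 1] by simp
    then have "Vir V 1 (md ?v ?n ?u) = md ?v ?n (Vir V 1 ?u) + md (Vir V 1 ?v) ?n ?u
        + sc (of_int (2 * (d - int j) - ?n - 2)) (md ?v (?n + 1) ?u)"
      by (rule L1_mode) (use u in simp)
    moreover have "B (vac V) (Vir V 1 (md ?v ?n ?u)) = 0"
      by (rule B_vac_L1) (use u v in simp)
    ultimately have "B (vac V) (md ?v ?n (Vir V 1 ?u)) + B (vac V) (md (Vir V 1 ?v) ?n ?u)
        + of_int (int k - int j) * B (vac V) (md ?v (?n + 1) ?u) = 0"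
      using u v by (simp add: B_add_right)
    then show ?thesis
      by (simp add: A_def algebra_simps add_eq_0_iff2)
  qed
  obtain K1 where K1: "\<forall>K\<ge>K1. adj u (-1) v =
    (\<Sum>k<K. sc ((-1) powi d / fact k) (md ((Vir V 1 ^^ k) u) (2 * d - int k - (-1) - 2) v))"
    using adj_homog[OF u, of v "-1"] v by auto
  obtain K2 where K2: "\<forall>K\<ge>K2. adj v (-1) u =
    (\<Sum>k<K. sc ((-1) powi d / fact k) (md ((Vir V 1 ^^ k) v) (2 * d - int k - (-1) - 2) u))"
    using adj_homog[OF v, of u "-1"] u by auto
  let ?K = "max K1 K2"
  have A0: "B (vac V) (md ((Vir V 1 ^^ k) u) (2 * d - int k - (-1) - 2) v) = (-1) ^ k * A 0 k" for k
  proof -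
    \<comment> \<open>The parity of the mode index cancels the minus sign of skew-symmetry and
      leaves the sign that \<open>alternating_symmetry\<close> absorbs.\<close>
    have "(-1) powi (2 * d - 1 - int k) = (- ((-1) ^ k) :: complex)"
      by (cases "even k") auto
    then show ?thesis
      using B_vac_mode[of v "(Vir V 1 ^^ k) u" "2 * d - 1 - int k"] u v
      by (simp add: A_def algebra_simps)
  qed
  have A_flip: "(-1) ^ k * A 0 k = A k 0" for k
    by (subst alternating_symmetry[of A k 0, OF rel]) simp
  have "B u v = (\<Sum>k<?K. (-1) powi d / fact k *
      B (vac V) (md ((Vir V 1 ^^ k) u) (2 * d - int k - (-1) - 2) v))"
    using B_via_vac[of u v] K1[rule_format, of ?K] u v by (simp add: B_sum_right)
  also have "\<dots> = (\<Sum>k<?K. (-1) powi d / fact k * A k 0)"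
    unfolding A0 by (simp only: A_flip)
  also have "\<dots> = (\<Sum>k<?K. (-1) powi d / fact k *
      B (vac V) (md ((Vir V 1 ^^ k) v) (2 * d - int k - (-1) - 2) u))"
    by (simp add: A_def algebra_simps)
  also have "\<dots> = B v u"
    using B_via_vac[of v u] K2[rule_format, of ?K] u v by (simp add: B_sum_right)
  finally show ?thesis .
qed

lemma B_symmetric:
  assumes "u \<in> C" "v \<in> C"
  shows "B u v = B v u"
  using assms(1)
proof (induction rule: weight_induct)
  case u: (homog d u)
  show ?case
    using assms(2)
  proof (induction rule: weight_induct)
    case (homog e v)
    then show ?case
      using u B_symmetric_homog B_orthogonal[of u d v e] B_orthogonal[of v e u d]
      by (cases "d = e") auto
  qed (use u in \<open>simp add: B_add_left B_add_right\<close>)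
qed (use assms in \<open>simp add: B_add_left B_add_right\<close>)

section \<open>Invariance of the form under automorphisms\<close>

lemma automorphism_facts:
  assumes "voa_automorphism V t"
  shows "x \<in> C \<Longrightarrow> t x \<in> C"
    and "x \<in> C \<Longrightarrow> y \<in> C \<Longrightarrow> t (x + y) = t x + t y"
    and "x \<in> C \<Longrightarrow> t (sc c x) = sc c (t x)"
    and "x \<in> C \<Longrightarrow> y \<in> C \<Longrightarrow> t (md x n y) = md (t x) n (t y)"
    and "x \<in> C \<Longrightarrow> t (Vir V n x) = Vir V n (t x)"
    and "t (vac V) = vac V" "t (conf V) = conf V"
  using assms by (auto simp: voa_automorphism_def linear_on_def Vir_def bij_betw_def)

lemma automorphism_weight:
  "voa_automorphism V t \<Longrightarrow> x \<in> W d \<Longrightarrow> t x \<in> W d"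
  by (auto simp: weight_iff automorphism_facts simp flip: automorphism_facts(5))

text \<open>An automorphism fixes the vacuum and preserves weights, hence fixes the functional B(1,
  -); it also commutes with forming opposite modes, and these two data determine
  \<open>B\<close>.\<close>

lemma B_automorphism:
  assumes t: "voa_automorphism V t" and "u \<in> C" "v \<in> C"
  shows "B (t u) (t v) = B u v"
proof -
  have "B (vac V) (t w) = B (vac V) w" if "w \<in> C" for w
    using that
  proof (induction rule: weight_induct)
    case (homog d x)
    show ?case
    proof (cases "d = 0")
      case True
      then show ?thesis using weight_0[of x] homog automorphism_facts[OF t] by auto
    next
      case False
      then show ?thesis
        using B_orthogonal[OF vac_weight homog] B_orthogonal[OF vac_weight automorphism_weight[OF t homog]]
        by simp
    qed
  qed (simp add: B_add_right automorphism_facts[OF t])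
  moreover have "t (adj u (-1) v) = adj (t u) (-1) (t v)"
    by (rule adj_map[of t C])
       (use assms automorphism_facts[OF t] automorphism_weight[OF t] in auto)
  ultimately show ?thesis
    using B_via_vac[of u v] B_via_vac[of "t u" "t v"] assms automorphism_facts(1)[OF t]
    by (metis adj_in)
qed

end

section \<open>From self-duality to a normalised invariant form\<close>

locale voa_form = voa_dual_form +
  assumes B_vac: "B (vac V) (vac V) = 1"

text \<open>An isomorphism T from V to its contragredient is read as the form T u v. The
  intertwining property becomes invariance, injectivity becomes nondegeneracy, and surjectivity
  represents every functional of the restricted dual.\<close>

lemma self_dual_form:
  fixes V :: "('v::ab_group_add) voa_data"
  assumes "voa V" "self_dual V" "simple_voa V" "CFT_type V"
  shows "\<exists>B. voa_form V B"
proof -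
  interpret voa V by fact
  let ?A = "adjoint_module V"
  obtain T where "module_iso V ?A (contragredient V ?A) T"
    using assms(2) by (auto simp: self_dual_def)
  then have bij: "bij_betw T C (restricted_dual V ?A)"
    and add: "\<And>x y. x \<in> C \<Longrightarrow> y \<in> C \<Longrightarrow> T (x + y) = T x + T y"
    and scale: "\<And>c x. x \<in> C \<Longrightarrow> T (sc c x) = (\<lambda>w. c * T x w)"
    and mode: "\<And>a n w. a \<in> C \<Longrightarrow> w \<in> C \<Longrightarrow>
      T (md a n w) = (\<lambda>v. if v \<in> C then T w (adj a n v) else 0)"
    by (auto simp: module_iso_def linear_on_def contragredient_def adjoint_module_def)
  have rd: "T u \<in> restricted_dual V ?A" if "u \<in> C" for u
    using bij that by (auto simp: bij_betw_def)
  have lin: "linear_on sc (*) C (T u)" if "u \<in> C" for u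
    using rd[OF that] by (simp add: restricted_dual_def adjoint_module_def)
  have out: "T u x = 0" if "u \<in> C" "x \<notin> C" for u x
    using rd[OF that(1)] that by (simp add: restricted_dual_def adjoint_module_def)
  have z: "T 0 = (\<lambda>w. 0)" using scale[of 0 0] by simp
  interpret F: voa_dual_form V T
  proof
    show "simple_voa V" "CFT_type V" by fact+
    show "linear_on sc (*) C (\<lambda>u. T u v)" if "v \<in> C" for v
      using that by (simp add: linear_on_def add scale)
    show "linear_on sc (*) C (T u)" if "u \<in> C" for u by (rule lin[OF that])
    show "T (md a n u) v = T u (adj a n v)" if "a \<in> C" "u \<in> C" "v \<in> C" for a u v n
      using that by (simp add: mode)
    show "u = 0" if "u \<in> C" "\<forall>v\<in>C. T u v = 0" for u
    proof -
      have "T u = T 0" using that out by (auto simp: z fun_eq_iff)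
      then show ?thesis using bij that by (auto simp: bij_betw_def inj_on_def)
    qed
    show "\<exists>u\<in>C. \<forall>v\<in>C. T u v = g v" if "g \<in> restricted_dual V ?A" for g
      using that unfolding bij_betw_imp_surj_on[OF bij, symmetric] by auto
  qed
  \<comment> \<open>The unnormalised form already gives \<open>t\<close> nonzero, so the form can be
    divided by it.\<close>
  define t where "t = T (vac V) (vac V)"
  have t: "t \<noteq> 0" using F.B_vac_nonzero by (simp add: t_def)
  have "voa_form V (\<lambda>u v. T u v / t)"
  proof
    show "simple_voa V" "CFT_type V" by fact+
    show "linear_on sc (*) C (\<lambda>u. T u v / t)" if "v \<in> C" for v
      using F.B_linear_left[OF that] by (simp add: linear_on_def add_divide_distrib)
    show "linear_on sc (*) C (\<lambda>v. T u v / t)" if "u \<in> C" for u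
      using lin[OF that] by (simp add: linear_on_def add_divide_distrib)
    show "T (md a n u) v / t = T u (adj a n v) / t" if "a \<in> C" "u \<in> C" "v \<in> C" for a u v n
      using that by (simp add: mode)
    show "u = 0" if "u \<in> C" "\<forall>v\<in>C. T u v / t = 0" for u
      using F.B_nondegenerate[OF that(1)] that t by simp
    show "\<exists>u\<in>C. \<forall>v\<in>C. T u v / t = g v" if g: "g \<in> restricted_dual V ?A" for g
    proof -
      obtain u where "u \<in> C" "\<forall>v\<in>C. T u v = g v" using F.B_represents[OF g] by blast
      then show ?thesis using t by (intro bexI[of _ "sc t u"]) (auto simp: scale)
    qed
    show "T (vac V) (vac V) / t = 1" using t by (simp add: t_def)
  qed
  then show ?thesis by blast
qed

section \<open>The grading by a cyclic automorphism\<close>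

lemma root_of_unity_power: "p > 0 \<Longrightarrow> root_of_unity p ^ p = 1"
  by (simp add: root_of_unity_def exp_of_nat_mult[symmetric] exp_two_pi_i)

lemma root_of_unity_nonzero [simp]: "root_of_unity p \<noteq> 0"
  by (simp add: root_of_unity_def)

lemma root_of_unity_powi_eq_1_iff:
  assumes "p > 0"
  shows "root_of_unity p powi j = 1 \<longleftrightarrow> int p dvd j"
proof
  assume "int p dvd j"
  then obtain k where "j = int p * k" by blast
  then show "root_of_unity p powi j = 1"
    using root_of_unity_power[OF assms] by (simp add: power_int_mult)
next
  assume 1: "root_of_unity p powi j = 1"
  have "root_of_unity p = cis (2 * pi / of_nat p)"
    by (simp add: root_of_unity_def cis_conv_exp algebra_simps)
  then have "cos (of_int j * (2 * pi / of_nat p)) = 1"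
    using arg_cong[OF 1, of Re] by (simp add: cis_power_int)
  then obtain n where "of_int j * (2 * pi / of_nat p) = of_int n * 2 * pi"
    by (auto simp: cos_one_2pi_int)
  then have "real_of_int j = of_int n * of_nat p" using assms by (simp add: field_simps)
  then have "j = n * int p" by (metis of_int_eq_iff of_int_mult of_int_of_nat_eq)
  then show "int p dvd j" by simp
qed

text \<open>Orthogonality of the characters of Z/p, by summing a geometric series.\<close>

lemma root_of_unity_sum:
  assumes "p > 0"
  shows "(\<Sum>l<p. (root_of_unity p powi j) ^ l) = (if int p dvd j then of_nat p else 0)"
proof (cases "int p dvd j")
  case True
  then have "root_of_unity p powi j = 1" using root_of_unity_powi_eq_1_iff[OF assms] by blast
  then show ?thesis using True by simp
next
  case False
  have "(root_of_unity p powi j) ^ p = root_of_unity p powi (int p * j)"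
    by (simp add: power_int_power' mult.commute)
  also have "\<dots> = 1" by (simp add: root_of_unity_powi_eq_1_iff[OF assms])
  finally have "(root_of_unity p powi j) ^ p = 1" .
  moreover have "root_of_unity p powi j \<noteq> 1"
    using False root_of_unity_powi_eq_1_iff[OF assms] by blast
  ultimately show ?thesis using False by (simp add: geometric_sum)
qed

text \<open>Spans are formed in the ambient type while modes are linear only on the carrier, so
  membership in the carrier is carried through the induction.\<close>

lemma (in voa) span_carr_induct [consumes 2, case_names base step]:
  assumes "S \<subseteq> C" "x \<in> span S" "Q 0"
    and "\<And>c s y. s \<in> S \<Longrightarrow> s \<in> C \<Longrightarrow> y \<in> C \<Longrightarrow> Q y \<Longrightarrow> Q (sc c s + y)"
  shows "Q x"
proof -
  have "x \<in> C \<and> Q x"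
    using assms(2) by (induction rule: span_induct_alt) (use assms in auto)
  then show ?thesis by blast
qed

locale voa_cyclic = voa V for V :: "('v::ab_group_add) voa_data" +
  fixes f :: "'v \<Rightarrow> 'v" and p :: nat
  assumes p_pos: "p > 0" and f_auto: "voa_automorphism V f"
    and f_pow_p: "\<And>x. x \<in> carr V \<Longrightarrow> (f ^^ p) x = x"
begin

lemma f_in [simp]: "x \<in> C \<Longrightarrow> f x \<in> C"
  and f_add: "x \<in> C \<Longrightarrow> y \<in> C \<Longrightarrow> f (x + y) = f x + f y"
  and f_scale: "x \<in> C \<Longrightarrow> f (sc c x) = sc c (f x)"
  and f_mode: "x \<in> C \<Longrightarrow> y \<in> C \<Longrightarrow> f (md x n y) = md (f x) n (f y)"
  and f_vac: "f (vac V) = vac V" and f_conf: "f (conf V) = conf V"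
  using f_auto by (auto simp: voa_automorphism_def linear_on_def bij_betw_def)

lemma f_zero [simp]: "f 0 = 0"
  using f_scale[of 0 0] by simp

lemma f_sum: "(\<And>i. i \<in> A \<Longrightarrow> g i \<in> C) \<Longrightarrow> f (sum g A) = (\<Sum>i\<in>A. f (g i))"
  by (induction A rule: infinite_finite_induct) (auto simp: f_add)

lemma f_Vir: "x \<in> C \<Longrightarrow> f (Vir V n x) = Vir V n (f x)"
  by (simp add: Vir_def f_mode f_conf)

lemma f_weight: "x \<in> W d \<Longrightarrow> f x \<in> W d"
  by (simp add: weight_iff f_Vir[symmetric] f_scale)

lemma f_pow_in [simp]: "x \<in> C \<Longrightarrow> (f ^^ l) x \<in> C"
  by (induction l) auto

lemma f_pow_add: "x \<in> C \<Longrightarrow> y \<in> C \<Longrightarrow> (f ^^ l) (x + y) = (f ^^ l) x + (f ^^ l) y"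
  by (induction l) (auto simp: f_add)

lemma f_pow_scale: "x \<in> C \<Longrightarrow> (f ^^ l) (sc c x) = sc c ((f ^^ l) x)"
  by (induction l) (auto simp: f_scale)

lemma f_pow_mode: "x \<in> C \<Longrightarrow> y \<in> C \<Longrightarrow> (f ^^ l) (md x n y) = md ((f ^^ l) x) n ((f ^^ l) y)"
  by (induction l) (auto simp: f_mode)

section \<open>Eigenspaces and Fourier projections\<close>

abbreviation "\<xi> \<equiv> root_of_unity p"

definition E :: "int \<Rightarrow> 'v set" where
  "E i = {x \<in> C. f x = sc (\<xi> powi i) x}"

text \<open>The discrete Fourier projection onto the eigenspace \<open>E i\<close>.\<close>

definition P :: "int \<Rightarrow> 'v \<Rightarrow> 'v" where
  "P i x = sc (1 / of_nat p) (\<Sum>l<p. sc (\<xi> powi (- (i * int l))) ((f ^^ l) x))"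

lemma E_in [simp]: "x \<in> E i \<Longrightarrow> x \<in> C"
  and E_f: "x \<in> E i \<Longrightarrow> f x = sc (\<xi> powi i) x"
  and E_I: "x \<in> C \<Longrightarrow> f x = sc (\<xi> powi i) x \<Longrightarrow> x \<in> E i"
  by (simp_all add: E_def)

lemma subspace_E: "subspace (E i)"
  by (rule subspaceI; rule E_I) (simp_all add: E_f f_add f_scale scale_right_distrib mult.commute)

lemma E_zero [simp]: "0 \<in> E i"
  and E_add: "x \<in> E i \<Longrightarrow> y \<in> E i \<Longrightarrow> x + y \<in> E i"
  and E_scale: "x \<in> E i \<Longrightarrow> sc c x \<in> E i"
  using subspace_0[OF subspace_E] subspace_add[OF subspace_E]
    subspace_scale[OF subspace_E] by auto

lemma E_sum: "(\<And>a. a \<in> A \<Longrightarrow> g a \<in> E i) \<Longrightarrow> sum g A \<in> E i"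
  using subspace_sum[OF subspace_E] by blast

lemma E_cong: "i mod int p = j mod int p \<Longrightarrow> E i = E j"
proof -
  assume "i mod int p = j mod int p"
  then have "\<xi> powi (i - j) = 1"
    using root_of_unity_powi_eq_1_iff[OF p_pos] by (simp add: mod_eq_dvd_iff)
  then have "\<xi> powi i = \<xi> powi j" by (simp add: power_int_diff)
  then show "E i = E j" by (simp only: E_def)
qed

lemma E_mod [simp]: "E (i mod int p) = E i"
  by (rule E_cong) simp

lemma E_mode: "x \<in> E i \<Longrightarrow> y \<in> E j \<Longrightarrow> md x n y \<in> E (i + j)"
  by (rule E_I) (simp_all add: E_f f_mode mode_scale_left mode_scale_right power_int_add mult.commute)

lemma E_vac [simp]: "vac V \<in> E 0"
  by (rule E_I) (simp_all add: f_vac)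

lemma E_conf [simp]: "conf V \<in> E 0"
  by (rule E_I) (simp_all add: f_conf)

lemma E_Vir: "x \<in> E i \<Longrightarrow> Vir V n x \<in> E i"
  using E_mode[OF E_conf, of x i] by (simp add: Vir_def)

lemma E_homog_comp:
  assumes "x \<in> E i"
  shows "homog_comp V x d \<in> E i"
proof -
  have "f (homog_comp V x d) = homog_comp V (f x) d"
    using assms by (intro homog_comp_map[symmetric]) (auto simp: f_add f_weight)
  also have "\<dots> = homog_comp V (sc (\<xi> powi i) x) d" using assms by (simp add: E_f)
  also have "\<dots> = sc (\<xi> powi i) (homog_comp V x d)"
    using assms by (intro homog_comp_map) (auto simp: scale_right_distrib weight_scale)
  finally show ?thesis using assms by (intro E_I) auto
qed

lemma f_pow_E: "x \<in> E i \<Longrightarrow> (f ^^ l) x = sc ((\<xi> powi i) ^ l) x"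
  by (induction l) (auto simp: E_f f_scale mult.commute)

lemma P_in [simp]: "x \<in> C \<Longrightarrow> P i x \<in> C"
  by (auto simp: P_def)

lemma P_add: "x \<in> C \<Longrightarrow> y \<in> C \<Longrightarrow> P i (x + y) = P i x + P i y"
  by (simp add: P_def f_pow_add scale_right_distrib sum.distrib)

lemma P_scale: "x \<in> C \<Longrightarrow> P i (sc c x) = sc c (P i x)"
  by (simp add: P_def f_pow_scale scale_sum_right mult.commute mult.left_commute)

lemma P_E: "x \<in> C \<Longrightarrow> P i x \<in> E i"
proof -
  assume x: "x \<in> C"
  define g where "g = (\<lambda>l. sc (\<xi> powi (- (i * int l))) ((f ^^ l) x))"
  have "\<xi> powi (- (i * int p)) = 1"
    using root_of_unity_powi_eq_1_iff[OF p_pos, of "- (i * int p)"] by simp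
  \<comment> \<open>Periodicity of the summands makes the sum invariant under a cyclic shift, and
    applying \<open>f\<close> is such a shift up to the factor \<xi>^i.\<close>
  then have gp: "g p = g 0" using x by (simp add: g_def f_pow_p)
  have "g 0 + (\<Sum>l<p. g (Suc l)) = (\<Sum>l<Suc p. g l)" by (simp only: sum.lessThan_Suc_shift)
  then have shift: "(\<Sum>l<p. g (Suc l)) = (\<Sum>l<p. g l)" using gp by simp
  have "f (g l) = sc (\<xi> powi i) (g (Suc l))" for l
  proof -
    have "\<xi> powi (- (i * int l)) = \<xi> powi i * \<xi> powi (- (i * int (Suc l)))"
      by (simp add: power_int_add[symmetric] algebra_simps)
    then show ?thesis using x by (simp add: g_def f_scale)
  qed
  moreover have "f (\<Sum>l<p. g l) = (\<Sum>l<p. f (g l))" by (rule f_sum) (use x in \<open>simp add: g_def\<close>)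
  ultimately have "f (\<Sum>l<p. g l) = sc (\<xi> powi i) (\<Sum>l<p. g l)"
    using shift by (simp flip: scale_sum_right)
  then show ?thesis using x
    by (intro E_I) (auto simp: P_def g_def f_scale mult.commute)
qed

lemma P_on_E: "x \<in> E j \<Longrightarrow> P i x = (if j mod int p = i mod int p then x else 0)"
proof -
  assume x: "x \<in> E j"
  have "\<xi> powi (- (i * int l)) * (\<xi> powi j) ^ l = (\<xi> powi (j - i)) ^ l" for l
    by (simp add: power_int_power' power_int_add[symmetric] algebra_simps)
  then have "P i x = sc (1 / of_nat p) (\<Sum>l<p. sc ((\<xi> powi (j - i)) ^ l) x)"
    using x by (simp add: P_def f_pow_E)
  also have "\<dots> = sc (1 / of_nat p * (\<Sum>l<p. (\<xi> powi (j - i)) ^ l)) x"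
    by (simp only: scale_sum_left flip: scale_scale)
  finally show ?thesis using p_pos by (simp add: root_of_unity_sum mod_eq_dvd_iff)
qed

text \<open>Summing the characters over i first leaves only the power l = 0 of
  \<open>f\<close>.\<close>

lemma P_sum: "x \<in> C \<Longrightarrow> (\<Sum>i<p. P (int i) x) = x"
proof -
  assume x: "x \<in> C"
  have c: "(\<Sum>i<p. \<xi> powi (- (int i * int l))) = (if l = 0 then of_nat p else 0)" if "l < p" for l
  proof -
    have "(\<Sum>i<p. \<xi> powi (- (int i * int l))) = (\<Sum>i<p. (\<xi> powi (- int l)) ^ i)"
      by (simp add: power_int_power' mult.commute)
    also have "\<dots> = (if l = 0 then of_nat p else 0)"
      using that by (auto simp: root_of_unity_sum[OF p_pos] dest: zdvd_imp_le)
    finally show ?thesis .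
  qed
  have "(\<Sum>i<p. P (int i) x) =
      sc (1 / of_nat p) (\<Sum>l<p. \<Sum>i<p. sc (\<xi> powi (- (int i * int l))) ((f ^^ l) x))"
    by (subst sum.swap) (simp add: P_def scale_sum_right)
  also have "\<dots> = sc (1 / of_nat p) (\<Sum>l<p. sc (if l = 0 then of_nat p else 0) ((f ^^ l) x))"
    using c by (simp flip: scale_sum_left)
  also have "(\<Sum>l<p. sc (if l = 0 then of_nat p else 0) ((f ^^ l) x)) =
      (\<Sum>l\<in>{0}. sc (if l = 0 then of_nat p else 0) ((f ^^ l) x))"
    by (rule sum.mono_neutral_right) (use p_pos in auto)
  finally show ?thesis using p_pos by simp
qed

lemma grade_induct [consumes 1, case_names homog add]:
  assumes "x \<in> C" and "\<And>i x. x \<in> E i \<Longrightarrow> Q x"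
    and "\<And>x y. x \<in> C \<Longrightarrow> y \<in> C \<Longrightarrow> Q x \<Longrightarrow> Q y \<Longrightarrow> Q (x + y)"
  shows "Q x"
proof -
  have "(\<Sum>i<k. P (int i) x) \<in> C \<and> Q (\<Sum>i<k. P (int i) x)" for k
  proof (induction k)
    case 0
    show ?case using assms(2)[OF E_zero] by simp
  next
    case (Suc k)
    then show ?case using assms(1,3) assms(2)[OF P_E[OF assms(1)]] by simp
  qed
  from this[of p] show ?thesis using P_sum[OF assms(1)] by simp
qed

text \<open>Acting on y of degree k shifts degrees by k. In the proof of irreducibility this
  identifies the degree k part of v_n w with (P_0 v)_n w.\<close>

lemma P_mode_left: "x \<in> C \<Longrightarrow> y \<in> E k \<Longrightarrow> P (i + k) (md x n y) = md (P i x) n y"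
proof -
  assume x: "x \<in> C" and y: "y \<in> E k"
  have "\<xi> powi (- ((i + k) * int l)) * (\<xi> powi k) ^ l = \<xi> powi (- (i * int l))" for l
    by (simp add: power_int_power' power_int_add[symmetric] algebra_simps)
  then show ?thesis using x y
    by (simp add: P_def f_pow_mode f_pow_E mode_scale_left mode_scale_right mode_sum_left)
qed

text \<open>Scales every eigenspace separately, using the representatives 0, ..., p - 1 of the
  degrees. It is the means of rescaling a conjugation degree by degree.\<close>

definition diag :: "(int \<Rightarrow> complex) \<Rightarrow> 'v \<Rightarrow> 'v" where
  "diag m x = (\<Sum>i<p. sc (m (int i)) (P (int i) x))"

lemma diag_in [simp]: "x \<in> C \<Longrightarrow> diag m x \<in> C"
  by (auto simp: diag_def)

lemma diag_add: "x \<in> C \<Longrightarrow> y \<in> C \<Longrightarrow> diag m (x + y) = diag m x + diag m y"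
  by (simp add: diag_def P_add scale_right_distrib sum.distrib)

lemma diag_scale: "x \<in> C \<Longrightarrow> diag m (sc c x) = sc c (diag m x)"
  by (simp add: diag_def P_scale scale_sum_right mult.commute)

lemma diag_E: "x \<in> E j \<Longrightarrow> diag m x = sc (m (j mod int p)) x"
proof -
  assume x: "x \<in> E j"
  have "diag m x = (\<Sum>i\<in>{nat (j mod int p)}. sc (m (int i)) (P (int i) x))"
    unfolding diag_def
    by (rule sum.mono_neutral_right) (use x p_pos in \<open>auto simp: P_on_E nat_less_iff\<close>)
  then show ?thesis using x p_pos by (simp add: P_on_E)
qed

end

locale voa_form_cyclic = voa_form V B + voa_cyclic V f p
  for V :: "('v::ab_group_add) voa_data" and B f p
begin

text \<open>Invariance under \<open>f\<close> multiplies B(u,v) by \<xi>^(i+j), which differs from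
  1.\<close>

lemma B_E_orthogonal:
  assumes "u \<in> E i" "v \<in> E j" "(i + j) mod int p \<noteq> 0"
  shows "B u v = 0"
proof -
  have "B u v = B (f u) (f v)" using B_automorphism[OF f_auto] assms by simp
  also have "\<dots> = \<xi> powi (i + j) * B u v"
    using assms by (simp add: E_f power_int_add)
  finally have "(1 - \<xi> powi (i + j)) * B u v = 0" by (simp add: algebra_simps)
  moreover have "\<xi> powi (i + j) \<noteq> 1"
    using root_of_unity_powi_eq_1_iff[OF p_pos] assms(3) by (auto simp: dvd_eq_mod_eq_0)
  ultimately show ?thesis by simp
qed

lemma B_E_eqI:
  assumes "x \<in> E i" "y \<in> E i" "\<And>u. u \<in> E (- i) \<Longrightarrow> B x u = B y u"
  shows "x = y"
proof (rule B_eqI)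
  fix u assume "u \<in> C"
  then show "B x u = B y u"
  proof (induction rule: grade_induct)
    case (homog j u)
    show ?case
    proof (cases "(i + j) mod int p = 0")
      case True
      then have "E j = E (- i)"
        by (intro E_cong) (simp add: mod_eq_dvd_iff dvd_eq_mod_eq_0 add.commute)
      then show ?thesis using assms homog by simp
    next
      case False
      then show ?thesis using B_E_orthogonal assms homog by metis
    qed
  qed (use assms in \<open>simp add: B_add_right\<close>)
qed (use assms in auto)

text \<open>The ideal generated by a \<open>V\<^sup>0\<close>-submodule \<open>U\<close> of \<open>V\<^sup>k\<close> is spanned by the \<open>v\<^sub>n w\<close> with
  \<open>w \<in> U\<close>, and its intersection with \<open>V\<^sup>k\<close> is \<open>U\<close>.\<close>

lemma E_irreducible:
  assumes U: "subspace U" "U \<subseteq> E k" "\<exists>w\<in>U. w \<noteq> 0"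
    and stable: "\<And>a w n. a \<in> E 0 \<Longrightarrow> w \<in> U \<Longrightarrow> md a n w \<in> U"
  shows "U = E k"
proof -
  define S where "S = {md v n w | v n w. v \<in> C \<and> w \<in> U}"
  define I where "I = span S"
  have sub: "subspace I" by (simp add: I_def)
  have UC: "w \<in> C" if "w \<in> U" for w using U(2) that by auto
  have "S \<subseteq> C" using UC by (auto simp: S_def)
  then have IC: "I \<subseteq> C" unfolding I_def using span_minimal[OF _ subspace_carr] by simp
  \<comment> \<open>Associativity expresses u_q v_n w through the vectors (u_k v)_m w, which are
    generators again.\<close>
  have left_gen: "md u q (md v n w) \<in> I" if u: "u \<in> C" "v \<in> C" and w: "w \<in> U" for u v w q n
  proof -
    obtain m where m: "\<forall>j\<ge>m. md u j w = 0" using truncation u(1) UC[OF w] by blast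
    obtain N where N: "\<forall>n\<ge>N. md v n w = 0" using truncation u(2) UC[OF w] by blast
    show ?thesis
    proof (rule assoc_triangular[OF sub, of N _ m])
      show "md u q (md v n w) = 0" if "n \<ge> N" for q n using N that u by simp
      fix k n
      obtain K0 where K0: "\<forall>K\<ge>K0.
          (\<Sum>i<K. sc (of_int m gchoose i) (md (md u (k + int i) v) (m + n - int i) w)) =
          (\<Sum>i<K. sc ((-1) ^ i * (of_int k gchoose i)) (md u (m + k - int i) (md v (n + int i) w)))"
        using associativity[of u v w m k n] u UC[OF w] m by auto
      have "(\<Sum>i<K. sc (of_int m gchoose i) (md (md u (k + int i) v) (m + n - int i) w)) \<in> I" for K
        by (intro subspace_sum[OF sub] subspace_scale[OF sub])
           (use u w in \<open>auto simp: I_def S_def intro!: span_base\<close>)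
      then show "\<exists>K0. \<forall>K\<ge>K0. (\<Sum>i<K. sc ((-1) ^ i * (of_int k gchoose i))
          (md u (m + k - int i) (md v (n + int i) w))) \<in> I"
        by (intro exI[of _ K0] allI impI) (subst K0[rule_format, symmetric], assumption)
    qed
  qed
  have left: "md u q x \<in> I" if "x \<in> I" "u \<in> C" for u q x
    using \<open>S \<subseteq> C\<close> that(1) unfolding I_def
  proof (induction rule: span_carr_induct)
    case base
    then show ?case using that(2) by (simp add: span_zero)
  next
    case (step c x y)
    have "md u q x \<in> span S" using step(1) left_gen that(2) by (auto simp: S_def I_def)
    then show ?case
      using step that(2) by (simp add: mode_add_right mode_scale_right span_add span_scale)
  qed
  have Lpow: "(Vir V (-1) ^^ i) x \<in> I" if "x \<in> I" for i x
    using that left by (induction i) (auto simp: Vir_def)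
  \<comment> \<open>Skew-symmetry reduces products from the other side to left products followed by
    powers of L(-1), itself a left product by \<omega>.\<close>
  have right: "md x q u \<in> I" if x: "x \<in> I" and u: "u \<in> C" for u q x
  proof -
    obtain K0 where "\<forall>K\<ge>K0. md x q u =
      sc (- ((-1) powi q)) (\<Sum>i<K. sc ((-1) ^ i / fact i) ((Vir V (-1) ^^ i) (md u (q + int i) x)))"
      using skew_symmetry[of u x q] u x IC by blast
    then have "md x q u =
      sc (- ((-1) powi q)) (\<Sum>i<K0. sc ((-1) ^ i / fact i) ((Vir V (-1) ^^ i) (md u (q + int i) x)))"
      by blast
    also have "\<dots> \<in> I"
      by (intro subspace_scale[OF sub] subspace_sum[OF sub] Lpow left x u)
    finally show ?thesis .
  qed
  obtain w where w: "w \<in> U" "w \<noteq> 0" using U(3) by blast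
  have "md (vac V) (-1) w \<in> I"
    unfolding I_def by (rule span_base) (use w in \<open>auto simp: S_def\<close>)
  then have "I \<noteq> {0}" using w UC by (auto simp: vacuum)
  moreover have "I = {0} \<or> I = C"
    by (rule simple[unfolded simple_voa_def, THEN conjunct2, rule_format])
       (use IC sub left right in blast)
  ultimately have IC: "I = C" by blast
  \<comment> \<open>Projecting a generator to degree k replaces its left factor by the V^0-part, so
    stability of \<open>U\<close> under V^0 applies.\<close>
  have PS: "P k x \<in> U" if "x \<in> I" for x
    using \<open>S \<subseteq> C\<close> that unfolding I_def
  proof (induction rule: span_carr_induct)
    case base
    then show ?case using P_on_E[of 0 k k] U(1) by (simp add: subspace_0)
  next
    case (step c x y)
    obtain v n w where x: "x = md v n w" "v \<in> C" "w \<in> U" using step by (auto simp: S_def)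
    have "P k x = md (P 0 v) n w" using P_mode_left[of v w k 0 n] x U(2) by auto
    then have "P k x \<in> U" using x stable P_E by simp
    then show ?case
      using step U(1) by (simp add: P_add P_scale subspace_add subspace_scale)
  qed
  have "x \<in> U" if "x \<in> E k" for x
    using PS[of x] P_on_E[of x k k] IC that by simp
  then show ?thesis using U(2) by blast
qed

end

section \<open>Schur's lemma\<close>

text \<open>Take a nonzero polynomial q of least degree with q(T)x = 0. A root z of q gives q = (X -
  z) r, and r(T)x is an eigenvector. \<open>T\<close> has to be linear only on
  \<open>U\<close>.\<close>

lemma (in voa) eigenvector_exists:
  assumes U: "subspace U" "U \<subseteq> span F" "finite F"
    and TU: "\<And>x. x \<in> U \<Longrightarrow> T x \<in> U"
    and Tadd: "\<And>x y. x \<in> U \<Longrightarrow> y \<in> U \<Longrightarrow> T (x + y) = T x + T y"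
    and Tscale: "\<And>c x. x \<in> U \<Longrightarrow> T (sc c x) = sc c (T x)"
    and x: "x \<in> U" "x \<noteq> 0"
  shows "\<exists>y c. y \<in> U \<and> y \<noteq> 0 \<and> T y = sc c y"
proof -
  have pow: "(T ^^ i) x \<in> U" for i by (induction i) (use TU x in auto)
  have T0: "T 0 = 0" using Tscale[OF x(1), of 0] Tscale[OF pow[of 1], of 0] by simp
  have Tsum: "T (sum g A) = (\<Sum>i\<in>A. T (g i))" if "\<And>i. i \<in> A \<Longrightarrow> g i \<in> U" for g :: "nat \<Rightarrow> 'v" and A
    using that
    by (induction A rule: infinite_finite_induct) (auto simp: T0 Tadd subspace_sum[OF U(1)])
  define ev where "ev = (\<lambda>q. \<Sum>i\<le>degree q. sc (coeff q i) ((T ^^ i) x))"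
  have evU: "ev q \<in> U" for q
    unfolding ev_def by (intro subspace_sum[OF U(1)] subspace_scale[OF U(1)] pow)
  have ev: "ev q = (\<Sum>i\<le>N. sc (coeff q i) ((T ^^ i) x))" if "degree q \<le> N" for q N
    unfolding ev_def by (rule sum.mono_neutral_left) (use that in \<open>auto simp: coeff_eq_0\<close>)
  have ev_step: "ev ([:- z, 1:] * r) = T (ev r) - sc z (ev r)" for z r
  proof -
    let ?N = "degree r"
    have c: "coeff ([:- z, 1:] * r) i = coeff (pCons 0 r) i - z * coeff r i" for i
      by simp
    have "ev ([:- z, 1:] * r) = (\<Sum>i\<le>Suc ?N. sc (coeff ([:- z, 1:] * r) i) ((T ^^ i) x))"
      by (rule ev, rule order.trans[OF degree_mult_le]) simp
    also have "\<dots> = (\<Sum>i\<le>Suc ?N. sc (coeff (pCons 0 r) i) ((T ^^ i) x))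
        - sc z (\<Sum>i\<le>Suc ?N. sc (coeff r i) ((T ^^ i) x))"
      by (simp only: c scale_left_diff_distrib sum_subtractf scale_sum_right scale_scale)
    also have "(\<Sum>i\<le>Suc ?N. sc (coeff r i) ((T ^^ i) x)) = ev r"
      by (rule ev[symmetric]) simp
    also have "(\<Sum>i\<le>Suc ?N. sc (coeff (pCons 0 r) i) ((T ^^ i) x)) =
        (\<Sum>i\<le>?N. sc (coeff r i) ((T ^^ Suc i) x))"
      by (subst sum.atMost_Suc_shift) simp
    also have "\<dots> = T (ev r)"
      unfolding ev_def using pow subspace_scale[OF U(1)] by (subst Tsum) (auto simp: Tscale)
    finally show ?thesis .
  qed
  \<comment> \<open>Linear dependence of a set sees only distinct vectors, so a repetition among the
    iterates of x is treated separately, with a difference of monomials.\<close>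
  have "\<exists>q. q \<noteq> 0 \<and> ev q = 0"
  proof (cases "inj_on (\<lambda>i. (T ^^ i) x) {..card F}")
    case False
    then obtain i j where ij: "i < j" "(T ^^ i) x = (T ^^ j) x"
      by (metis (no_types, lifting) inj_onI linorder_neqE_nat)
    let ?q = "monom 1 j - monom 1 i :: complex poly"
    have "coeff ?q j = 1" using ij by simp
    then have "?q \<noteq> 0" by (metis coeff_0 zero_neq_one)
    moreover have "degree ?q \<le> j"
      by (rule degree_diff_le) (use ij in \<open>auto simp: degree_monom_eq\<close>)
    then have "ev ?q = (\<Sum>k\<le>j. sc (coeff ?q k) ((T ^^ k) x))" by (rule ev)
    then have "ev ?q = (T ^^ j) x - (T ^^ i) x"
      using ij(1) by (simp add: scale_left_diff_distrib sum_subtractf if_distrib[of "\<lambda>c. sc c _"] cong: if_cong)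
    then have "ev ?q = 0" using ij by simp
    ultimately show ?thesis by blast
  next
    case True
    let ?S = "(\<lambda>i. (T ^^ i) x) ` {..card F}"
    have "card ?S = Suc (card F)" using True by (simp add: card_image)
    moreover have "?S \<subseteq> span F" using pow U(2) by auto
    ultimately have "dependent ?S"
      using independent_span_bound[OF U(3), of ?S] by auto
    then obtain u v where uv: "v \<in> ?S" "u v \<noteq> 0" "(\<Sum>v\<in>?S. sc (u v) v) = 0"
      by (subst (asm) dependent_finite) auto
    define q where "q = (\<Sum>i\<le>card F. monom (u ((T ^^ i) x)) i)"
    have c: "coeff q i = (if i \<le> card F then u ((T ^^ i) x) else 0)" for i
      by (simp add: q_def coeff_sum)
    have "q \<noteq> 0" using uv(1,2) c by (metis (no_types, lifting) atMost_iff coeff_0 imageE)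
    moreover have "degree q \<le> card F" by (rule degree_le) (simp add: c)
    then have "ev q = 0" using ev uv(3) c by (simp add: sum.reindex[OF True])
    ultimately show ?thesis by blast
  qed
  then obtain q where q: "q \<noteq> 0" "ev q = 0"
    and min: "\<And>r. degree r < degree q \<Longrightarrow> r \<noteq> 0 \<Longrightarrow> ev r \<noteq> 0"
    using ex_has_least_nat[of "\<lambda>q. q \<noteq> 0 \<and> ev q = 0" _ degree] by (metis not_less)
  have "degree q \<noteq> 0"
  proof
    assume "degree q = 0"
    then have "sc (coeff q 0) x = 0" using q(2) by (simp add: ev_def)
    moreover have "coeff q 0 \<noteq> 0" using \<open>degree q = 0\<close> q(1) by (metis leading_coeff_0_iff)
    ultimately show False using x by simp
  qed
  then obtain z where "poly q z = 0"
    using fundamental_theorem_of_algebra[of q] constant_degree[of q] by auto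
  then obtain r where r: "q = [:- z, 1:] * r" by (metis poly_eq_0_iff_dvd dvdE)
  have "r \<noteq> 0" using r q(1) by auto
  moreover have "degree q = Suc (degree r)"
    unfolding r using \<open>r \<noteq> 0\<close> by (subst degree_mult_eq) auto
  ultimately have "ev r \<noteq> 0" using min by simp
  moreover have "T (ev r) = sc z (ev r)" using ev_step[of z r] q(2) r by simp
  ultimately show ?thesis using evU by blast
qed

lemma (in voa) homog_comp_nonzero:
  assumes "v \<in> C" "v \<noteq> 0"
  shows "\<exists>d. homog_comp V v d \<noteq> 0"
  using decomp_sum[OF decomp_homog_comp[OF assms(1)], of "{}"] assms(2) by auto

context voa_form_cyclic
begin

text \<open>Schur's lemma for a relation, so that it applies to correspondences not known beforehand
  to be maps. Its domain is a nonzero submodule, hence all of V^k; the resulting map preserves a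
  finite-dimensional weight space and has an eigenvector there, and its eigenspace is again a
  submodule.\<close>

lemma schur_relation:
  assumes R_in: "\<And>x y. R x y \<Longrightarrow> x \<in> E k \<and> y \<in> E k"
    and R_zero: "R 0 0"
    and R_add: "\<And>x y x' y'. R x y \<Longrightarrow> R x' y' \<Longrightarrow> R (x + x') (y + y')"
    and R_scale: "\<And>c x y. R x y \<Longrightarrow> R (sc c x) (sc c y)"
    and R_mode: "\<And>a n x y. a \<in> E 0 \<Longrightarrow> R x y \<Longrightarrow> R (md a n x) (md a n y)"
    and R_unique: "\<And>y. R 0 y \<Longrightarrow> y = 0"
  shows "\<exists>c. \<forall>x y. R x y \<longrightarrow> y = sc c x"
proof (cases "\<exists>x y. R x y \<and> x \<noteq> 0")
  case False
  then have "y = sc 0 x" if "R x y" for x y using R_unique that by auto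
  then show ?thesis by blast
next
  case True
  have diff: "R (x - x') (y - y')" if "R x y" "R x' y'" for x y x' y'
    using R_add[OF that(1) R_scale[OF that(2), of "-1"]] by simp
  have unique: "y = y'" if "R x y" "R x y'" for x y y'
    using R_unique[of "y - y'"] diff[OF that] by simp
  have dom: "{x. \<exists>y. R x y} = E k"
  proof (rule E_irreducible)
    show "subspace {x. \<exists>y. R x y}"
      by (rule subspaceI) (use R_zero R_add R_scale in blast)+
  qed (use True R_in R_mode in blast)+
  define T where "T = (\<lambda>x. THE y. R x y)"
  have T: "R x (T x)" if "x \<in> E k" for x
  proof -
    have "x \<in> {x. \<exists>y. R x y}" unfolding dom by (rule that)
    then obtain y where y: "R x y" by auto
    show ?thesis unfolding T_def by (rule theI[of "R x", OF y]) (rule unique[OF _ y])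
  qed
  have T_eq: "T x = y" if "R x y" for x y using unique[OF T that] R_in[OF that] by simp
  obtain v where v: "v \<in> E k" "v \<noteq> 0" using True R_in by blast
  have "\<exists>d. homog_comp V v d \<noteq> 0" using v by (intro homog_comp_nonzero) auto
  then obtain d where d: "homog_comp V v d \<noteq> 0" by blast
  let ?U = "E k \<inter> W d"
  obtain F where F: "finite F" "W d \<subseteq> span F" using weight_space_fin_dim[of d] by blast
  have TU: "T x \<in> W d" if "x \<in> E k" "x \<in> W d" for x
  proof -
    \<comment> \<open>Since \<omega> lies in V^0, the relation is compatible with L(0) - d, which
      kills x; uniqueness over 0 then kills the image.\<close>
    have "R (Vir V 0 x - sc (of_int d) x) (Vir V 0 (T x) - sc (of_int d) (T x))"
      unfolding Vir_def by (intro diff R_scale R_mode T that) simp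
    then have "R 0 (Vir V 0 (T x) - sc (of_int d) (T x))" using that by (simp add: weight_iff)
    then have "Vir V 0 (T x) = sc (of_int d) (T x)" using R_unique[of "_ - _"] by simp
    moreover have "T x \<in> C" using R_in[OF T[OF that(1)]] by auto
    ultimately show ?thesis by (simp add: weight_iff)
  qed
  have "\<exists>y c. y \<in> ?U \<and> y \<noteq> 0 \<and> T y = sc c y"
  proof (rule eigenvector_exists)
    show "subspace ?U" by (intro subspace_inter subspace_E subspace_weight)
    show "?U \<subseteq> span F" "finite F" using F by auto
    show "T x \<in> ?U" if "x \<in> ?U" for x using that TU R_in[OF T] by auto
    show "T (x + y) = T x + T y" if "x \<in> ?U" "y \<in> ?U" for x y
      by (rule T_eq, rule R_add) (use T that in auto)
    show "T (sc c x) = sc c (T x)" if "x \<in> ?U" for c x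
      by (rule T_eq, rule R_scale) (use T that in auto)
    show "homog_comp V v d \<in> ?U" using v E_homog_comp by simp
    show "homog_comp V v d \<noteq> 0" by fact
  qed
  then obtain y c where y: "y \<in> E k" "y \<noteq> 0" "T y = sc c y" by blast
  have "{x. R x (sc c x)} = E k"
  proof (rule E_irreducible)
    show "subspace {x. R x (sc c x)}"
      by (rule subspaceI) (use R_zero R_add R_scale in \<open>force simp: scale_right_distrib mult.commute\<close>)+
    show "{x. R x (sc c x)} \<subseteq> E k" using R_in by blast
    show "\<exists>w\<in>{x. R x (sc c x)}. w \<noteq> 0" using y T by force
    show "md a n w \<in> {x. R x (sc c x)}" if "a \<in> E 0" "w \<in> {x. R x (sc c x)}" for a n w
    proof -
      have w: "R w (sc c w)" using that by simp
      then have "w \<in> C" using R_in by force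
      then show ?thesis using R_mode[OF that(1) w, of n] that(1) by (simp add: mode_scale_right)
    qed
  qed
  then have "R x (sc c x)" if "R x y" for x y using R_in[OF that] by auto
  then have "y = sc c x" if "R x y" for x y using unique[OF that] that by blast
  then show ?thesis by blast
qed

lemma schur:
  assumes "\<And>x. x \<in> E k \<Longrightarrow> T x \<in> E k"
    and "\<And>x y. x \<in> E k \<Longrightarrow> y \<in> E k \<Longrightarrow> T (x + y) = T x + T y"
    and scale: "\<And>c x. x \<in> E k \<Longrightarrow> T (sc c x) = sc c (T x)"
    and "\<And>a n x. a \<in> E 0 \<Longrightarrow> x \<in> E k \<Longrightarrow> T (md a n x) = md a n (T x)"
  shows "\<exists>c. \<forall>x\<in>E k. T x = sc c x"
proof -
  have T0: "T 0 = 0" using scale[of 0 0] by simp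
  have m: "md a n x \<in> E k" if "a \<in> E 0" "x \<in> E k" for a n x using E_mode[OF that] by simp
  have "\<exists>c. \<forall>x y. x \<in> E k \<and> y = T x \<longrightarrow> y = sc c x"
    by (rule schur_relation) (use assms m in \<open>auto simp: T0 E_add E_scale\<close>)
  then show ?thesis by blast
qed

text \<open>By the commutator formula the span is stable under V^0, so one nonzero product and
  irreducibility suffice.\<close>

lemma products_span:
  assumes "u0 \<in> E i" "w0 \<in> E j" "md u0 n0 w0 \<noteq> 0"
  shows "span {md u n w | u n w. u \<in> E i \<and> w \<in> E j} = E (i + j)"
proof -
  let ?S = "{md u n w | u n w. u \<in> E i \<and> w \<in> E j}"
  have SE: "?S \<subseteq> E (i + j)" using E_mode by auto
  then have SC: "?S \<subseteq> C" using E_in by blast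
  show ?thesis
  proof (rule E_irreducible)
    show "span ?S \<subseteq> E (i + j)" using span_minimal[OF SE subspace_E] .
    have "md u0 n0 w0 \<in> span ?S" by (rule span_base) (use assms in blast)
    then show "\<exists>w\<in>span ?S. w \<noteq> 0" using assms(3) by blast
    show "md a m x \<in> span ?S" if a: "a \<in> E 0" and x: "x \<in> span ?S" for a m x
      using SC x
    proof (induction rule: span_carr_induct)
      case base
      then show ?case using a by (simp add: span_zero)
    next
      case (step c s y)
      obtain u n w where s: "s = md u n w" and u: "u \<in> E i" and w: "w \<in> E j" using step by blast
      obtain K where K: "\<And>i. i \<ge> K \<Longrightarrow> md a (0 + int i) u = 0"
        using truncation_nat[of a u 0] a u by auto
      have "md a m (md u n w) = md u n (md a m w) +
          (\<Sum>i<K. sc (of_int m gchoose i) (md (md a (int i) u) (m + n - int i) w))"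
        using commutator[of a u w K m n] K a u w by (simp add: algebra_simps)
      also have "\<dots> \<in> span ?S"
        using E_mode[OF a w] E_mode[OF a u] u w
        by (intro span_add span_sum span_scale span_base) (simp_all, blast+)
      finally show ?case
        using step a by (simp add: s mode_add_right mode_scale_right span_add span_scale)
    qed
  qed simp
qed

end

section \<open>Conjugations compatible with the fixed-point subalgebra\<close>

text \<open>Pascal's rule: a difference of order r + 1 is a difference of order r of first
  differences.\<close>

lemma alternating_binomial_sum_Suc:
  fixes a :: "nat \<Rightarrow> real"
  shows "(\<Sum>i\<le>Suc r. (-1) ^ i * of_nat (Suc r choose i) * a i) =
    (\<Sum>i\<le>r. (-1) ^ i * of_nat (r choose i) * (a i - a (Suc i)))"
proof -
  have "(\<Sum>i\<le>Suc r. (-1) ^ i * of_nat (Suc r choose i) * a i) =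
      a 0 - (\<Sum>i\<le>r. (-1) ^ i * of_nat (r choose i) * a (Suc i))
      - (\<Sum>i\<le>r. (-1) ^ i * of_nat (r choose Suc i) * a (Suc i))"
    by (subst sum.atMost_Suc_shift) (simp add: algebra_simps sum_subtractf sum_negf)
  also have "(\<Sum>i\<le>r. (-1) ^ i * of_nat (r choose Suc i) * a (Suc i)) =
      a 0 - (\<Sum>i\<le>Suc r. (-1) ^ i * of_nat (r choose i) * a i)"
    by (subst sum.atMost_Suc_shift) (simp add: sum_negf)
  finally show ?thesis
    by (simp add: algebra_simps sum_subtractf binomial_eq_0)
qed

text \<open>By induction on the order the first differences are bounded below by a positive constant
  near minus infinity. Then q grows at least linearly in that direction.\<close>

lemma difference_eventually_positive:
  fixes q :: "int \<Rightarrow> real"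
  assumes "c > 0" "\<And>m. m \<le> M \<Longrightarrow> (\<Sum>i\<le>r. (-1) ^ i * of_nat (r choose i) * q (m + int i)) \<ge> c"
  shows "\<exists>M' c'. c' > 0 \<and> (\<forall>m\<le>M'. q m \<ge> c')"
  using assms(2)
proof (induction r arbitrary: q)
  case 0
  then show ?case using assms(1) by auto
next
  case (Suc r)
  have "(\<Sum>i\<le>r. (-1) ^ i * of_nat (r choose i) * (q (m + int i) - q (m + int i + 1))) \<ge> c"
    if "m \<le> M" for m
    using Suc.prems[OF that] alternating_binomial_sum_Suc[of r "\<lambda>i. q (m + int i)"]
    by (simp add: add.assoc add.commute[of 1] del: sum.atMost_Suc)
  then obtain M' c' where c': "c' > 0" and M': "\<And>m. m \<le> M' \<Longrightarrow> q m - q (m + 1) \<ge> c'"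
    using Suc.IH[of "\<lambda>m. q m - q (m + 1)"] by blast
  have lin: "q (M' - int t) \<ge> q M' + of_nat t * c'" for t
  proof (induction t)
    case (Suc t)
    then show ?case using M'[of "M' - int (Suc t)"] by (simp add: algebra_simps)
  qed simp
  \<comment> \<open>Chosen so that the linear lower bound exceeds 1 from \<open>M' - int t\<close>
    downwards.\<close>
  obtain t :: nat where t: "(1 - q M') / c' < t" using reals_Archimedean2 by blast
  have "q m \<ge> 1" if "m \<le> M' - int t" for m
  proof -
    define s where "s = nat (M' - m)"
    have m: "m = M' - int s" "t \<le> s" using that by (auto simp: s_def)
    have "1 - q M' < of_nat t * c'" using t c' by (simp add: field_simps)
    also have "\<dots> \<le> of_nat s * c'" using m(2) c' by simp
    finally show ?thesis using lin[of s] m(1) by simp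
  qed
  then show ?case by (intro exI[of _ "M' - int t"] exI[of _ 1]) auto
qed

lemma (in voa) mode_commute:
  assumes "a \<in> C" "u \<in> C" "w \<in> C"
  shows "\<exists>K0. \<forall>K\<ge>K0. md a m (md u n w) = md u n (md a m w) +
    (\<Sum>i<K. sc (of_int m gchoose i) (md (md a (int i) u) (m + n - int i) w))"
proof -
  obtain K0 where K0: "\<And>i. i \<ge> K0 \<Longrightarrow> md a (0 + int i) u = 0"
    using truncation_nat[of a u 0] assms by auto
  have "md a m (md u n w) = md u n (md a m w) +
    (\<Sum>i<K. sc (of_int m gchoose i) (md (md a (int i) u) (m + n - int i) w))" if "K \<ge> K0" for K
    using commutator[of a u w K m n] assms K0 that by (simp add: algebra_simps)
  then show ?thesis by blast
qed

text \<open>An antilinear involution that reverses degrees and is positive with respect to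
  \<open>B\<close> on each V^i, but is multiplicative so far only for left factors from V^0.\<close>

locale voa_conjugation = voa_form_cyclic V B f p
  for V :: "('v::ab_group_add) voa_data" and B f p +
  fixes \<Phi> :: "'v \<Rightarrow> 'v"
  assumes Phi_in [simp]: "\<And>x. x \<in> carr V \<Longrightarrow> \<Phi> x \<in> carr V"
    and Phi_add: "\<And>x y. x \<in> carr V \<Longrightarrow> y \<in> carr V \<Longrightarrow> \<Phi> (x + y) = \<Phi> x + \<Phi> y"
    and Phi_scale: "\<And>c x. x \<in> carr V \<Longrightarrow> \<Phi> (scal V c x) = scal V (cnj c) (\<Phi> x)"
    and Phi_Phi [simp]: "\<And>x. x \<in> carr V \<Longrightarrow> \<Phi> (\<Phi> x) = x"
    and Phi_E: "\<And>i x. x \<in> E i \<Longrightarrow> \<Phi> x \<in> E (- i)"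
    and B_Phi: "\<And>x y. x \<in> carr V \<Longrightarrow> y \<in> carr V \<Longrightarrow> B (\<Phi> x) (\<Phi> y) = cnj (B x y)"
    and B_Phi_pos: "\<And>i x. x \<in> E i \<Longrightarrow> x \<noteq> 0 \<Longrightarrow> Re (B x (\<Phi> x)) > 0"
    and Phi_mode_E0: "\<And>a n x. a \<in> E 0 \<Longrightarrow> x \<in> carr V \<Longrightarrow> \<Phi> (mode V a n x) = mode V (\<Phi> a) n (\<Phi> x)"
    and Phi_vac [simp]: "\<Phi> (vac V) = vac V" and Phi_conf [simp]: "\<Phi> (conf V) = conf V"
begin

lemma Phi_zero [simp]: "\<Phi> 0 = 0"
  using Phi_scale[of 0 0] by simp

lemma Phi_sum: "(\<And>i. i \<in> A \<Longrightarrow> g i \<in> C) \<Longrightarrow> \<Phi> (sum g A) = (\<Sum>i\<in>A. \<Phi> (g i))"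
  by (induction A rule: infinite_finite_induct) (auto simp: Phi_add)

lemma Phi_Vir: "x \<in> C \<Longrightarrow> \<Phi> (Vir V n x) = Vir V n (\<Phi> x)"
  by (simp add: Vir_def Phi_mode_E0)

lemma Phi_Vir_pow: "x \<in> C \<Longrightarrow> \<Phi> ((Vir V n ^^ k) x) = (Vir V n ^^ k) (\<Phi> x)"
  by (induction k) (auto simp: Phi_Vir)

lemma Phi_weight: "x \<in> W d \<Longrightarrow> \<Phi> x \<in> W d"
  by (simp add: weight_iff Phi_Vir[symmetric] Phi_scale)

lemma Phi_eq_0_iff: "x \<in> C \<Longrightarrow> \<Phi> x = 0 \<longleftrightarrow> x = 0"
  using Phi_Phi[of x] Phi_zero by metis

lemma B_Phi_real: "x \<in> C \<Longrightarrow> Im (B x (\<Phi> x)) = 0"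
  using B_Phi[of x "\<Phi> x"] B_symmetric[of "\<Phi> x" x] by (simp add: complex_eq_iff)

text \<open>Skew-symmetry moves the factor from V^0 to the left, where multiplicativity is
  known.\<close>

lemma Phi_mode_right_E0:
  assumes "x \<in> C" "a \<in> E 0"
  shows "\<Phi> (md x k a) = md (\<Phi> x) k (\<Phi> a)"
proof -
  have a: "a \<in> C" using assms by simp
  obtain K1 where K1: "\<forall>K\<ge>K1. md x k a =
    sc (- ((-1) powi k)) (\<Sum>i<K. sc ((-1) ^ i / fact i) ((Vir V (-1) ^^ i) (md a (k + int i) x)))"
    using skew_symmetry[OF a assms(1)] by blast
  obtain K2 where K2: "\<forall>K\<ge>K2. md (\<Phi> x) k (\<Phi> a) = sc (- ((-1) powi k))
      (\<Sum>i<K. sc ((-1) ^ i / fact i) ((Vir V (-1) ^^ i) (md (\<Phi> a) (k + int i) (\<Phi> x))))"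
    using skew_symmetry[of "\<Phi> a" "\<Phi> x"] assms a by auto
  let ?K = "max K1 K2"
  have "\<Phi> (md x k a) = sc (- ((-1) powi k))
      (\<Sum>i<?K. sc ((-1) ^ i / fact i) ((Vir V (-1) ^^ i) (\<Phi> (md a (k + int i) x))))"
    using K1[rule_format, of ?K] assms a
    by (simp add: Phi_scale Phi_sum Phi_Vir_pow del: scale_minus_left)
  also have "\<dots> = md (\<Phi> x) k (\<Phi> a)"
    using K2[rule_format, of ?K] assms by (simp add: Phi_mode_E0 del: scale_minus_left)
  finally show ?thesis .
qed

text \<open>The vector \<open>y'\<close> is kept separate from \<open>\<Phi> y\<close>: for the
  four-point products it is a product of conjugates that is not yet known to be the conjugate of
  \<open>y\<close>.\<close>

lemma Phi_adj:
  assumes u: "u \<in> E i" and y: "y \<in> C" "y' \<in> C"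
    and mult: "\<And>x q. x \<in> E i \<Longrightarrow> \<Phi> (md x q y) = md (\<Phi> x) q y'"
  shows "\<Phi> (adj u n y) = adj (\<Phi> u) n y'"
  by (rule adj_map[of \<Phi> "E i"])
     (use assms in \<open>auto simp: Phi_add Phi_scale Phi_weight Phi_Vir E_Vir E_homog_comp\<close>)

text \<open>\<open>\<Phi>(u\<^sub>n v)\<close> is tested against \<open>V\<^sup>0\<close>, where invariance of \<open>B\<close> moves \<open>u\<close> onto an element
  of \<open>V\<^sup>0\<close>.\<close>

lemma Phi_mode_dual:
  assumes u: "u \<in> E i" and v: "v \<in> E (- i)"
  shows "\<Phi> (md u n v) = md (\<Phi> u) n (\<Phi> v)"
proof (rule B_E_eqI[of _ 0])
  show "\<Phi> (md u n v) \<in> E 0" using Phi_E[OF E_mode[OF u v]] by simp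
  show "md (\<Phi> u) n (\<Phi> v) \<in> E 0" using E_mode[OF Phi_E[OF u] Phi_E[OF v]] by simp
  fix w assume "w \<in> E (- 0)"
  then have w: "w \<in> E 0" by simp
  define a where "a = \<Phi> w"
  have a: "a \<in> E 0" and wa: "w = \<Phi> a" using Phi_E[OF w] w by (auto simp: a_def)
  have uv: "u \<in> C" "v \<in> C" "a \<in> C" using u v a by auto
  have "B (\<Phi> (md u n v)) w = cnj (B v (adj u n a))"
    using uv by (simp add: wa B_Phi B_invariant)
  also have "\<dots> = B (\<Phi> v) (\<Phi> (adj u n a))" using uv by (simp add: B_Phi)
  also have "\<Phi> (adj u n a) = adj (\<Phi> u) n (\<Phi> a)"
    using uv by (intro Phi_adj[OF u] Phi_mode_right_E0 a) auto
  also have "B (\<Phi> v) \<dots> = B (md (\<Phi> u) n (\<Phi> v)) w" using uv by (simp add: wa B_invariant)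
  finally show "B (\<Phi> (md u n v)) w = B (md (\<Phi> u) n (\<Phi> v)) w" .
qed

text \<open>The products u_k v lie in V^0, so \<Phi> respects (u_k v)_m w. Associativity for both
  triples, compared by \<open>assoc_triangular\<close> on their difference, transfers this to u_q
  v_n w.\<close>

lemma Phi_triple:
  assumes u: "u \<in> E i" and v: "v \<in> E (- i)" and w: "w \<in> C"
  shows "\<Phi> (md u q (md v n w)) = md (\<Phi> u) q (md (\<Phi> v) n (\<Phi> w))"
proof -
  have uv: "u \<in> C" "v \<in> C" using u v by auto
  obtain m1 where m1: "\<forall>j\<ge>m1. md u j w = 0" using truncation uv w by blast
  obtain m2 where m2: "\<forall>j\<ge>m2. md (\<Phi> u) j (\<Phi> w) = 0" using truncation[of "\<Phi> u" "\<Phi> w"] uv w by auto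
  obtain N1 where N1: "\<forall>j\<ge>N1. md v j w = 0" using truncation uv w by blast
  obtain N2 where N2: "\<forall>j\<ge>N2. md (\<Phi> v) j (\<Phi> w) = 0" using truncation[of "\<Phi> v" "\<Phi> w"] uv w by auto
  define g where "g = (\<lambda>q n. \<Phi> (md u q (md v n w)) - md (\<Phi> u) q (md (\<Phi> v) n (\<Phi> w)))"
  let ?m = "max m1 m2"
  have "g q n \<in> {0}"
  proof (rule assoc_triangular[of _ "max N1 N2" _ ?m])
    show "g q n = 0" if "n \<ge> max N1 N2" for q n using that N1 N2 uv w by (simp add: g_def)
    fix k n
    have "\<exists>K0. \<forall>K\<ge>K0.
        (\<Sum>i<K. sc (of_int ?m gchoose i) (md (md u (k + int i) v) (?m + n - int i) w)) =
        (\<Sum>i<K. sc ((-1) ^ i * (of_int k gchoose i)) (md u (?m + k - int i) (md v (n + int i) w)))"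
      by (rule associativity) (use m1 uv w in auto)
    then obtain K1 where K1: "\<forall>K\<ge>K1.
        (\<Sum>i<K. sc (of_int ?m gchoose i) (md (md u (k + int i) v) (?m + n - int i) w)) =
        (\<Sum>i<K. sc ((-1) ^ i * (of_int k gchoose i)) (md u (?m + k - int i) (md v (n + int i) w)))" ..
    have "\<exists>K0. \<forall>K\<ge>K0.
        (\<Sum>i<K. sc (of_int ?m gchoose i) (md (md (\<Phi> u) (k + int i) (\<Phi> v)) (?m + n - int i) (\<Phi> w))) =
        (\<Sum>i<K. sc ((-1) ^ i * (of_int k gchoose i))
          (md (\<Phi> u) (?m + k - int i) (md (\<Phi> v) (n + int i) (\<Phi> w))))"
      by (rule associativity) (use m2 uv w in auto)
    then obtain K2 where K2: "\<forall>K\<ge>K2.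
        (\<Sum>i<K. sc (of_int ?m gchoose i) (md (md (\<Phi> u) (k + int i) (\<Phi> v)) (?m + n - int i) (\<Phi> w))) =
        (\<Sum>i<K. sc ((-1) ^ i * (of_int k gchoose i))
          (md (\<Phi> u) (?m + k - int i) (md (\<Phi> v) (n + int i) (\<Phi> w))))" ..
    have "(\<Sum>i<K. sc ((-1) ^ i * (of_int k gchoose i)) (g (?m + k - int i) (n + int i))) = 0"
      if K: "K \<ge> max K1 K2" for K
    proof -
      have "(\<Sum>i<K. sc ((-1) ^ i * (of_int k gchoose i)) (\<Phi> (md u (?m + k - int i) (md v (n + int i) w)))) =
          \<Phi> (\<Sum>i<K. sc ((-1) ^ i * (of_int k gchoose i)) (md u (?m + k - int i) (md v (n + int i) w)))"
        using uv w by (simp add: Phi_sum Phi_scale)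
      also have "\<dots> = \<Phi> (\<Sum>i<K. sc (of_int ?m gchoose i) (md (md u (k + int i) v) (?m + n - int i) w))"
        using K1 K by simp
      also have "\<dots> = (\<Sum>i<K. sc (of_int ?m gchoose i)
          (md (md (\<Phi> u) (k + int i) (\<Phi> v)) (?m + n - int i) (\<Phi> w)))"
      proof -
        have "md u q v \<in> E 0" for q using E_mode[OF u v] by simp
        then show ?thesis using uv w by (simp add: Phi_sum Phi_scale Phi_mode_E0 Phi_mode_dual[OF u v])
      qed
      also have "\<dots> = (\<Sum>i<K. sc ((-1) ^ i * (of_int k gchoose i))
          (md (\<Phi> u) (?m + k - int i) (md (\<Phi> v) (n + int i) (\<Phi> w))))"
        using K2 K by simp
      finally show ?thesis by (simp add: g_def scale_right_diff_distrib sum_subtractf)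
    qed
    then show "\<exists>K0. \<forall>K\<ge>K0. (\<Sum>i<K. sc ((-1) ^ i * (of_int k gchoose i))
        (g (?m + k - int i) (n + int i))) \<in> {0}"
      by blast
  qed simp
  then show ?thesis by (simp add: g_def)
qed

text \<open>Invariance moves the first left factor across \<open>B\<close> and produces the triple
  products handled by \<open>Phi_triple\<close>. Multiplicativity of \<Phi> on u_n w itself is
  avoided.\<close>

lemma B_gram:
  assumes u: "u \<in> E i" and v: "v \<in> E (- i)" and w: "w \<in> C" "w' \<in> C"
  shows "B (md (\<Phi> u) n (\<Phi> w)) (md (\<Phi> v) m (\<Phi> w')) = cnj (B (md u n w) (md v m w'))"
proof -
  have uv: "u \<in> C" "v \<in> C" using u v by auto
  have "B (md (\<Phi> u) n (\<Phi> w)) (md (\<Phi> v) m (\<Phi> w')) = B (\<Phi> w) (adj (\<Phi> u) n (md (\<Phi> v) m (\<Phi> w')))"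
    using uv w by (simp add: B_invariant)
  also have "adj (\<Phi> u) n (md (\<Phi> v) m (\<Phi> w')) = \<Phi> (adj u n (md v m w'))"
    by (rule Phi_adj[symmetric, OF u]) (use uv w Phi_triple[OF _ v] in auto)
  also have "B (\<Phi> w) \<dots> = cnj (B (md u n w) (md v m w'))"
    using uv w by (simp add: B_Phi B_invariant)
  finally show ?thesis .
qed

end

section \<open>Positivity of the structure scalars\<close>

context voa_conjugation
begin

text \<open>Weights are nonnegative, so V^i has a least one, and L(1) must kill a vector of that
  weight. This makes the opposite modes of u single modes.\<close>

lemma lowest_weight_vector:
  assumes "v \<in> E i" "v \<noteq> 0"
  obtains u d where "u \<in> E i" "u \<in> W d" "u \<noteq> 0" "d \<ge> 0" "Vir V 1 u = 0"
proof -
  define Q where "Q = (\<lambda>n::nat. \<exists>u. u \<in> E i \<and> u \<in> W (int n) \<and> u \<noteq> 0)"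
  obtain d where d: "homog_comp V v d \<noteq> 0" using homog_comp_nonzero assms by fastforce
  have h: "homog_comp V v d \<in> E i" "homog_comp V v d \<in> W d" using assms E_homog_comp by auto
  then have "d \<ge> 0" using weight_negative d by force
  then have "Q (nat d)" using d h by (auto simp: Q_def)
  then have L: "Q (LEAST n. Q n)" by (rule LeastI)
  define n where "n = (LEAST n. Q n)"
  obtain u where u: "u \<in> E i" "u \<in> W (int n)" "u \<noteq> 0" using L by (auto simp: Q_def n_def)
  have L1: "Vir V 1 u \<in> E i" "Vir V 1 u \<in> W (int n - 1)" using u E_Vir Vir_weight by auto
  have "Vir V 1 u = 0"
  proof (cases n)
    case 0
    then show ?thesis using weight_negative[OF L1(2)] by simp
  next
    case (Suc k)
    then have "\<not> Q k" using not_less_Least[of k Q] by (simp add: n_def)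
    then show ?thesis using L1 Suc by (auto simp: Q_def)
  qed
  then show thesis using that u by simp
qed

text \<open>Reflection positivity. In \<open>\<langle>u\<^sup>*(z\<^sub>1) u(z\<^sub>2) x, x\<rangle>\<close> the vacuum dominates
  as \<open>z\<^sub>1 \<rightarrow> z\<^sub>2\<close>; in terms of modes, the \<open>(2d-1)\<close>-st differences of the
  numbers \<open>Q m\<close> are a positive constant for \<open>m\<close> near \<open>-\<infinity>\<close>.\<close>

lemma product_positive:
  assumes "v \<in> E i" "v \<noteq> 0"
  shows "\<exists>u\<in>E i. \<forall>j. \<forall>x\<in>E j. x \<noteq> 0 \<longrightarrow>
    (\<exists>n. Im (B (md u n x) (md (\<Phi> u) n (\<Phi> x))) = 0 \<and> Re (B (md u n x) (md (\<Phi> u) n (\<Phi> x))) > 0)"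
proof -
  obtain u d where u: "u \<in> E i" "u \<in> W d" "u \<noteq> 0" "d \<ge> 0" "Vir V 1 u = 0"
    using lowest_weight_vector[OF assms] .
  let ?u = "\<Phi> u"
  have uC: "u \<in> C" "?u \<in> C" using u by auto
  have u': "?u \<in> W d" "Vir V 1 ?u = 0" "?u \<in> E (- i)"
    using u Phi_weight Phi_E by (auto simp flip: Phi_Vir)
  have "\<exists>n. Im (B (md u n x) (md ?u n (\<Phi> x))) = 0 \<and> Re (B (md u n x) (md ?u n (\<Phi> x))) > 0"
    if x: "x \<in> E j" "x \<noteq> 0" for j x
  proof (cases "d = 0")
    \<comment> \<open>In weight 0 the vector u is a multiple of the vacuum, and 2d - 1 would be
      negative.\<close>
    case True
    then obtain c where c: "u = sc c (vac V)" using weight_0 u by blast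
    have "B (md u (-1) x) (md ?u (-1) (\<Phi> x)) = (c * cnj c) * B x (\<Phi> x)"
      using x by (simp add: c Phi_scale mode_scale_left vacuum)
    also have "\<dots> = of_real ((cmod c)\<^sup>2) * B x (\<Phi> x)" by (simp only: complex_norm_square)
    finally show ?thesis
      using B_Phi_pos[OF x] B_Phi_real[of x] x u(3) c by (intro exI[of _ "-1"]) auto
  next
    case False
    then have d1: "d \<ge> 1" using u by simp
    have xC: "x \<in> C" using x by simp
    \<comment> \<open>The mode r = 2d - 1 sends the conjugate of u to weight 0, and all higher modes
      land in negative weights. Being odd, r makes the remaining term of the Borcherds identity
      positive.\<close>
    define r where "r = nat (2 * d - 1)"
    have r: "int r = 2 * d - 1" "odd r" using d1 by (auto simp: r_def even_nat_iff)
    define Q where "Q = (\<lambda>m. B (md u m x) (md ?u m (\<Phi> x)))"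
    have Qreal: "Im (Q m) = 0" for m
    proof -
      have "cnj (Q m) = B (md ?u m (\<Phi> x)) (md u m x)"
        using B_gram[OF u(1) u'(3) xC, of "\<Phi> x" m m] uC xC by (simp add: Q_def)
      also have "\<dots> = Q m" unfolding Q_def by (rule B_symmetric) (use uC xC in auto)
      finally show ?thesis by (simp add: complex_eq_iff)
    qed
    define c where "c = B u ?u * B x (\<Phi> x)"
    have c: "Im c = 0" "Re c > 0"
      using B_Phi_pos[OF u(1,3)] B_Phi_pos[OF x] B_Phi_real uC xC by (auto simp: c_def)
    \<comment> \<open>The vector is a multiple of the vacuum, and pairing with the vacuum finds the
      factor.\<close>
    have uu: "md u (int r) ?u = sc ((-1) powi d * B u ?u) (vac V)"
    proof -
      have "md u (int r) ?u \<in> W 0" using mode_weight[OF u(2) u'(1), of "int r"] r by simp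
      then obtain b where b: "md u (int r) ?u = sc b (vac V)" using weight_0 by blast
      then have "b = B (md u (int r) ?u) (vac V)" by (simp add: B_vac)
      also have "\<dots> = B ?u (sc ((-1) powi d) (md u (-1) (vac V)))"
        using uC r adj_quasi_primary[OF u(2) vac_in u(5), of "int r"] by (simp add: B_invariant)
      also have "\<dots> = (-1) powi d * B u ?u"
        using uC B_symmetric[of u ?u] by (simp add: creation)
      finally show ?thesis using b by simp
    qed
    have uu0: "md u (int r + int i) ?u = 0" if "i > 0" for i
      using mode_weight[OF u(2) u'(1), of "int r + int i"] r that by (intro weight_negative) auto
    obtain N where N: "\<forall>n\<ge>N. md ?u n x = 0" using truncation uC xC by blast
    \<comment> \<open>The bound on m gives -1 - m >= N, so one half of the right side of the
      Borcherds identity vanishes.\<close>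
    have main: "(\<Sum>i\<le>r. (-1) ^ i * of_nat (r choose i) * Q (m + int i)) = c" if m: "m \<le> - 1 - N" for m
    proof -
      \<comment> \<open>With this choice the outer mode on the left is m + n = -1, so the vacuum
        contribution is a multiple of x itself.\<close>
      let ?n = "- 1 - m"
      obtain K1 where K1: "\<And>i. i \<ge> K1 \<Longrightarrow> md u (m + int i) x = 0" using truncation_nat uC xC by metis
      define K where "K = Suc (max K1 r)"
      have z: "md ?u (?n + int i) x = 0" for i using N m by simp
      have "(\<Sum>i<K. sc (of_int m gchoose i) (md (md u (int r + int i) ?u) (m + ?n - int i) x)) =
        (\<Sum>i<K. sc ((-1) ^ i * (of_int (int r) gchoose i))
        (md u (m + int r - int i) (md ?u (?n + int i) x)
         - sc ((-1) powi (int r)) (md ?u (?n + int r - int i) (md u (m + int i) x))))"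
        by (rule borcherds_finite) (use uC xC K1 z uu0 in \<open>auto simp: K_def\<close>)
      also have "\<dots> = (\<Sum>i<K. sc ((-1) ^ i * of_nat (r choose i))
          (md ?u (?n + int r - int i) (md u (m + int i) x)))"
        using r(2) uC by (simp add: z binomial_gbinomial)
      also have "\<dots> = (\<Sum>i\<le>r. sc ((-1) ^ i * of_nat (r choose i))
          (md ?u (?n + int r - int i) (md u (m + int i) x)))"
        by (rule sum.mono_neutral_right) (auto simp: K_def)
      also have "(\<Sum>i<K. sc (of_int m gchoose i) (md (md u (int r + int i) ?u) (m + ?n - int i) x)) =
          (\<Sum>i\<in>{0}. sc (of_int m gchoose i) (md (md u (int r + int i) ?u) (m + ?n - int i) x))"
        by (rule sum.mono_neutral_right) (use uu0 xC in \<open>auto simp: K_def\<close>)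
      also have "\<dots> = sc ((-1) powi d * B u ?u) x" using xC by (simp add: uu mode_scale_left vacuum)
      finally have "B (sc ((-1) powi d * B u ?u) x) (\<Phi> x) =
          B (\<Sum>i\<le>r. sc ((-1) ^ i * of_nat (r choose i))
          (md ?u (?n + int r - int i) (md u (m + int i) x))) (\<Phi> x)" by simp
      then have "(-1) powi d * c = (\<Sum>i\<le>r. (-1) ^ i * of_nat (r choose i) *
          B (md ?u (?n + int r - int i) (md u (m + int i) x)) (\<Phi> x))"
        using uC xC by (simp add: c_def B_sum_left mult.assoc)
      also have "\<dots> = (\<Sum>i\<le>r. (-1) ^ i * of_nat (r choose i) * ((-1) powi d * Q (m + int i)))"
      proof (intro sum.cong refl)
        fix i
        \<comment> \<open>Taking the adjoint of the outer mode reflects its index to m + i, so both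
          factors of \<open>Q\<close> carry the same mode.\<close>
        have e: "2 * d - (?n + int r - int i) - 2 = m + int i" using r by simp
        have "B (md ?u (?n + int r - int i) (md u (m + int i) x)) (\<Phi> x) =
            B (md u (m + int i) x) (sc ((-1) powi d) (md ?u (m + int i) (\<Phi> x)))"
          using uC xC adj_quasi_primary[OF u'(1) _ u'(2), of "\<Phi> x" "?n + int r - int i"] unfolding e
          by (subst B_invariant) auto
        then show "(-1) ^ i * of_nat (r choose i) *
            B (md ?u (?n + int r - int i) (md u (m + int i) x)) (\<Phi> x) =
          (-1) ^ i * of_nat (r choose i) * ((-1) powi d * Q (m + int i))"
          using uC xC by (simp add: Q_def)
      qed
      also have "\<dots> = (-1) powi d * (\<Sum>i\<le>r. (-1) ^ i * of_nat (r choose i) * Q (m + int i))"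
        by (simp add: sum_distrib_left mult.left_commute)
      finally show ?thesis by simp
    qed
    have "(\<Sum>i\<le>r. (-1) ^ i * of_nat (r choose i) * Re (Q (m + int i))) \<ge> Re c" if "m \<le> - 1 - N" for m
    proof -
      have "Re c = (\<Sum>i\<le>r. Re ((-1) ^ i * of_nat (r choose i) * Q (m + int i)))"
        unfolding main[OF that, symmetric] by (rule Re_sum)
      also have "\<dots> = (\<Sum>i\<le>r. (-1) ^ i * of_nat (r choose i) * Re (Q (m + int i)))"
      proof (intro sum.cong refl)
        fix i
        have "(-1) ^ i * of_nat (r choose i) * Q (m + int i) =
            of_real ((-1) ^ i * of_nat (r choose i)) * Q (m + int i)" by simp
        then show "Re ((-1) ^ i * of_nat (r choose i) * Q (m + int i)) =
            (-1) ^ i * of_nat (r choose i) * Re (Q (m + int i))"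
          by (simp only: Re_complex_of_real times_complex.sel Im_complex_of_real)
      qed
      finally show ?thesis by simp
    qed
    then obtain M' c' where "c' > 0" "\<forall>m\<le>M'. Re (Q m) \<ge> c'"
      using difference_eventually_positive[OF c(2), of "- 1 - N" r "\<lambda>m. Re (Q m)"] by blast
    then have "Re (Q M') > 0" by force
    then show ?thesis using Qreal unfolding Q_def by blast
  qed
  then show ?thesis using u(1) by blast
qed

text \<open>The additive closure of the pairs (u_n w, \<Phi>(\<Phi>(u)_n \<Phi>(w))). Whether the
  second entry depends only on the first is not known yet, hence a relation.\<close>

inductive conj_product :: "int \<Rightarrow> int \<Rightarrow> 'v \<Rightarrow> 'v \<Rightarrow> bool" for i j where
  zero: "conj_product i j 0 0"
| step: "conj_product i j x y \<Longrightarrow> u \<in> E i \<Longrightarrow> w \<in> E j \<Longrightarrow>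
    conj_product i j (md u n w + x) (\<Phi> (md (\<Phi> u) n (\<Phi> w)) + y)"

lemma conj_product_gen:
  "u \<in> E i \<Longrightarrow> w \<in> E j \<Longrightarrow> conj_product i j (md u n w) (\<Phi> (md (\<Phi> u) n (\<Phi> w)))"
  using conj_product.step[OF conj_product.zero] by fastforce

lemma conj_product_in:
  "conj_product i j x y \<Longrightarrow> x \<in> E (i + j) \<and> y \<in> E (i + j)"
proof (induction rule: conj_product.induct)
  case (step x y u w n)
  have "md (\<Phi> u) n (\<Phi> w) \<in> E (- (i + j))" using E_mode[OF Phi_E Phi_E] step by force
  then have "\<Phi> (md (\<Phi> u) n (\<Phi> w)) \<in> E (- (- (i + j)))" by (rule Phi_E)
  then have "\<Phi> (md (\<Phi> u) n (\<Phi> w)) \<in> E (i + j)" by (simp only: minus_minus)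
  then show ?case using step E_mode E_add by auto
qed simp

lemma conj_product_add:
  "conj_product i j x y \<Longrightarrow> conj_product i j x' y' \<Longrightarrow> conj_product i j (x + x') (y + y')"
  by (induction rule: conj_product.induct) (auto simp: add.assoc intro: conj_product.intros)

text \<open>Scalars are absorbed into u; the two applications of \<Phi> conjugate them
  twice.\<close>

lemma conj_product_scale:
  "conj_product i j x y \<Longrightarrow> conj_product i j (sc c x) (sc c y)"
proof (induction rule: conj_product.induct)
  case (step x y u w n)
  have "conj_product i j (md (sc c u) n w + sc c x) (\<Phi> (md (\<Phi> (sc c u)) n (\<Phi> w)) + sc c y)"
    by (rule conj_product.step) (use step E_scale in auto)
  moreover have "md (sc c u) n w = sc c (md u n w)" using step by (simp add: mode_scale_left)
  moreover have "\<Phi> (md (\<Phi> (sc c u)) n (\<Phi> w)) = sc c (\<Phi> (md (\<Phi> u) n (\<Phi> w)))"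
    using step by (simp add: Phi_scale mode_scale_left)
  ultimately show ?case by (simp add: scale_right_distrib)
qed (simp add: conj_product.zero)

lemma conj_product_sum:
  "(\<And>a. a \<in> A \<Longrightarrow> conj_product i j (g a) (h a)) \<Longrightarrow> conj_product i j (sum g A) (sum h A)"
  by (induction A rule: infinite_finite_induct) (auto intro: conj_product.zero conj_product_add)

text \<open>The commutator formula expands both entries in parallel, and each term is a generating
  pair because \<Phi> respects modes of V^0.\<close>

lemma conj_product_mode:
  assumes a: "a \<in> E 0" and "conj_product i j x y"
  shows "conj_product i j (md a m x) (md a m y)"
  using assms(2)
proof (induction rule: conj_product.induct)
  case zero
  then show ?case using a by (simp add: conj_product.zero)
next
  case (step x y u w n)
  have aC: "a \<in> C" "u \<in> C" "w \<in> C" using a step by auto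
  have a': "\<Phi> a \<in> E 0" using Phi_E[OF a] by simp
  obtain K1 where K1: "\<forall>K\<ge>K1. md a m (md u n w) = md u n (md a m w) +
      (\<Sum>i<K. sc (of_int m gchoose i) (md (md a (int i) u) (m + n - int i) w))"
    using mode_commute[OF aC] by blast
  obtain K2 where K2: "\<forall>K\<ge>K2. md (\<Phi> a) m (md (\<Phi> u) n (\<Phi> w)) = md (\<Phi> u) n (md (\<Phi> a) m (\<Phi> w)) +
      (\<Sum>i<K. sc (of_int m gchoose i) (md (md (\<Phi> a) (int i) (\<Phi> u)) (m + n - int i) (\<Phi> w)))"
    using mode_commute[OF Phi_in Phi_in Phi_in, OF aC] by blast
  let ?K = "max K1 K2"
  have 1: "md a m (md u n w) = md u n (md a m w) +
      (\<Sum>i<?K. sc (of_int m gchoose i) (md (md a (int i) u) (m + n - int i) w))"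
    using K1 by simp
  have "md a m (\<Phi> (md (\<Phi> u) n (\<Phi> w))) = \<Phi> (md (\<Phi> a) m (md (\<Phi> u) n (\<Phi> w)))"
    using a a' aC by (simp add: Phi_mode_E0)
  also have "\<dots> = \<Phi> (md (\<Phi> u) n (md (\<Phi> a) m (\<Phi> w))) +
      (\<Sum>i<?K. sc (of_int m gchoose i) (\<Phi> (md (md (\<Phi> a) (int i) (\<Phi> u)) (m + n - int i) (\<Phi> w))))"
    using K2[rule_format, of ?K] aC by (simp add: Phi_add Phi_sum Phi_scale)
  also have "\<dots> = \<Phi> (md (\<Phi> u) n (\<Phi> (md a m w))) +
      (\<Sum>i<?K. sc (of_int m gchoose i) (\<Phi> (md (\<Phi> (md a (int i) u)) (m + n - int i) (\<Phi> w))))"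
    using a aC by (simp add: Phi_mode_E0)
  finally have 2: "md a m (\<Phi> (md (\<Phi> u) n (\<Phi> w))) = \<dots>" .
  have "md a q u \<in> E i" "md a q w \<in> E j" for q
    using E_mode[OF a step(2)] E_mode[OF a step(3)] by simp_all
  then have "conj_product i j (md a m (md u n w)) (md a m (\<Phi> (md (\<Phi> u) n (\<Phi> w))))"
    unfolding 1 2 using step(2,3)
    by (intro conj_product_add conj_product_sum conj_product_scale conj_product_gen) auto
  moreover have "x \<in> C" "y \<in> C" using conj_product_in[OF step(1)] by auto
  ultimately show ?case using step(4) aC by (simp add: mode_add_right conj_product_add)
qed

text \<open>The first entry determines the pairing of the second with all conjugated products, by
  \<open>B_gram\<close>. This is what makes the relation single-valued.\<close>

lemma conj_product_gram:
  assumes "conj_product i j x y" "u \<in> E i" "w \<in> E j"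
  shows "B y (\<Phi> (md u n w)) = B x (md (\<Phi> u) n (\<Phi> w))"
  using assms(1)
proof (induction rule: conj_product.induct)
  case zero
  then show ?case using assms(2,3) by simp
next
  case (step x y u' w' n')
  have C: "u \<in> C" "w \<in> C" "u' \<in> C" "w' \<in> C" "x \<in> C" "y \<in> C"
    using assms(2,3) step conj_product_in[OF step(1)] by auto
  have "B (\<Phi> (md (\<Phi> u') n' (\<Phi> w'))) (\<Phi> (md u n w)) = cnj (B (md (\<Phi> u') n' (\<Phi> w')) (md u n w))"
    using C by (simp add: B_Phi)
  also have "B (md (\<Phi> u') n' (\<Phi> w')) (md u n w) = cnj (B (md u' n' w') (md (\<Phi> u) n (\<Phi> w)))"
    using B_gram[OF step(2) Phi_E[OF assms(2)], of w' "\<Phi> w" n' n] C by simp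
  finally show ?case using step(4) C by (simp add: B_add_left)
qed

text \<open>Schur's lemma gives a scalar for the relation \<open>conj_product\<close>; reflection
  positivity supplies a nonzero product and the sign of the scalar.\<close>

lemma Phi_product_scalar:
  assumes i: "v \<in> E i" "v \<noteq> 0" and j: "x \<in> E j" "x \<noteq> 0"
  shows "\<exists>c::real. c > 0 \<and> (\<forall>u\<in>E i. \<forall>w\<in>E j. \<forall>n.
    md (\<Phi> u) n (\<Phi> w) = sc (of_real c) (\<Phi> (md u n w)))"
proof -
  obtain u n where u: "u \<in> E i"
    and pos: "Re (B (md u n x) (md (\<Phi> u) n (\<Phi> x))) > 0" "Im (B (md u n x) (md (\<Phi> u) n (\<Phi> x))) = 0"
    using product_positive[OF i] j by blast
  have C: "u \<in> C" "x \<in> C" using u j by auto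
  have nz: "md u n x \<noteq> 0" using pos C by auto
  have "\<exists>c. \<forall>x y. conj_product i j x y \<longrightarrow> y = sc c x"
  proof (rule schur_relation)
    \<comment> \<open>The products span V^(i+j), so y is orthogonal to the conjugate of every vector
      there, in particular to its own; positivity excludes this for nonzero y.\<close>
    show "y = 0" if "conj_product i j 0 y" for y
    proof (rule ccontr)
      assume "y \<noteq> 0"
      have y: "y \<in> E (i + j)" using conj_product_in[OF that] by simp
      have "B y (\<Phi> z) = 0" if "z \<in> E (i + j)" for z
      proof -
        have "{md u n w | u n w. u \<in> E i \<and> w \<in> E j} \<subseteq> C" by auto
        moreover have "z \<in> span {md u n w | u n w. u \<in> E i \<and> w \<in> E j}"
          using products_span[OF u j(1) nz] that by simp
        ultimately show ?thesis
        proof (induction rule: span_carr_induct)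
          case base
          then show ?case using y by simp
        next
          case (step c s z)
          then show ?case
            using conj_product_gram[OF \<open>conj_product i j 0 y\<close>] y by (auto simp: Phi_add Phi_scale B_add_right)
        qed
      qed
      then show False using B_Phi_pos[OF y \<open>y \<noteq> 0\<close>] y by force
    qed
  qed (rule conj_product_in conj_product.zero conj_product_add conj_product_scale conj_product_mode; assumption)+
  then obtain c where c: "\<And>x y. conj_product i j x y \<Longrightarrow> y = sc c x" by blast
  have eq: "md (\<Phi> u) n (\<Phi> w) = sc (cnj c) (\<Phi> (md u n w))" if "u \<in> E i" "w \<in> E j" for u w n
  proof -
    have "\<Phi> (\<Phi> (md (\<Phi> u) n (\<Phi> w))) = \<Phi> (sc c (md u n w))"
      using c[OF conj_product_gen[OF that]] by simp
    then show ?thesis using that by (simp add: Phi_scale)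
  qed
  \<comment> \<open>Comparing the positive four-point value with the positive norm of u_n x forces
    the scalar to be real and positive.\<close>
  define t where "t = B (md u n x) (\<Phi> (md u n x))"
  have t: "Im t = 0" "Re t > 0"
    unfolding t_def using B_Phi_real B_Phi_pos[OF E_mode[OF u j(1)] nz] C by auto
  have "B (md u n x) (md (\<Phi> u) n (\<Phi> x)) = cnj c * t"
    unfolding t_def eq[OF u j(1)] using C by simp
  then have "Re c * Re t > 0" "Im c * Re t = 0" using pos t by auto
  then have "Re c > 0" "Im c = 0" using t by (auto simp: zero_less_mult_iff)
  then have "Re c > 0" "cnj c = of_real (Re c)" by (auto simp: complex_eq_iff)
  then show ?thesis using eq by (intro exI[of _ "Re c"]) auto
qed

text \<open>Positivity of a four-point product in particular excludes that all products with x
  vanish.\<close>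

lemma product_nonzero:
  assumes "v \<in> E i" "v \<noteq> 0" "x \<in> E j" "x \<noteq> 0"
  obtains u n where "u \<in> E i" "md u n x \<noteq> 0"
proof -
  obtain u n where "u \<in> E i" "Re (B (md u n x) (md (\<Phi> u) n (\<Phi> x))) > 0"
    using product_positive[OF assms(1,2)] assms(3,4) by blast
  then show thesis using that[of u n] assms(3) by force
qed

end

section \<open>Trivialising the cocycle\<close>

context voa_conjugation
begin

lemma structure_scalars:
  obtains L :: "int \<Rightarrow> int \<Rightarrow> real"
  where "\<And>i j. L i j > 0" "\<And>i j. L (i mod int p) (j mod int p) = L i j"
    "\<And>i j u w n. u \<in> E i \<Longrightarrow> w \<in> E j \<Longrightarrow>
      md (\<Phi> u) n (\<Phi> w) = sc (of_real (L i j)) (\<Phi> (md u n w))"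
proof -
  have "\<exists>c::real. c > 0 \<and> (\<forall>u\<in>E i. \<forall>w\<in>E j. \<forall>n.
    md (\<Phi> u) n (\<Phi> w) = sc (of_real c) (\<Phi> (md u n w)))" for i j
  proof (cases "(\<exists>v\<in>E i. v \<noteq> 0) \<and> (\<exists>x\<in>E j. x \<noteq> 0)")
    case True
    then show ?thesis using Phi_product_scalar by blast
  next
    case False
    then have "md (\<Phi> u) n (\<Phi> w) = sc (of_real 1) (\<Phi> (md u n w))"
      if "u \<in> E i" "w \<in> E j" for u w n
      using that by (cases "u = 0"; cases "w = 0") auto
    \<comment> \<open>When one of the eigenspaces is zero both sides vanish, and 1 is a harmless
      default.\<close>
    then show ?thesis by (intro exI[of _ 1]) auto
  qed
  then obtain L0 where L0: "\<And>i j. L0 i j > 0" "\<And>i j. \<forall>u\<in>E i. \<forall>w\<in>E j. \<forall>n.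
    md (\<Phi> u) n (\<Phi> w) = sc (of_real (L0 i j)) (\<Phi> (md u n w))"
    by metis
  show thesis
  \<comment> \<open>Reducing the indices makes the scalars periodic, since \<open>E i\<close>
    depends only on i mod p.\<close>
  proof (rule that[of "\<lambda>i j. L0 (i mod int p) (j mod int p)"])
    show "md (\<Phi> u) n (\<Phi> w) = sc (of_real (L0 (i mod int p) (j mod int p))) (\<Phi> (md u n w))"
      if "u \<in> E i" "w \<in> E j" for i j u w n
      using L0(2)[of "i mod int p" "j mod int p"] that by simp
  qed (simp_all add: L0(1))
qed

text \<open>Both bracketings of \<Phi>(u), \<Phi>(v), \<Phi>(w) are scalar multiples of the
  conjugated bracketings, and associativity relates the two. Different scalars would annihilate all
  associativity sums, and triangularity would then annihilate every u_q v_n w.\<close>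

lemma structure_cocycle:
  assumes L: "\<And>i j u w n. u \<in> E i \<Longrightarrow> w \<in> E j \<Longrightarrow>
      md (\<Phi> u) n (\<Phi> w) = sc (of_real (L i j)) (\<Phi> (md u n w))"
    and ne: "x \<in> E i" "x \<noteq> 0" "y \<in> E j" "y \<noteq> 0" "w \<in> E k" "w \<noteq> 0"
  shows "L i j * L (i + j) k = L j k * (L i (j + k) :: real)"
proof (rule ccontr)
  assume neq: "L i j * L (i + j) k \<noteq> L j k * L i (j + k)"
  let ?\<alpha> = "of_real (L i j * L (i + j) k) :: complex" and ?\<beta> = "of_real (L j k * L i (j + k)) :: complex"
  \<comment> \<open>A nonzero iterated product, chosen from the inside out, is what the
    contradiction is aimed at.\<close>
  obtain v n0 where v: "v \<in> E j" "md v n0 w \<noteq> 0"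
    using product_nonzero[OF ne(3,4,5,6)] .
  obtain u q0 where u: "u \<in> E i" "md u q0 (md v n0 w) \<noteq> 0"
    using product_nonzero[OF ne(1,2) E_mode[OF v(1) ne(5)] v(2)] .
  have C: "u \<in> C" "v \<in> C" "w \<in> C" using u v ne by auto
  have 1: "md (md (\<Phi> u) q (\<Phi> v)) n (\<Phi> w) = sc ?\<alpha> (\<Phi> (md (md u q v) n w))" for q n
  proof -
    have "md (md (\<Phi> u) q (\<Phi> v)) n (\<Phi> w) = sc (of_real (L i j)) (md (\<Phi> (md u q v)) n (\<Phi> w))"
      using L[OF u(1) v(1)] C by (simp add: mode_scale_left)
    also have "\<dots> = sc ?\<alpha> (\<Phi> (md (md u q v) n w))"
      using L[OF E_mode[OF u(1) v(1)] ne(5)] by simp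
    finally show ?thesis .
  qed
  have 2: "md (\<Phi> u) q (md (\<Phi> v) n (\<Phi> w)) = sc ?\<beta> (\<Phi> (md u q (md v n w)))" for q n
  proof -
    have "md (\<Phi> u) q (md (\<Phi> v) n (\<Phi> w)) = sc (of_real (L j k)) (md (\<Phi> u) q (\<Phi> (md v n w)))"
      using L[OF v(1) ne(5)] C by (simp add: mode_scale_right)
    also have "\<dots> = sc ?\<beta> (\<Phi> (md u q (md v n w)))"
      using L[OF u(1) E_mode[OF v(1) ne(5)]] by simp
    finally show ?thesis .
  qed
  obtain m1 where m1: "\<forall>j\<ge>m1. md u j w = 0" using truncation C by blast
  obtain m2 where m2: "\<forall>j\<ge>m2. md (\<Phi> u) j (\<Phi> w) = 0" using truncation[OF Phi_in Phi_in, OF C(1,3)] by blast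
  obtain N where N: "\<forall>j\<ge>N. md v j w = 0" using truncation C by blast
  let ?m = "max m1 m2"
  have "md u q0 (md v n0 w) \<in> {0}"
  proof (rule assoc_triangular[of _ N _ ?m])
    show "md u q (md v n w) = 0" if "n \<ge> N" for q n using that N C by simp
    fix l n
    have "\<exists>K0. \<forall>K\<ge>K0.
        (\<Sum>i<K. sc (of_int ?m gchoose i) (md (md u (l + int i) v) (?m + n - int i) w)) =
        (\<Sum>i<K. sc ((-1) ^ i * (of_int l gchoose i)) (md u (?m + l - int i) (md v (n + int i) w)))"
      by (rule associativity) (use m1 C in auto)
    then obtain K1 where K1: "\<forall>K\<ge>K1.
        (\<Sum>i<K. sc (of_int ?m gchoose i) (md (md u (l + int i) v) (?m + n - int i) w)) =
        (\<Sum>i<K. sc ((-1) ^ i * (of_int l gchoose i)) (md u (?m + l - int i) (md v (n + int i) w)))" ..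
    have "\<exists>K0. \<forall>K\<ge>K0.
        (\<Sum>i<K. sc (of_int ?m gchoose i) (md (md (\<Phi> u) (l + int i) (\<Phi> v)) (?m + n - int i) (\<Phi> w))) =
        (\<Sum>i<K. sc ((-1) ^ i * (of_int l gchoose i))
          (md (\<Phi> u) (?m + l - int i) (md (\<Phi> v) (n + int i) (\<Phi> w))))"
      by (rule associativity) (use m2 C in auto)
    then obtain K2 where K2: "\<forall>K\<ge>K2.
        (\<Sum>i<K. sc (of_int ?m gchoose i) (md (md (\<Phi> u) (l + int i) (\<Phi> v)) (?m + n - int i) (\<Phi> w))) =
        (\<Sum>i<K. sc ((-1) ^ i * (of_int l gchoose i))
          (md (\<Phi> u) (?m + l - int i) (md (\<Phi> v) (n + int i) (\<Phi> w))))" ..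
    have "(\<Sum>i<K. sc ((-1) ^ i * (of_int l gchoose i)) (md u (?m + l - int i) (md v (n + int i) w))) = 0"
      if K: "K \<ge> max K1 K2" for K
    proof -
      define X where "X = (\<Sum>i<K. sc (of_int ?m gchoose i) (md (md u (l + int i) v) (?m + n - int i) w))"
      have XC: "X \<in> C" using C by (auto simp: X_def)
      have XY: "X = (\<Sum>i<K. sc ((-1) ^ i * (of_int l gchoose i)) (md u (?m + l - int i) (md v (n + int i) w)))"
        using K1 K by (simp add: X_def)
      have \<alpha>: "(\<Sum>i<K. sc (of_int ?m gchoose i) (md (md (\<Phi> u) (l + int i) (\<Phi> v)) (?m + n - int i) (\<Phi> w))) =
          sc ?\<alpha> (\<Phi> X)"
        unfolding 1 X_def using C
        by (simp add: Phi_sum Phi_scale scale_sum_right mult.commute del: of_real_mult)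
      have \<beta>: "(\<Sum>i<K. sc ((-1) ^ i * (of_int l gchoose i))
          (md (\<Phi> u) (?m + l - int i) (md (\<Phi> v) (n + int i) (\<Phi> w)))) = sc ?\<beta> (\<Phi> X)"
        unfolding 2 XY using C
        by (simp add: Phi_sum Phi_scale scale_sum_right mult.commute del: of_real_mult)
      have "sc ?\<alpha> (\<Phi> X) = sc ?\<beta> (\<Phi> X)"
        unfolding \<alpha>[symmetric] \<beta>[symmetric] by (rule K2[rule_format]) (use K in simp)
      then have "\<Phi> X = 0" using neq by (metis of_real_eq_iff scale_cancel_right)
      then show ?thesis using XC XY by (simp add: Phi_eq_0_iff)
    qed
    then show "\<exists>K0. \<forall>K\<ge>K0. (\<Sum>i<K. sc ((-1) ^ i * (of_int l gchoose i))
        (md u (?m + l - int i) (md v (n + int i) w))) \<in> {0}"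
      by blast
  qed simp
  then show False using u by simp
qed

text \<open>Averaging over the second index writes the cocycle as a coboundary.\<close>

lemma multiplicative_scalars:
  obtains \<mu> :: "int \<Rightarrow> real"
  where "\<And>i. \<mu> i > 0" "\<And>i. \<mu> (i mod int p) = \<mu> i" "\<mu> 0 = 1"
    "\<And>i x. x \<in> E i \<Longrightarrow> x \<noteq> 0 \<Longrightarrow> \<mu> i * \<mu> (- i) = 1"
    "\<And>i j u w n. u \<in> E i \<Longrightarrow> w \<in> E j \<Longrightarrow>
      sc (of_real (\<mu> (i + j))) (md (\<Phi> u) n (\<Phi> w)) = sc (of_real (\<mu> i * \<mu> j)) (\<Phi> (md u n w))"
proof -
  obtain L :: "int \<Rightarrow> int \<Rightarrow> real" where pos: "\<And>i j. L i j > 0"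
    and per: "\<And>i j. L (i mod int p) (j mod int p) = L i j"
    and L: "\<And>i j u w n. u \<in> E i \<Longrightarrow> w \<in> E j \<Longrightarrow>
      md (\<Phi> u) n (\<Phi> w) = sc (of_real (L i j)) (\<Phi> (md u n w))"
    by (rule structure_scalars) blast
  have per1: "L (i mod int p) j = L i j" and per2: "L i (j mod int p) = L i j" for i j
    using per[of "i mod int p" j] per[of i j] per[of i "j mod int p"] by simp_all
  \<comment> \<open>The degrees that occur. The cocycle identity is known only for these, so the
    averaging runs over \<open>S\<close> instead of all residues.\<close>
  define S where "S = {k \<in> {0..<int p}. \<exists>x\<in>E k. x \<noteq> 0}"
  have finS: "finite S" by (rule finite_subset[of _ "{0..<int p}"]) (auto simp: S_def)
  have S_iff: "i mod int p \<in> S \<longleftrightarrow> (\<exists>x\<in>E i. x \<noteq> 0)" for i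
    using p_pos by (simp add: S_def)
  have S0: "0 \<in> S" using S_iff[of 0] E_vac vac_nonzero p_pos by auto
  define N where "N = card S"
  have N: "N > 0" using finS S0 by (auto simp: N_def card_gt_0_iff)
  have S_add: "(j + k) mod int p \<in> S" if j: "y \<in> E j" "y \<noteq> 0" and k: "k \<in> S" for j k y
  proof -
    obtain w where w: "w \<in> E k" "w \<noteq> 0" using k by (auto simp: S_def)
    obtain v n where "v \<in> E j" "md v n w \<noteq> 0" using product_nonzero[OF j w] .
    then show ?thesis unfolding S_iff using E_mode[OF _ w(1)] by blast
  qed
  define M where "M = (\<lambda>i. \<Prod>k\<in>S. L i k)"
  have Mpos: "M i > 0" for i by (auto simp: M_def pos intro: prod_pos)
  \<comment> \<open>Translation by an occurring degree is an injection of the finite set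
    \<open>S\<close> into itself, hence a permutation.\<close>
  have shift: "(\<Prod>k\<in>S. L i (j + k)) = M i" if j: "y \<in> E j" "y \<noteq> 0" for i j y
  proof -
    have inj: "inj_on (\<lambda>k. (j + k) mod int p) S"
    proof (rule inj_onI)
      fix k k' assume *: "k \<in> S" "k' \<in> S" "(j + k) mod int p = (j + k') mod int p"
      then have "k mod int p = k' mod int p" by (simp add: mod_eq_dvd_iff)
      then show "k = k'" using * by (simp add: S_def)
    qed
    have "(\<lambda>k. (j + k) mod int p) ` S = S"
      by (rule endo_inj_surj[OF finS _ inj]) (use S_add[OF j] in blast)
    then have "M i = prod (L i) ((\<lambda>k. (j + k) mod int p) ` S)" by (simp add: M_def)
    also have "\<dots> = (\<Prod>k\<in>S. L i (j + k))" by (simp add: prod.reindex[OF inj] per2)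
    finally show ?thesis ..
  qed
  \<comment> \<open>Multiplying the cocycle identity over k in \<open>S\<close> gives L(i,j)^N
    M(i+j) = M(i) M(j); positive N-th roots then give the coboundary.\<close>
  define \<mu> where "\<mu> = (\<lambda>i. root N (M i))"
  have mu_pos: "\<mu> i > 0" for i using N Mpos by (simp add: \<mu>_def)
  have cob: "L i j * \<mu> (i + j) = \<mu> i * \<mu> j"
    if i: "x \<in> E i" "x \<noteq> 0" and j: "y \<in> E j" "y \<noteq> 0" for i j x y
  proof -
    have "L i j ^ N * M (i + j) = (\<Prod>k\<in>S. L i j * L (i + j) k)"
      by (simp add: M_def N_def prod.distrib)
    also have "\<dots> = (\<Prod>k\<in>S. L j k * L i (j + k))"
      by (rule prod.cong[OF refl]) (use structure_cocycle[OF L i j] in \<open>auto simp: S_def\<close>)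
    also have "\<dots> = M j * M i" unfolding prod.distrib shift[OF j] by (simp add: M_def)
    finally have "root N (L i j ^ N * M (i + j)) = root N (M i * M j)" by (simp add: mult.commute)
    then show ?thesis
      using N pos[of i j] by (simp add: \<mu>_def real_root_mult real_root_power_cancel)
  qed
  \<comment> \<open>The scalar is 1 wherever \<Phi> is already multiplicative on a nonzero product.
    This applies to the vacuum and to dual degrees, giving \<mu>_0 = 1 and \<mu>_i \<mu>_{-i} =
    1.\<close>
  have unit: "L i j = 1" if "u \<in> E i" "w \<in> E j" "md u n w \<noteq> 0"
    "\<Phi> (md u n w) = md (\<Phi> u) n (\<Phi> w)" for i j u w n
  proof -
    have "md u n w \<in> C" using that by auto
    then have "\<Phi> (md u n w) \<noteq> 0" using that(3) by (simp add: Phi_eq_0_iff)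
    moreover have "sc (of_real (L i j)) (\<Phi> (md u n w)) = sc 1 (\<Phi> (md u n w))"
      using L[OF that(1,2), of n] that(4) by simp
    ultimately show ?thesis by (simp only: scale_cancel_right of_real_eq_1_iff simp_thms)
  qed
  have L0: "L 0 k = 1" if "k \<in> S" for k
  proof -
    obtain x where x: "x \<in> E k" "x \<noteq> 0" using \<open>k \<in> S\<close> by (auto simp: S_def)
    show ?thesis by (rule unit[OF E_vac x(1), of "-1"]) (use x in \<open>auto simp: vacuum\<close>)
  qed
  have mu0: "\<mu> 0 = 1" using N by (simp add: \<mu>_def M_def L0)
  show thesis
  proof (rule that[of \<mu>])
    show "\<mu> (i mod int p) = \<mu> i" for i by (simp add: \<mu>_def M_def per1)
    show "\<mu> i * \<mu> (- i) = 1" if x: "x \<in> E i" "x \<noteq> 0" for i x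
    proof -
      have x': "\<Phi> x \<in> E (- i)" "\<Phi> x \<noteq> 0" using x Phi_E by (auto simp: Phi_eq_0_iff)
      obtain u n where u: "u \<in> E i" "md u n (\<Phi> x) \<noteq> 0" using product_nonzero[OF x x'] .
      have "L i (- i) = 1" by (rule unit[OF u(1) x'(1) u(2) Phi_mode_dual[OF u(1) x'(1)]])
      then show ?thesis using cob[OF x x'] mu0 by simp
    qed
    show "sc (of_real (\<mu> (i + j))) (md (\<Phi> u) n (\<Phi> w)) = sc (of_real (\<mu> i * \<mu> j)) (\<Phi> (md u n w))"
      if "u \<in> E i" "w \<in> E j" for i j u w n
    proof (cases "u = 0 \<or> w = 0")
      case True
      then show ?thesis using that by auto
    next
      case False
      then show ?thesis
        using cob[of u i w j] that L[OF that, of n] by (simp add: mult.commute flip: of_real_mult)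
    qed
  qed (use mu_pos mu0 in auto)
qed

text \<open>Dividing by \<mu> removes the coboundary, and \<mu>_i \<mu>_{-i} = 1 keeps the
  involution and its compatibility with \<open>B\<close>. The form B(x, \<Psi> y) is then invariant
  because \<Psi> is multiplicative.\<close>

theorem unitary_structure: "\<exists>\<Psi>. antilinear_involution V \<Psi> \<and> unitary_voa V \<Psi>"
proof -
  obtain \<mu> :: "int \<Rightarrow> real" where pos: "\<And>i. \<mu> i > 0" and per: "\<And>i. \<mu> (i mod int p) = \<mu> i"
    and mu0: "\<mu> 0 = 1" and inv: "\<And>i x. x \<in> E i \<Longrightarrow> x \<noteq> 0 \<Longrightarrow> \<mu> i * \<mu> (- i) = 1"
    and mult: "\<And>i j u w n. u \<in> E i \<Longrightarrow> w \<in> E j \<Longrightarrow>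
      sc (of_real (\<mu> (i + j))) (md (\<Phi> u) n (\<Phi> w)) = sc (of_real (\<mu> i * \<mu> j)) (\<Phi> (md u n w))"
    by (rule multiplicative_scalars) blast
  define \<Psi> where "\<Psi> = (\<lambda>x. \<Phi> (diag (\<lambda>i. of_real (1 / \<mu> i)) x))"
  have in_C: "\<Psi> x \<in> C" if "x \<in> C" for x using that by (simp add: \<Psi>_def)
  have add: "\<Psi> (x + y) = \<Psi> x + \<Psi> y" if "x \<in> C" "y \<in> C" for x y
    using that by (simp add: \<Psi>_def diag_add Phi_add)
  have scale: "\<Psi> (sc c x) = sc (cnj c) (\<Psi> x)" if "x \<in> C" for c x
    using that by (simp add: \<Psi>_def diag_scale Phi_scale)
  have hom: "\<Psi> x = sc (of_real (1 / \<mu> i)) (\<Phi> x)" if "x \<in> E i" for i x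
    using that by (simp add: \<Psi>_def diag_E per Phi_scale)
  have hom_E: "\<Psi> x \<in> E (- i)" if "x \<in> E i" for i x
    using that by (simp add: hom E_scale Phi_E)
  have z: "\<Psi> 0 = 0" using scale[of 0 0] by simp
  have hom_mode: "\<Psi> (md x n y) = md (\<Psi> x) n (\<Psi> y)" if x: "x \<in> E i" and y: "y \<in> E j" for x y n i j
  proof -
    have "\<Psi> (md x n y) = sc (of_real (1 / (\<mu> (i + j) * \<mu> i * \<mu> j)))
        (sc (of_real (\<mu> i * \<mu> j)) (\<Phi> (md x n y)))"
      using pos[of i] pos[of j] pos[of "i + j"] by (simp add: hom[OF E_mode[OF x y]])
    also have "\<dots> = sc (of_real (1 / \<mu> i) * of_real (1 / \<mu> j)) (md (\<Phi> x) n (\<Phi> y))"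
      unfolding mult[OF x y, symmetric] using pos[of "i + j"] by simp
    also have "\<dots> = md (\<Psi> x) n (\<Psi> y)"
      using x y by (simp add: hom mode_scale_left mode_scale_right)
    finally show ?thesis .
  qed
  have mode: "\<Psi> (md x n y) = md (\<Psi> x) n (\<Psi> y)" if "x \<in> C" "y \<in> C" for x y n
    using that(1)
  proof (induction rule: grade_induct)
    case x: (homog i x)
    show ?case
      using that(2)
    proof (induction rule: grade_induct)
      case (homog j y)
      show ?case by (rule hom_mode[OF x homog])
    qed (use x in \<open>simp add: mode_add_right add in_C\<close>)
  qed (use that in \<open>simp add: mode_add_left add in_C\<close>)
  have invol: "\<Psi> (\<Psi> x) = x" if "x \<in> C" for x
    using that
  proof (induction rule: grade_induct)
    case (homog i x)
    show ?case
    proof (cases "x = 0")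
      case False
      have "\<Psi> (\<Psi> x) = sc (of_real (1 / \<mu> (- i))) (\<Phi> (\<Psi> x))" by (rule hom[OF hom_E[OF homog]])
      also have "\<dots> = sc (of_real (1 / (\<mu> i * \<mu> (- i)))) x"
        using homog by (simp add: hom[OF homog] Phi_scale mult.commute)
      finally show ?thesis using inv[OF homog False] by simp
    qed (simp add: z)
  qed (simp add: add in_C)
  have B_Psi: "B (\<Psi> x) (\<Psi> y) = cnj (B x y)" if "x \<in> C" "y \<in> C" for x y
    using that(1)
  proof (induction rule: grade_induct)
    case x: (homog i x)
    show ?case
      using that(2)
    proof (induction rule: grade_induct)
      case y: (homog j y)
      show ?case
      \<comment> \<open>In dual degrees the two scaling factors cancel, which is known only when V^i
        is nonzero; otherwise both sides are zero.\<close>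
      proof (cases "(i + j) mod int p = 0 \<and> x \<noteq> 0")
        case True
        then have "j mod int p = (- i) mod int p"
          by (simp add: mod_eq_dvd_iff dvd_eq_mod_eq_0 add.commute)
        then have "\<mu> j = \<mu> (- i)" using per[of j] per[of "- i"] by simp
        then have "\<mu> i * \<mu> j = 1" using inv[OF x] True by simp
        then have "of_real (1 / \<mu> i) * of_real (1 / \<mu> j) = (1::complex)"
          by (simp flip: of_real_mult)
        moreover have "B (\<Psi> x) (\<Psi> y) = (of_real (1 / \<mu> i) * of_real (1 / \<mu> j)) * cnj (B x y)"
          using x y by (simp add: hom[OF x] hom[OF y] B_Phi)
        ultimately show ?thesis by simp
      next
        case False
        show ?thesis
        proof (cases "x = 0")
          case True
          then show ?thesis using y in_C by (simp add: z)
        next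
          case nz: False
          then have *: "(i + j) mod int p \<noteq> 0" using False by simp
          then have "(- i + - j) mod int p \<noteq> 0"
            by (metis dvd_eq_mod_eq_0 dvd_minus_iff minus_add_distrib)
          then show ?thesis
            using B_E_orthogonal[OF x y *] B_E_orthogonal[OF hom_E[OF x] hom_E[OF y]] by simp
        qed
      qed
    qed (use x in_C in \<open>simp add: B_add_right add\<close>)
  qed (use that in_C in \<open>simp add: B_add_left add\<close>)
  define H where "H = (\<lambda>x y. B x (\<Psi> y))"
  have H_herm: "H y x = cnj (H x y)" if "x \<in> C" "y \<in> C" for x y
  proof -
    have "H y x = B (\<Psi> x) y" using B_symmetric that in_C by (simp add: H_def)
    also have "\<dots> = cnj (H x y)" using B_Psi[of x "\<Psi> y"] that in_C by (simp add: invol H_def)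
    finally show ?thesis .
  qed
  have H_hom: "Re (H x x) > 0" if "x \<in> E i" "x \<noteq> 0" for i x
    using B_Phi_pos[OF that] pos[of i] that by (simp add: H_def hom[OF that(1)])
  have H_pos: "Re (H x x) > 0" if x: "x \<in> C" "x \<noteq> 0" for x
  proof -
    let ?x = "\<lambda>i. P (int i) x"
    have Psum: "\<Psi> (\<Sum>i<k. ?x i) = (\<Sum>i<k. \<Psi> (?x i))" for k
      by (induction k) (use x in \<open>auto simp: z add\<close>)
    have "H x x = B (\<Sum>i<p. ?x i) (\<Sum>i<p. \<Psi> (?x i))"
      using P_sum[OF x(1)] Psum[of p] by (simp add: H_def)
    also have "\<dots> = (\<Sum>i<p. \<Sum>j<p. B (?x i) (\<Psi> (?x j)))"
      using x in_C by (simp add: B_sum_left B_sum_right) (rule sum.swap)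
    also have "\<dots> = (\<Sum>i<p. H (?x i) (?x i))"
    proof (rule sum.cong[OF refl])
      fix i assume i: "i \<in> {..<p}"
      have "B (?x i) (\<Psi> (?x j)) = 0" if "j < p" "j \<noteq> i" for j
      proof (rule B_E_orthogonal)
        show "?x i \<in> E (int i)" "\<Psi> (?x j) \<in> E (- int j)" using P_E x hom_E by auto
        show "(int i + - int j) mod int p \<noteq> 0"
          using that i by (auto simp: mod_eq_dvd_iff[symmetric] dvd_eq_mod_eq_0[symmetric])
      qed
      then have "(\<Sum>j<p. B (?x i) (\<Psi> (?x j))) = (\<Sum>j\<in>{i}. B (?x i) (\<Psi> (?x j)))"
        using i by (intro sum.mono_neutral_right) auto
      then show "(\<Sum>j<p. B (?x i) (\<Psi> (?x j))) = H (?x i) (?x i)" by (simp add: H_def)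
    qed
    finally have "Re (H x x) = (\<Sum>i<p. Re (H (?x i) (?x i)))" by simp
    moreover have "(\<Sum>i<p. Re (H (?x i) (?x i))) > 0"
    proof -
      have "\<exists>i<p. ?x i \<noteq> 0"
      proof (rule ccontr)
        assume "\<not> (\<exists>i<p. ?x i \<noteq> 0)"
        then have "(\<Sum>i<p. ?x i) = 0" by simp
        then show False using P_sum[OF x(1)] x(2) by simp
      qed
      then obtain i where i: "i < p" "?x i \<noteq> 0" by blast
      show ?thesis
      proof (rule sum_pos2[of _ i])
        show "Re (H (?x i) (?x i)) > 0" using H_hom[OF P_E i(2)] x by simp
        show "Re (H (?x j) (?x j)) \<ge> 0" for j
          using H_hom[OF P_E[OF x(1)], of "int j"]
          by (cases "?x j = 0") (auto simp: H_def z less_imp_le)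
      qed (use i in auto)
    qed
    ultimately show ?thesis by simp
  qed
  have "antilinear_involution V \<Psi>"
    unfolding antilinear_involution_def
  proof (intro conjI)
    show "bij_betw \<Psi> C C"
      by (rule bij_betw_byWitness[of _ \<Psi>]) (use invol in_C in auto)
    show "antilinear_on sc sc C \<Psi>" by (simp add: antilinear_on_def add scale)
    \<comment> \<open>Antilinearity moves this vector, so the order is 2 and not 1.\<close>
    have "\<Psi> (sc \<i> (vac V)) \<noteq> sc \<i> (vac V)"
    proof
      assume "\<Psi> (sc \<i> (vac V)) = sc \<i> (vac V)"
      then have "sc (- \<i>) (vac V) = sc \<i> (vac V)"
        using hom[OF E_vac] by (simp add: scale mu0)
      then have "- \<i> = \<i>" using vac_nonzero by (simp only: scale_cancel_right simp_thms)
      then show False by (simp add: complex_eq_iff)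
    qed
    then have "\<exists>x\<in>C. (\<Psi> ^^ m) x \<noteq> x" if "0 < m" "m < 2" for m
      using that by (intro bexI[of _ "sc \<i> (vac V)"]) (auto simp: less_2_cases_iff)
    then show "has_order_on C \<Psi> 2"
      by (simp add: has_order_on_def invol numeral_2_eq_2)
    show "\<Psi> (vac V) = vac V" "\<Psi> (conf V) = conf V"
      using hom[OF E_vac] hom[OF E_conf] by (simp_all add: mu0)
  qed (simp add: mode)
  moreover have "pos_def_hermitian sc C H"
    unfolding pos_def_hermitian_def
  proof (intro conjI ballI impI)
    show "linear_on sc (*) C (\<lambda>x. H x y)" if "y \<in> C" for y
      using B_linear_left[OF in_C[OF that]] by (simp add: H_def)
    show "antilinear_on sc (*) C (H x)" if "x \<in> C" for x
      using that in_C by (simp add: antilinear_on_def H_def add scale B_add_right)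
    show "H y x = cnj (H x y)" if "x \<in> C" "y \<in> C" for x y by (rule H_herm[OF that])
    show "Im (H x x) = 0" if "x \<in> C" for x
      using H_herm[OF that that] by (simp add: complex_eq_iff)
    show "0 < Re (H x x)" if "x \<in> C" "x \<noteq> 0" for x by (rule H_pos[OF that])
  qed
  moreover have "invariant_form V \<Psi> (adjoint_module V) H"
  proof -
    have "H (adj a n x) y = H x (md (\<Psi> a) n y)" if C: "a \<in> C" "x \<in> C" "y \<in> C" for a n x y
    proof -
      have "H x (md (\<Psi> a) n y) = B x (md a n (\<Psi> y))" using C in_C by (simp add: H_def mode invol)
      also have "\<dots> = B (md a n (\<Psi> y)) x" using C in_C by (simp add: B_symmetric)
      also have "\<dots> = B (\<Psi> y) (adj a n x)" using C in_C by (simp add: B_invariant)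
      also have "\<dots> = H (adj a n x) y" using C in_C B_symmetric by (simp add: H_def)
      finally show ?thesis ..
    qed
    then show ?thesis by (simp add: invariant_form_def adjoint_module_def)
  qed
  ultimately show ?thesis
    using voa_axioms unfolding unitary_voa_def by blast
qed

end

section \<open>The conjugation defined by the Hermitian forms\<close>

lemma cnj_root_of_unity_powi: "cnj (root_of_unity p powi i) = root_of_unity p powi (- i)"
proof -
  have "root_of_unity p = cis (2 * pi / of_nat p)"
    by (simp add: root_of_unity_def cis_conv_exp algebra_simps)
  then show ?thesis by (simp add: cis_power_int cis_cnj)
qed

context voa_form_cyclic
begin

lemma P_f: "x \<in> C \<Longrightarrow> P i (f x) = f (P i x)"
proof (induction rule: grade_induct)
  case (homog j x)
  then show ?case by (simp add: E_f P_scale P_on_E)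
qed (simp add: P_add f_add)

lemma P_mode_right:
  assumes "a \<in> E 0" "x \<in> C"
  shows "P i (md a n x) = md a n (P i x)"
  using assms(2)
proof (induction rule: grade_induct)
  case (homog j x)
  then show ?case using P_on_E[OF homog, of i] P_on_E[of "md a n x" j i] E_mode[OF assms(1) homog, of n] assms(1)
    by simp
qed (use assms(1) in \<open>simp add: P_add mode_add_right\<close>)

text \<open>Nondegeneracy replaces the defining sum: \<open>B\<close> turns the opposite mode into
  an ordinary mode on the other argument, where linearity is evident.\<close>

lemma adj_add_right:
  assumes "a \<in> C" "x \<in> C" "y \<in> C"
  shows "adj a n (x + y) = adj a n x + adj a n y"
proof (rule B_eqI)
  fix u assume "u \<in> C"
  then show "B (adj a n (x + y)) u = B (adj a n x + adj a n y) u"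
    using assms by (simp add: B_symmetric[of _ u] B_add_right B_invariant[symmetric])
qed (use assms in auto)

lemma adj_E:
  assumes a: "a \<in> E 0" and x: "x \<in> E i"
  shows "adj a n x \<in> E i"
proof (rule E_I)
  have C: "a \<in> C" "x \<in> C" using a x by auto
  have "f (adj a n x) = adj (f a) n (f x)"
    by (rule adj_map[of f C]) (use C in \<open>auto simp: f_add f_scale f_weight f_Vir f_mode\<close>)
  also have "f a = a" using E_f[OF a] by simp
  also have "adj a n (f x) = sc (\<xi> powi i) (adj a n x)"
    unfolding E_f[OF x]
  proof (rule B_eqI)
    fix u assume "u \<in> C"
    then show "B (adj a n (sc (\<xi> powi i) x)) u = B (sc (\<xi> powi i) (adj a n x)) u"
      using C by (simp add: B_symmetric[of _ u] B_invariant[symmetric])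
  qed (use C in auto)
  finally show "f (adj a n x) = sc (\<xi> powi i) (adj a n x)" .
qed (use assms in auto)

lemma P_adj:
  assumes "a \<in> E 0" "x \<in> C"
  shows "P i (adj a n x) = adj a n (P i x)"
  using assms(2)
proof (induction rule: grade_induct)
  case (homog j x)
  have "adj a n 0 = 0" using adj_add_right[of a 0 0 n] assms(1) by simp
  then show ?case using P_on_E[OF homog] P_on_E[OF adj_E[OF assms(1) homog]] by simp
qed (use assms(1) in \<open>simp add: P_add adj_add_right\<close>)

text \<open>The weight spaces of V^0 are intersections with those of V, and components of a vector
  of V^0 stay in V^0. So invariance stated over V^0 can be read with the opposite modes of
  V.\<close>

lemma opp_mode_restrict:
  assumes "a \<in> E 0"
  shows "opp_mode (restrict_voa V (E 0)) (restrict_module V A) a n w = adj a n w"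
proof -
  have ws: "weight_space (restrict_voa V (E 0)) d = E 0 \<inter> W d" for d
    by (auto simp: weight_space_def restrict_voa_def Vir_def simp del: weight_in)
  have "homog_comp (restrict_voa V (E 0)) a = homog_comp V a"
    unfolding homog_comp_def[of "restrict_voa V (E 0)"] ws
  proof (rule the_equality)
    show "(\<forall>n. homog_comp V a n \<in> E 0 \<inter> W n) \<and> finite {n. homog_comp V a n \<noteq> 0} \<and>
        a = Sum_any (homog_comp V a)"
      using decomp_homog_comp[of a] assms E_homog_comp[OF assms] by (simp add: decomp_def)
    fix c assume "(\<forall>n. c n \<in> E 0 \<inter> W n) \<and> finite {n. c n \<noteq> 0} \<and> a = Sum_any c"
    then have "decomp a c" by (simp add: decomp_def)
    then show "c = homog_comp V a" by (rule homog_comp_eqI[symmetric])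
  qed
  moreover have "Vir (restrict_voa V (E 0)) = Vir V"
    by (simp add: Vir_def restrict_voa_def fun_eq_iff)
  ultimately show ?thesis
    by (simp add: opp_mode_def restrict_module_def adjoint_module_def)
qed

end

locale voa_unitary_pieces = voa_form_cyclic V B f p
  for V :: "('v::ab_group_add) voa_data" and B f p +
  fixes \<phi> :: "'v \<Rightarrow> 'v" and H :: "nat \<Rightarrow> 'v \<Rightarrow> 'v \<Rightarrow> complex"
  assumes involution: "antilinear_involution (restrict_voa V (E 0)) \<phi>"
    and H_hermitian: "\<And>i. i < p \<Longrightarrow> pos_def_hermitian (scal V) (E (int i)) (H i)"
    and H_invariant: "\<And>i. i < p \<Longrightarrow>
      invariant_form (restrict_voa V (E 0)) \<phi> (restrict_module V (E (int i))) (H i)"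
begin

lemma phi_E [simp]: "a \<in> E 0 \<Longrightarrow> \<phi> a \<in> E 0"
  and phi_phi [simp]: "a \<in> E 0 \<Longrightarrow> \<phi> (\<phi> a) = a"
  and phi_vac [simp]: "\<phi> (vac V) = vac V"
  and phi_conf [simp]: "\<phi> (conf V) = conf V"
  using involution
  by (auto simp: antilinear_involution_def restrict_voa_def bij_betw_def has_order_on_def numeral_2_eq_2)

text \<open>The orthogonal sum of the given forms.\<close>

definition HH :: "'v \<Rightarrow> 'v \<Rightarrow> complex" where
  "HH x y = (\<Sum>i<p. H i (P (int i) x) (P (int i) y))"

lemma H_add_left: "i < p \<Longrightarrow> x \<in> E (int i) \<Longrightarrow> x' \<in> E (int i) \<Longrightarrow> y \<in> E (int i) \<Longrightarrow>
    H i (x + x') y = H i x y + H i x' y"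
  and H_scale_left: "i < p \<Longrightarrow> x \<in> E (int i) \<Longrightarrow> y \<in> E (int i) \<Longrightarrow> H i (sc c x) y = c * H i x y"
  and H_add_right: "i < p \<Longrightarrow> x \<in> E (int i) \<Longrightarrow> x' \<in> E (int i) \<Longrightarrow> y \<in> E (int i) \<Longrightarrow>
    H i y (x + x') = H i y x + H i y x'"
  and H_scale_right: "i < p \<Longrightarrow> x \<in> E (int i) \<Longrightarrow> y \<in> E (int i) \<Longrightarrow> H i y (sc c x) = cnj c * H i y x"
  and H_cnj: "i < p \<Longrightarrow> x \<in> E (int i) \<Longrightarrow> y \<in> E (int i) \<Longrightarrow> H i y x = cnj (H i x y)"
  and H_pos: "i < p \<Longrightarrow> x \<in> E (int i) \<Longrightarrow> x \<noteq> 0 \<Longrightarrow> Re (H i x x) > 0"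
  using H_hermitian[of i] unfolding pos_def_hermitian_def linear_on_def antilinear_on_def by blast+

lemma H_adj:
  assumes "i < p" "a \<in> E 0" "x \<in> E (int i)" "y \<in> E (int i)"
  shows "H i (adj a n x) y = H i x (md (\<phi> a) n y)"
proof -
  have m: "carr (restrict_voa V A) = A" "mcarr (restrict_module V A) = A" "mmode (restrict_module V A) = md"
    for A by (simp_all add: restrict_voa_def restrict_module_def adjoint_module_def)
  have "H i (opp_mode (restrict_voa V (E 0)) (restrict_module V (E (int i))) a n x) y =
      H i x (md (\<phi> a) n y)"
    using H_invariant[OF assms(1)] assms(2-4) unfolding invariant_form_def m by blast
  then show ?thesis by (simp add: opp_mode_restrict[OF assms(2)])
qed

lemma HH_add_left: "x \<in> C \<Longrightarrow> x' \<in> C \<Longrightarrow> y \<in> C \<Longrightarrow> HH (x + x') y = HH x y + HH x' y"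
  by (simp add: HH_def P_add P_E H_add_left sum.distrib)

lemma HH_scale_left: "x \<in> C \<Longrightarrow> y \<in> C \<Longrightarrow> HH (sc c x) y = c * HH x y"
  by (simp add: HH_def P_scale P_E H_scale_left sum_distrib_left)

lemma HH_add_right: "x \<in> C \<Longrightarrow> x' \<in> C \<Longrightarrow> y \<in> C \<Longrightarrow> HH y (x + x') = HH y x + HH y x'"
  by (simp add: HH_def P_add P_E H_add_right sum.distrib)

lemma HH_scale_right: "x \<in> C \<Longrightarrow> y \<in> C \<Longrightarrow> HH y (sc c x) = cnj c * HH y x"
  by (simp add: HH_def P_scale P_E H_scale_right sum_distrib_left)

lemma HH_cnj: "x \<in> C \<Longrightarrow> y \<in> C \<Longrightarrow> HH y x = cnj (HH x y)"
  unfolding HH_def cnj_sum by (intro sum.cong refl H_cnj) (auto simp: P_E)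

lemma HH_real: "x \<in> C \<Longrightarrow> Im (HH x x) = 0"
  using HH_cnj[of x x] by (simp add: complex_eq_iff)

lemma HH_zero_right [simp]: "y \<in> C \<Longrightarrow> HH y 0 = 0"
  using HH_scale_right[of 0 y 0] by simp

lemma HH_sum_right: "y \<in> C \<Longrightarrow> (\<And>i. i \<in> A \<Longrightarrow> g i \<in> C) \<Longrightarrow> HH y (sum g A) = (\<Sum>i\<in>A. HH y (g i))"
  by (induction A rule: infinite_finite_induct) (auto simp: HH_add_right)

lemma HH_pos:
  assumes "x \<in> C" "x \<noteq> 0"
  shows "Re (HH x x) > 0"
proof -
  have nn: "Re (H i (P (int i) x) (P (int i) x)) \<ge> 0" if "i < p" for i
  proof (cases "P (int i) x = 0")
    case True
    then show ?thesis using H_scale_left[OF that E_zero E_zero, of 0] by simp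
  next
    case False
    then show ?thesis using H_pos[OF that P_E[OF assms(1)]] by simp
  qed
  have "\<exists>i<p. P (int i) x \<noteq> 0"
  proof (rule ccontr)
    assume "\<not> (\<exists>i<p. P (int i) x \<noteq> 0)"
    then have "(\<Sum>i<p. P (int i) x) = 0" by simp
    then show False using P_sum[OF assms(1)] assms(2) by simp
  qed
  then obtain i where i: "i < p" "P (int i) x \<noteq> 0" by blast
  have "(\<Sum>i<p. Re (H i (P (int i) x) (P (int i) x))) > 0"
    by (rule sum_pos2[of _ i]) (use i nn H_pos[OF i(1) P_E[OF assms(1)] i(2)] in auto)
  then show ?thesis by (simp add: HH_def)
qed

lemma HH_adj: "a \<in> E 0 \<Longrightarrow> x \<in> C \<Longrightarrow> y \<in> C \<Longrightarrow> HH (adj a n x) y = HH x (md (\<phi> a) n y)"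
  unfolding HH_def by (intro sum.cong refl) (simp add: P_adj P_mode_right H_adj P_E)

text \<open>On each V^i the automorphism \<open>f\<close> is a scalar of modulus 1.\<close>

lemma HH_f:
  assumes "x \<in> C" "y \<in> C"
  shows "HH (f x) (f y) = HH x y"
proof -
  have "H i (P (int i) (f x)) (P (int i) (f y)) = H i (P (int i) x) (P (int i) y)" if i: "i < p" for i
  proof -
    define c where "c = \<xi> powi int i"
    have "f (P (int i) z) = sc c (P (int i) z)" if "z \<in> C" for z
      unfolding c_def by (rule E_f[OF P_E[OF that]])
    then have "H i (P (int i) (f x)) (P (int i) (f y)) = (c * cnj c) * H i (P (int i) x) (P (int i) y)"
      using assms i by (simp add: P_f H_scale_left H_scale_right P_E E_scale)
    also have "c * cnj c = 1"
      unfolding c_def cnj_root_of_unity_powi power_int_minus by simp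
    finally show ?thesis by simp
  qed
  then show ?thesis by (simp add: HH_def)
qed

text \<open>\<open>B\<close> represents only functionals supported on finitely many weights. L(0) is
  self-adjoint for \<open>HH\<close>, because \<omega> lies in V^0 and is fixed by \<phi>, so
  pairing with y sees only the weights of y.\<close>

lemma HH_represented:
  assumes y: "y \<in> C"
  shows "\<exists>z\<in>C. \<forall>x\<in>C. B z x = HH x y"
proof -
  \<comment> \<open>Functionals of the restricted dual are zero outside the carrier.\<close>
  define g where "g = (\<lambda>x. if x \<in> C then HH x y else 0)"
  let ?D = "{d. homog_comp V y d \<noteq> 0}"
  have fin: "finite ?D" by (rule homog_comp_finite[OF y])
  have "l \<in> of_int ` ?D" if x: "x \<in> C" "md (conf V) 1 x = sc l x" and nz: "HH x y \<noteq> 0" for l x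
  proof (rule ccontr)
    assume l: "l \<notin> of_int ` ?D"
    have "HH x (homog_comp V y d) = 0" if "d \<in> ?D" for d
    proof -
      have yd: "homog_comp V y d \<in> W d" using y by simp
      have "l * HH x (homog_comp V y d) = HH (adj (conf V) 1 x) (homog_comp V y d)"
        using x y by (simp add: adj_conf HH_scale_left)
      also have "\<dots> = HH x (Vir V 0 (homog_comp V y d))"
        using x y by (subst HH_adj) (simp_all add: Vir_def)
      also have "Vir V 0 (homog_comp V y d) = sc (of_int d) (homog_comp V y d)"
        using yd by (simp add: weight_iff)
      also have "HH x \<dots> = of_int d * HH x (homog_comp V y d)"
        using x y by (simp add: HH_scale_right)
      finally show ?thesis using l that by auto
    qed
    moreover have "HH x y = (\<Sum>d\<in>?D. HH x (homog_comp V y d))"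
      using HH_sum_right[OF x(1), of ?D "homog_comp V y"] y
        decomp_sum[OF decomp_homog_comp[OF y] fin order_refl] by simp
    ultimately show False using nz by simp
  qed
  then have "{l. \<exists>x\<in>mweight_space V (adjoint_module V) l. g x \<noteq> 0} \<subseteq> of_int ` ?D"
    by (auto simp: mweight_space_def adjoint_module_def g_def)
  then have "finite {l. \<exists>x\<in>mweight_space V (adjoint_module V) l. g x \<noteq> 0}"
    using fin finite_subset by blast
  then have "g \<in> restricted_dual V (adjoint_module V)"
    using y by (auto simp: restricted_dual_def adjoint_module_def linear_on_def g_def
        HH_add_left HH_scale_left)
  then obtain z where "z \<in> C" "\<forall>x\<in>C. B z x = g x" using B_represents by blast
  then show ?thesis by (auto simp: g_def)
qed

text \<open>Comparing \<open>HH\<close> with \<open>B\<close> defines an antilinear map \<Psi> whose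
  square is a positive scalar c_i on V^i; dividing by the square root of c_i turns it into an
  involution extending \<phi>.\<close>

lemma conjugation_exists: "\<exists>\<Phi>. voa_conjugation V B f p \<Phi>"
proof -
  obtain \<Psi> where Psi_in: "\<And>y. y \<in> C \<Longrightarrow> \<Psi> y \<in> C"
    and Psi: "\<And>x y. x \<in> C \<Longrightarrow> y \<in> C \<Longrightarrow> B (\<Psi> y) x = HH x y"
    using bchoice[of C "\<lambda>y z. z \<in> C \<and> (\<forall>x\<in>C. B z x = HH x y)"] HH_represented by blast
  have add: "\<Psi> (x + y) = \<Psi> x + \<Psi> y" if "x \<in> C" "y \<in> C" for x y
    by (rule B_eqI) (use that Psi_in in \<open>auto simp: Psi B_add_left HH_add_right\<close>)
  have scale: "\<Psi> (sc c x) = sc (cnj c) (\<Psi> x)" if "x \<in> C" for c x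
    by (rule B_eqI) (use that Psi_in in \<open>auto simp: Psi HH_scale_right\<close>)
  have mode: "\<Psi> (md a n y) = md (\<phi> a) n (\<Psi> y)" if a: "a \<in> E 0" and y: "y \<in> C" for a n y
  proof (rule B_eqI)
    fix x assume x: "x \<in> C"
    have aC: "a \<in> C" "\<phi> a \<in> C" using a phi_E[OF a] E_in by blast+
    \<comment> \<open>Invariance of \<open>HH\<close> is used for \<open>\<phi> a\<close>, since
      \<phi> is its own inverse.\<close>
    have "B (\<Psi> (md a n y)) x = HH (adj (\<phi> a) n x) y"
      using a aC x y by (simp add: Psi HH_adj)
    also have "\<dots> = B (md (\<phi> a) n (\<Psi> y)) x"
      using aC x y Psi_in by (simp add: Psi B_invariant)
    finally show "B (\<Psi> (md a n y)) x = B (md (\<phi> a) n (\<Psi> y)) x" .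
  next
    have aC: "a \<in> C" "\<phi> a \<in> C" using a phi_E[OF a] E_in by blast+
    then show "\<Psi> (md a n y) \<in> C" "md (\<phi> a) n (\<Psi> y) \<in> C" using y Psi_in by auto
  qed
  have Psi_f: "f (\<Psi> y) = \<Psi> (f y)" if y: "y \<in> C" for y
  proof (rule B_eqI)
    have surj: "f ` C = C" using f_auto by (simp add: voa_automorphism_def bij_betw_def)
    fix x assume "x \<in> C"
    then obtain x' where x': "x' \<in> C" "x = f x'" using surj by (metis imageE)
    have "B (f (\<Psi> y)) x = B (\<Psi> y) x'" using B_automorphism[OF f_auto] y x' Psi_in by simp
    also have "\<dots> = B (\<Psi> (f y)) x" using x' y by (simp add: Psi HH_f)
    finally show "B (f (\<Psi> y)) x = B (\<Psi> (f y)) x" .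
  qed (use y Psi_in in auto)
  have Psi_E: "\<Psi> x \<in> E (- i)" if x: "x \<in> E i" for i x
  proof (rule E_I)
    show "f (\<Psi> x) = sc (\<xi> powi (- i)) (\<Psi> x)"
      using Psi_f[of x] x by (simp add: E_f scale cnj_root_of_unity_powi del: complex_cnj_power_int)
  qed (use x Psi_in in auto)
  have norm: "B x (\<Psi> x) = HH x x" if "x \<in> C" for x
    using B_symmetric[of x "\<Psi> x"] that Psi_in by (simp add: Psi)
  have Psi_nz: "\<Psi> x \<noteq> 0" if "x \<in> C" "x \<noteq> 0" for x
    using HH_pos[OF that] norm[OF that(1)] that by auto
  \<comment> \<open>Schur's lemma applies to \<Psi>^2, which is linear and commutes with V^0; zero
    eigenspaces receive the default 1.\<close>
  have "\<exists>c::real. c > 0 \<and> (\<forall>x\<in>E i. \<Psi> (\<Psi> x) = sc (of_real c) x)" for i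
  proof (cases "\<exists>x\<in>E i. x \<noteq> 0")
    case False
    then have "\<Psi> (\<Psi> x) = sc (of_real 1) x" if "x \<in> E i" for x
      using that scale[of 0 0] by auto
    then show ?thesis by (intro exI[of _ 1]) auto
  next
    case True
    then obtain x where x: "x \<in> E i" "x \<noteq> 0" by blast
    have xC: "x \<in> C" "\<Psi> x \<in> C" using x Psi_in by auto
    have "\<exists>c. \<forall>x\<in>E i. \<Psi> (\<Psi> x) = sc c x"
    proof (rule schur)
      show "\<Psi> (\<Psi> x) \<in> E i" if "x \<in> E i" for x using Psi_E[OF Psi_E[OF that]] by simp
      show "\<Psi> (\<Psi> (md a n x)) = md a n (\<Psi> (\<Psi> x))" if "a \<in> E 0" "x \<in> E i" for a n x
        using that Psi_in by (simp add: mode)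
    qed (simp_all add: add scale Psi_in)
    then obtain c where c: "\<forall>x\<in>E i. \<Psi> (\<Psi> x) = sc c x" by blast
    \<comment> \<open>Evaluating the norm of \<Psi> x in two ways shows that the scalar is a
      quotient of positive numbers.\<close>
    have "HH (\<Psi> x) (\<Psi> x) = B (\<Psi> (\<Psi> x)) (\<Psi> x)" using Psi[of "\<Psi> x" "\<Psi> x"] xC by simp
    also have "\<dots> = c * HH x x" using c x xC norm by simp
    finally have e: "HH (\<Psi> x) (\<Psi> x) = c * HH x x" .
    have "Re c * Re (HH x x) > 0" "Im c * Re (HH x x) = 0"
      using arg_cong[OF e, of Re] arg_cong[OF e, of Im] HH_pos[OF xC(2) Psi_nz[OF xC(1) x(2)]]
        HH_real[OF xC(1)] HH_real[OF xC(2)] by simp_all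
    then have "Re c > 0" "Im c = 0" using HH_pos[OF xC(1) x(2)] by (auto simp: zero_less_mult_iff)
    then have "Re c > 0" "c = of_real (Re c)" by (auto simp: complex_eq_iff)
    then show ?thesis using c by (intro exI[of _ "Re c"]) auto
  qed
  then obtain c0 :: "int \<Rightarrow> real" where c0: "\<And>i. c0 i > 0"
    "\<And>i x. x \<in> E i \<Longrightarrow> \<Psi> (\<Psi> x) = sc (of_real (c0 i)) x" by metis
  define c where "c = (\<lambda>i. c0 (i mod int p))"
  have pos: "c i > 0" for i by (simp add: c_def c0)
  have per: "c (i mod int p) = c i" for i by (simp add: c_def)
  have c: "\<Psi> (\<Psi> x) = sc (of_real (c i)) x" if "x \<in> E i" for i x
    using c0(2)[of x "i mod int p"] that by (simp add: c_def)
  \<comment> \<open>Both scalars describe \<Psi>^3 x; being real, they pass through the antilinear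
    map unchanged.\<close>
  have c_neg: "c (- i) = c i" if x: "x \<in> E i" "x \<noteq> 0" for i x
  proof -
    have "sc (of_real (c (- i))) (\<Psi> x) = \<Psi> (\<Psi> (\<Psi> x))" by (rule c[OF Psi_E[OF x(1)], symmetric])
    also have "\<dots> = sc (of_real (c i)) (\<Psi> x)" using x by (simp add: c[OF x(1)] scale)
    finally have "sc (of_real (c (- i))) (\<Psi> x) = sc (of_real (c i)) (\<Psi> x)" .
    then show ?thesis using Psi_nz[of x] x by simp
  qed
  obtain t where t: "\<Psi> (vac V) = sc t (vac V)"
  proof -
    have "Vir V 0 (\<Psi> (vac V)) = \<Psi> (Vir V 0 (vac V))" by (simp add: Vir_def mode)
    then have "\<Psi> (vac V) \<in> W 0" using Psi_in scale[of 0 0] by (simp add: weight_iff Vir_vac)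
    then show thesis using weight_0 that by blast
  qed
  have "t = HH (vac V) (vac V)" using norm[of "vac V"] by (simp add: t B_vac)
  then have t_pos: "Im t = 0" "Re t > 0" using HH_real HH_pos vac_nonzero by auto
  define s where "s = Re t"
  have s: "t = of_real s" "s > 0" using t_pos by (auto simp: s_def complex_eq_iff)
  \<comment> \<open>The vacuum is sent to a positive multiple s of itself, so the normalisation in
    degree 0 is exactly division by s.\<close>
  have "sc (of_real (c 0)) (vac V) = sc (of_real (s * s)) (vac V)"
    using c[OF E_vac, symmetric] by (simp add: t scale s)
  then have "c 0 = s * s" using vac_nonzero by (simp only: scale_cancel_right of_real_eq_iff simp_thms)
  then have sqrt0: "sqrt (c 0) = s" using s by simp
  \<comment> \<open>Write a as a_{-1}1 and use compatibility with the V^0-action; after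
    normalisation the conjugation agrees with \<phi> on V^0.\<close>
  have Psi_phi: "\<Psi> a = sc (of_real s) (\<phi> a)" if a: "a \<in> E 0" for a
  proof -
    have "\<phi> a \<in> C" using phi_E[OF a] by (rule E_in)
    then show ?thesis
      using mode[OF a vac_in, of "-1"] E_in[OF a] by (simp add: creation t s mode_scale_right)
  qed
  define r where "r = (\<lambda>i. 1 / sqrt (c i))"
  have r_pos: "r i > 0" for i by (simp add: r_def pos)
  have r_per: "r (i mod int p) = r i" for i by (simp add: r_def per)
  have "r i * r i * c i = 1" for i using pos[of i] by (simp add: r_def)
  then have rr: "of_real (r i) * of_real (r i) * of_real (c i) = (1::complex)" for i
    by (metis of_real_1 of_real_mult)
  define \<Phi> where "\<Phi> = (\<lambda>x. \<Psi> (diag (\<lambda>i. of_real (r i)) x))"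
  have Phi_in: "\<Phi> x \<in> C" if "x \<in> C" for x using that by (simp add: \<Phi>_def Psi_in)
  have Phi_add: "\<Phi> (x + y) = \<Phi> x + \<Phi> y" if "x \<in> C" "y \<in> C" for x y
    using that by (simp add: \<Phi>_def diag_add add)
  have Phi_scale: "\<Phi> (sc c x) = sc (cnj c) (\<Phi> x)" if "x \<in> C" for c x
    using that by (simp add: \<Phi>_def diag_scale scale)
  have hom: "\<Phi> x = sc (of_real (r i)) (\<Psi> x)" if "x \<in> E i" for i x
    using that by (simp add: \<Phi>_def diag_E r_per scale)
  have Phi_E: "\<Phi> x \<in> E (- i)" if "x \<in> E i" for i x
    using that by (simp add: hom E_scale Psi_E)
  have Phi_0: "\<Phi> a = \<phi> a" if "a \<in> E 0" for a
    using s by (simp add: hom[OF that] Psi_phi[OF that] r_def sqrt0)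
  have z: "\<Phi> 0 = 0" using Phi_scale[of 0 0] by simp
  have "voa_conjugation V B f p \<Phi>"
  proof
    show "\<Phi> (\<Phi> x) = x" if "x \<in> C" for x
      using that
    proof (induction rule: grade_induct)
      case (homog i x)
      show ?case
      proof (cases "x = 0")
        case False
        have r_neg: "r (- i) = r i" using c_neg[OF homog False] by (simp add: r_def)
        have "\<Phi> (\<Phi> x) = sc (of_real (r (- i))) (\<Psi> (\<Phi> x))"
          by (rule hom[OF Phi_E[OF homog]])
        also have "\<dots> = sc (of_real (r i) * of_real (r i) * of_real (c i)) x"
          using homog Psi_in by (simp add: hom[OF homog] scale c[OF homog] r_neg mult.assoc)
        finally show ?thesis by (simp add: rr)
      qed (simp add: z)
    qed (simp add: Phi_add Phi_in)
    show "B (\<Phi> x) (\<Phi> y) = cnj (B x y)" if "x \<in> C" "y \<in> C" for x y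
      using that(1)
    proof (induction rule: grade_induct)
      case x: (homog i x)
      show ?case
        using that(2)
      proof (induction rule: grade_induct)
        case y: (homog j y)
        have C: "x \<in> C" "y \<in> C" "\<Psi> x \<in> C" "\<Psi> y \<in> C" using x y Psi_in by auto
        have "B (\<Psi> x) (\<Psi> y) = HH (\<Psi> y) x" using C by (simp add: Psi)
        also have "\<dots> = cnj (HH x (\<Psi> y))" by (rule HH_cnj) (use C in auto)
        also have "HH x (\<Psi> y) = B (\<Psi> (\<Psi> y)) x" using C by (simp add: Psi)
        also have "\<dots> = of_real (c j) * B x y" using C B_symmetric[of x y] by (simp add: c[OF y])
        finally have *: "B (\<Psi> x) (\<Psi> y) = of_real (c j) * cnj (B x y)" by simp
        have **: "B (\<Phi> x) (\<Phi> y) = (of_real (r i) * of_real (r j) * of_real (c j)) * cnj (B x y)"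
          using C by (simp add: hom[OF x] hom[OF y] *)
        show ?case
        proof (cases "(i + j) mod int p = 0 \<and> x \<noteq> 0")
          case True
          then have "j mod int p = (- i) mod int p"
            by (simp add: mod_eq_dvd_iff dvd_eq_mod_eq_0 add.commute)
          then have "c j = c (- i)" using per[of j] per[of "- i"] by simp
          then have "c j = c i" using c_neg[OF x] True by simp
          then have "r j = r i" by (simp add: r_def)
          then show ?thesis unfolding ** using \<open>c j = c i\<close> by (simp add: rr)
        next
          case False
          then have "B x y = 0" using B_E_orthogonal[OF x y] y by auto
          then show ?thesis unfolding ** by simp
        qed
      qed (use x Phi_in in \<open>simp add: B_add_right Phi_add\<close>)
    qed (use that Phi_in in \<open>simp add: B_add_left Phi_add\<close>)
    show "Re (B x (\<Phi> x)) > 0" if "x \<in> E i" "x \<noteq> 0" for i x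
      using that HH_pos[of x] r_pos[of i] Psi_in by (simp add: hom[OF that(1)] norm)
    show "\<Phi> (md a n x) = md (\<Phi> a) n (\<Phi> x)" if a: "a \<in> E 0" and "x \<in> C" for a n x
      using that(2)
    proof (induction rule: grade_induct)
      case x: (homog i x)
      have "\<phi> a \<in> C" using phi_E[OF a] by (rule E_in)
      then show ?case
        using E_mode[OF a x, of n] x Psi_in
        by (simp add: Phi_0[OF a] hom[OF x] hom[of _ i] mode[OF a] mode_scale_right)
    next
      case (add x y)
      moreover have "\<phi> a \<in> C" using phi_E[OF a] by (rule E_in)
      ultimately show ?case using a Phi_in
        by (simp add: mode_add_right Phi_add Phi_0)
    qed
    show "\<Phi> (vac V) = vac V" "\<Phi> (conf V) = conf V" by (simp_all add: Phi_0)
  qed (fact Phi_in Phi_add Phi_scale Phi_E)+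
  then show ?thesis by blast
qed

end

text \<open>Because \<open>h\<close> commutes with \<open>f\<close>, its Fourier projections
  preserve each eigenspace of \<open>f\<close> and split it into joint eigenspaces.\<close>

lemma eigen1_eq:
  fixes V :: "('v::ab_group_add) voa_data"
  assumes "voa_cyclic V f p" "voa_cyclic V h p" and comm: "\<And>v. v \<in> carr V \<Longrightarrow> f (h v) = h (f v)"
  shows "eigen1 V p f h i = voa_cyclic.E V f p i"
proof -
  interpret F: voa_cyclic V f p by fact
  interpret G: voa_cyclic V h p by fact
  have e2: "eigen2 V p f h i j = F.E i \<inter> G.E j" for i j
    unfolding eigen2_def F.E_def G.E_def by blast
  have "x \<in> F.E i" if "x \<in> eigen1 V p f h i" for x
    using that by (auto simp: eigen1_def e2 intro!: F.E_sum)
  moreover have "x \<in> eigen1 V p f h i" if x: "x \<in> F.E i" for x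
  proof -
    have "f (G.P j y) = G.P j (f y)" if "y \<in> F.C" for j y
    proof -
      have "f ((h ^^ l) y) = (h ^^ l) (f y)" for l
        using that comm by (induction l) auto
      then show ?thesis using that by (simp add: G.P_def F.f_scale F.f_sum)
    qed
    then have "G.P j x \<in> F.E i" for j
      using x by (intro F.E_I) (auto simp: F.E_f G.P_scale)
    then have "\<forall>j<p. G.P (int j) x \<in> eigen2 V p f h i (int j)"
      using x G.P_E by (simp add: e2)
    moreover have "x = (\<Sum>j<p. G.P (int j) x)" using G.P_sum x by simp
    ultimately show ?thesis unfolding eigen1_def by blast
  qed
  ultimately show ?thesis by blast
qed

section \<open>The unitary structure from the stated hypotheses\<close>

theorem theorem5p3:
  fixes V :: "('v::ab_group_add) voa_data"
    and f h \<phi> \<psi> :: "'v \<Rightarrow> 'v"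
    and p :: nat
  assumes "p > 0"
    and "voa V" and "self_dual V" and "simple_voa V" and "CFT_type V"
    and "voa_automorphism V f" and "has_order_on (carr V) f p"
    and "voa_automorphism V h" and "has_order_on (carr V) h p"
    and "\<forall>v\<in>carr V. f (h v) = h (f v)"
    and A: "antilinear_involution (restrict_voa V (eigen1 V p f h 0)) \<phi>"
      "unitary_voa (restrict_voa V (eigen1 V p f h 0)) \<phi>"
    and B: "\<forall>i\<in>{1..int p - 1}.
      unitary_module (restrict_voa V (eigen1 V p f h 0)) \<phi> (restrict_module V (eigen1 V p f h i))"
    and C: "voa_automorphism V \<psi>"
      "\<forall>v\<in>carr V. inv_into (carr V) \<psi> (f (\<psi> v)) = h v"
    and D: "\<psi> ` eigen2 V p f h 0 0 = eigen2 V p f h 0 0"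
      "\<forall>v\<in>eigen2 V p f h 0 0. \<psi> (\<phi> (inv_into (carr V) \<psi> v)) = \<phi> v"
  shows "\<exists>\<Phi>. antilinear_involution V \<Phi> \<and> unitary_voa V \<Phi>"
proof -
  have cyclic: "voa_cyclic V f p" "voa_cyclic V h p"
    using assms by (auto simp: voa_cyclic_def voa_cyclic_axioms_def has_order_on_def)
  obtain b where "voa_form V b" using self_dual_form assms by blast
  then interpret voa_form_cyclic V b f p
    using cyclic by (simp add: voa_form_cyclic_def)
  have eig: "eigen1 V p f h i = E i" for i
    by (rule eigen1_eq) (use cyclic assms in auto)
  have "\<exists>H. pos_def_hermitian (scal V) (E (int i)) H \<and>
      invariant_form (restrict_voa V (E 0)) \<phi> (restrict_module V (E (int i))) H" if "i < p" for i
  \<comment> \<open>Degree 0 takes its form from the unitarity of V^0 itself, the other degrees from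
    the module hypotheses.\<close>
  proof (cases "i = 0")
    case True
    have "adjoint_module (restrict_voa V (E 0)) = restrict_module V (E 0)"
      by (simp add: adjoint_module_def restrict_voa_def restrict_module_def)
    then show ?thesis using A(2) True by (auto simp: eig unitary_voa_def restrict_voa_def)
  next
    case False
    then have "unitary_module (restrict_voa V (E 0)) \<phi> (restrict_module V (E (int i)))"
      using B that by (simp add: eig)
    then show ?thesis by (auto simp: unitary_module_def restrict_module_def adjoint_module_def)
  qed
  then obtain H where H: "\<forall>i<p. pos_def_hermitian (scal V) (E (int i)) (H i) \<and>
      invariant_form (restrict_voa V (E 0)) \<phi> (restrict_module V (E (int i))) (H i)"
    by metis
  interpret voa_unitary_pieces V b f p \<phi> H
    by unfold_locales (use A(1) H in \<open>auto simp: eig\<close>)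
  obtain \<Phi> where "voa_conjugation V b f p \<Phi>" using conjugation_exists by blast
  then show ?thesis by (rule voa_conjugation.unitary_structure)
qed

end
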